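(* Fix $2<p<\infty$ and $\alpha>0$, and let $X=\{(\lambda,m_\lambda)\}_{\lambda\in\Lambda}$ denote a divisor. (a) If $X$ is an interpolating divisor for $\mathcal F^p_\alpha$, then there exists $C=C(M_X)>0$ (depending only on the interpolation constant $M_X$, for the fixed $p$ and $\alpha$) such that the discs $\{D(\lambda,\sqrt{m_\lambda/\alpha}-C)\}_{\lambda\in\Lambda,\ m_\lambda>\alpha C^2}$ are pairwise disjoint. (b) Conversely, there exists $C_0>0$ (independent of $X$) such that if the discs $\{D(\lambda,\sqrt{m_\lambda/\alpha}+C_0)\}_{\lambda\in\Lambda}$ are pairwise disjoint, then $X$ is an interpolating divisor for $\mathcal F^p_\alpha$.
   Context: $D(z,r)$ is the open disc of radius $r$ centered at $z\in\mathbb C$; $dm$ is Lebesgue area measure. $\mathcal F^p_\alpha$ is the Banach space of entire functions $f$ such that $f(z)e^{-\alpha|z|^2/2}\in L^p(\mathbb C)$, with $\|f\|_p^p=\int_{\mathbb C}|f(z)|^pe^{-p\alpha|z|^2/2}dm(z)$. A divisor is $X=\{(\lambda,m_\lambda)\}_{\lambda\in\Lambda}$, where $\Lambda$ is a sequence of (distinct) points in $\mathbb C$ and $m_\lambda\in\{1,2,3,\dots\}$ is the multiplicity associated with $\lambda$. Put $N^p_\lambda=\{f\in\mathcal F^p_\alpha: f(\lambda)=f'(\lambda)=\dots=f^{(m_\lambda-1)}(\lambda)=0\}$, and let $\|f\|_{\mathcal F^p_\alpha/N^p_\lambda}=\inf_{g\in N^p_\lambda}\|f-g\|_p$ be the quotient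 norm. $X$ is called interpolating for $\mathcal F^p_\alpha$ if for every family $(f_\lambda)_{\lambda\in\Lambda}\subset\mathcal F^p_\alpha$ with $\sum_{\lambda\in\Lambda}\|f_\lambda\|^p_{\mathcal F^p_\alpha/N^p_\lambda}<\infty$ there exists $f\in\mathcal F^p_\alpha$ such that $f-f_\lambda\in N^p_\lambda$ for all $\lambda\in\Lambda$. In that case, the interpolation constant $M_X$ is the minimal constant $C'$ such that one can always find such an $f$ with $\|f\|_p\le C'\bigl(\sum_{\lambda\in\Lambda}\|f_\lambda\|^p_{\mathcal F^p_\alpha/N^p_\lambda}\bigr)^{1/p}$. *)

theory Defs
  imports "HOL-Complex_Analysis.Complex_Analysis"
begin

definition fock_space :: "real \<Rightarrow> real \<Rightarrow> (complex \<Rightarrow> complex) set" where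
  "fock_space p \<alpha> = {f. f holomorphic_on UNIV \<and>
     integrable lborel (\<lambda>z. (cmod (f z) * exp (- \<alpha> * (cmod z)\<^sup>2 / 2)) powr p)}"

definition fock_norm :: "real \<Rightarrow> real \<Rightarrow> (complex \<Rightarrow> complex) \<Rightarrow> real" where
  "fock_norm p \<alpha> f =
     (LINT z|lborel. cmod (f z) powr p * exp (- p * \<alpha> * (cmod z)\<^sup>2 / 2)) powr (1 / p)"

text \<open>A divisor \<open>X = {(\<lambda>, m\<^sub>\<lambda>)}\<close> is given by the set \<open>\<Lambda>\<close> of its points, finite or countably
  infinite, and a multiplicity function \<open>m\<close> whose values outside \<open>\<Lambda>\<close> play no role.\<close>

definition divisor :: "complex set \<Rightarrow> (complex \<Rightarrow> nat) \<Rightarrow> bool" where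
  "divisor \<Lambda> m \<longleftrightarrow> countable \<Lambda> \<and> (\<forall>l\<in>\<Lambda>. m l \<ge> 1)"

definition vanishing_space :: "real \<Rightarrow> real \<Rightarrow> (complex \<Rightarrow> nat) \<Rightarrow> complex \<Rightarrow> (complex \<Rightarrow> complex) set" where
  "vanishing_space p \<alpha> m l = {f \<in> fock_space p \<alpha>. \<forall>j<m l. (deriv ^^ j) f l = 0}"

definition quotient_norm ::
  "real \<Rightarrow> real \<Rightarrow> (complex \<Rightarrow> nat) \<Rightarrow> complex \<Rightarrow> (complex \<Rightarrow> complex) \<Rightarrow> real" where
  "quotient_norm p \<alpha> m l f = (INF g\<in>vanishing_space p \<alpha> m l. fock_norm p \<alpha> (\<lambda>z. f z - g z))"

definition admissible_data ::
  "real \<Rightarrow> real \<Rightarrow> complex set \<Rightarrow> (complex \<Rightarrow> nat) \<Rightarrow> (complex \<Rightarrow> complex \<Rightarrow> complex) \<Rightarrow> bool" where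
  "admissible_data p \<alpha> \<Lambda> m F \<longleftrightarrow> (\<forall>l\<in>\<Lambda>. F l \<in> fock_space p \<alpha>) \<and>
     (\<lambda>l. quotient_norm p \<alpha> m l (F l) powr p) summable_on \<Lambda>"

definition interpolates ::
  "real \<Rightarrow> real \<Rightarrow> complex set \<Rightarrow> (complex \<Rightarrow> nat) \<Rightarrow> (complex \<Rightarrow> complex \<Rightarrow> complex)
     \<Rightarrow> (complex \<Rightarrow> complex) \<Rightarrow> bool" where
  "interpolates p \<alpha> \<Lambda> m F f \<longleftrightarrow> f \<in> fock_space p \<alpha> \<and>
     (\<forall>l\<in>\<Lambda>. (\<lambda>z. f z - F l z) \<in> vanishing_space p \<alpha> m l)"

definition interpolating ::
  "real \<Rightarrow> real \<Rightarrow> complex set \<Rightarrow> (complex \<Rightarrow> nat) \<Rightarrow> bool" where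
  "interpolating p \<alpha> \<Lambda> m \<longleftrightarrow>
     (\<forall>F. admissible_data p \<alpha> \<Lambda> m F \<longrightarrow> (\<exists>f. interpolates p \<alpha> \<Lambda> m F f))"

text \<open>For an interpolating divisor some constant is admissible (open mapping theorem) and the
  infimum is attained (normal families and Fatou's lemma), so the infimum below is the minimal
  constant. The bound \<open>0 \<le> C\<close> only matters when all data have quotient norm zero,
  e.g. when \<open>\<Lambda>\<close> is empty.\<close>

definition interpolation_constant ::
  "real \<Rightarrow> real \<Rightarrow> complex set \<Rightarrow> (complex \<Rightarrow> nat) \<Rightarrow> real" where
  "interpolation_constant p \<alpha> \<Lambda> m = Inf {C. 0 \<le> C \<and>
     (\<forall>F. admissible_data p \<alpha> \<Lambda> m F \<longrightarrow>
       (\<exists>f. interpolates p \<alpha> \<Lambda> m F f \<and>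
         fock_norm p \<alpha> f \<le> C * (\<Sum>\<^sub>\<infinity>l\<in>\<Lambda>. quotient_norm p \<alpha> m l (F l) powr p) powr (1 / p)))}"

end

theory Submission
  imports Defs "HOL-Probability.Probability"
begin

text \<open>
  Write \<open>|f|\<^sub>w = |f| e\<^bsup>-\<alpha>|z|\<^sup>2/2\<^esup>\<close>. Weyl translations preserve it and move any point to the origin.

  Necessity. If \<open>f\<close> vanishes to order \<open>m\<close> at \<open>\<lambda>\<close> and \<open>|f|\<^sub>w \<le> K\<close>, the maximum principle gives
  \<open>|f|\<^sub>w \<le> K e\<^bsup>-\<alpha>t\<^sup>2/2\<^esup>\<close> at depth \<open>t\<close> inside the disc of radius \<open>(m/\<alpha>)\<^bsup>1/2\<^esup>\<close>. Interpolate the normalised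
  reproducing kernel at a point \<open>w\<close> deep inside two such discs at one centre and \<open>0\<close> at the other:
  the interpolant is at once close to the kernel and close to \<open>0\<close> at \<open>w\<close>.

  Sufficiency. Let \<open>f\<close> be the interpolant of least norm for a finite part of the divisor. It is
  annihilating: \<open>g \<mapsto> \<integral> g f\<^sup>* |f|\<^bsup>p-2\<^esup> e\<^bsup>-p\<alpha>|z|\<^sup>2/2\<^esup>\<close> kills all \<open>g\<close> that vanish on the divisor, so it is a sum
  of functionals attached to the points, each given by a polynomial of degree less than \<open>m\<close> around its
  point. Outside the disc of radius \<open>(m/\<alpha>)\<^bsup>1/2\<^esup>\<close> such a polynomial has a Gaussian tail in the dual norm,
  since suitably normalised circle means decrease; hence for well separated discs the dual norms of the
  pieces add up, up to a constant, to at most the dual norm of the sum, and Young's inequality bounds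
  \<open>f\<close> by the data. Normal families pass to countable divisors.
\<close>

subsection \<open>Lebesgue measure on the complex plane\<close>

text \<open>The multiplicities are unbounded, so in the sufficiency part no constant may depend on
  them, and every estimate must balance m against \<alpha> r^2 with r = sqrt (m / \<alpha>), the
  radius where x^m exp (-\<alpha> x^2 / 2) peaks. The pieces of the annihilating functional are made
  visible by coherent states: on the state centred at z, the piece of a point l has, up to a
  constant, the modulus of a polynomial in z - l times a Gaussian. As p and s are conjugate,
  (|f|^(p-1))^s = |f|^p, so Young's convolution inequality bounds the L^s norm of the sum of the
  pieces by the mass of f itself. Testing the functional on f gives exactly that mass, so a small
  multiple of it can be absorbed. In the necessity part the interpolation constant is an infimum of
  real numbers, which says something only if some constant is admissible at all. This is shown by a
  gliding hump instead of the open mapping theorem; the constants there may depend on the divisor,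
  because only finiteness is at stake.\<close>

lemma lborel_complex_eq:
  "(lborel :: complex measure) = distr (lborel \<Otimes>\<^sub>M lborel) borel (\<lambda>p. Complex (fst p) (snd p))"
proof (rule lborel_eqI)
  have [measurable]: "(\<lambda>p. Complex (fst p) (snd p)) \<in> borel_measurable (borel \<Otimes>\<^sub>M borel)"
    unfolding borel_prod by (intro borel_measurable_continuous_onI continuous_intros)
  fix l u :: complex assume "\<And>b. b \<in> Basis \<Longrightarrow> l \<bullet> b \<le> u \<bullet> b"
  from this[of 1] this[of \<i>] have le: "Re l \<le> Re u" "Im l \<le> Im u"
    by (auto simp: Basis_complex_def)
  have eq: "(\<lambda>p. Complex (fst p) (snd p)) -` box l u = box (Re l) (Re u) \<times> box (Im l) (Im u)"
    by (auto simp: box_def Basis_complex_def)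
  show "emeasure (distr (lborel \<Otimes>\<^sub>M lborel) borel (\<lambda>p. Complex (fst p) (snd p))) (box l u)
        = (\<Prod>b\<in>Basis. (u - l) \<bullet> b)"
    using le by (subst emeasure_distr)
      (auto simp: eq space_pair_measure lborel.emeasure_pair_measure_Times Basis_complex_def ennreal_mult')
qed simp

lemma nn_integral_complex_fubini:
  fixes f :: "complex \<Rightarrow> ennreal"
  assumes [measurable]: "f \<in> borel_measurable borel"
  shows "(\<integral>\<^sup>+z. f z \<partial>lborel) = (\<integral>\<^sup>+x. \<integral>\<^sup>+y. f (Complex x y) \<partial>lborel \<partial>lborel)"
    and "(\<integral>\<^sup>+z. f z \<partial>lborel) = (\<integral>\<^sup>+y. \<integral>\<^sup>+x. f (Complex x y) \<partial>lborel \<partial>lborel)"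
proof -
  have [measurable]: "(\<lambda>p. Complex (fst p) (snd p)) \<in> borel_measurable (borel \<Otimes>\<^sub>M borel)"
    unfolding borel_prod by (intro borel_measurable_continuous_onI continuous_intros)
  have "(\<integral>\<^sup>+z. f z \<partial>lborel) = (\<integral>\<^sup>+p. f (Complex (fst p) (snd p)) \<partial>(lborel \<Otimes>\<^sub>M lborel))"
    by (subst lborel_complex_eq, subst nn_integral_distr) auto
  moreover have [measurable]: "(\<lambda>p. f (Complex (fst p) (snd p))) \<in> borel_measurable (lborel \<Otimes>\<^sub>M lborel)"
    by simp
  ultimately show
    "(\<integral>\<^sup>+z. f z \<partial>lborel) = (\<integral>\<^sup>+x. \<integral>\<^sup>+y. f (Complex x y) \<partial>lborel \<partial>lborel)"
    "(\<integral>\<^sup>+z. f z \<partial>lborel) = (\<integral>\<^sup>+y. \<integral>\<^sup>+x. f (Complex x y) \<partial>lborel \<partial>lborel)"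
    using lborel.nn_integral_fst[of "\<lambda>p. f (Complex (fst p) (snd p))" lborel]
      lborel_pair.nn_integral_snd[of "\<lambda>p. f (Complex (fst p) (snd p))"] by auto
qed

text \<open>A rotation is a product of three shears, and shears preserve area by Fubini.\<close>

lemma nn_integral_rotate_aux:
  fixes f :: "complex \<Rightarrow> ennreal"
  assumes [measurable]: "f \<in> borel_measurable borel" and c: "cmod c = 1" "c \<noteq> -1"
  shows "(\<integral>\<^sup>+z. f (c * z) \<partial>lborel) = (\<integral>\<^sup>+z. f z \<partial>lborel)"
proof -
  have tr: "(\<integral>\<^sup>+x. g (x + t) \<partial>lborel) = (\<integral>\<^sup>+x. g x \<partial>lborel)"
    if "g \<in> borel_measurable borel" for g :: "real \<Rightarrow> ennreal" and t
    using nn_integral_real_affine[OF that, of 1 t] by (simp add: add.commute)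
  have [measurable]: "(\<lambda>y. Complex x y) \<in> borel_measurable borel" "(\<lambda>x. Complex x y) \<in> borel_measurable borel" for x y
    by (intro borel_measurable_continuous_onI continuous_intros)+
  have hor: "(\<integral>\<^sup>+z. g (Complex (Re z + a * Im z) (Im z)) \<partial>lborel) = (\<integral>\<^sup>+z. g z \<partial>lborel)"
    if g[measurable]: "g \<in> borel_measurable borel" for g :: "complex \<Rightarrow> ennreal" and a
  proof -
    have [measurable]: "(\<lambda>z. Complex (Re z + a * Im z) (Im z)) \<in> borel_measurable borel"
      by (intro borel_measurable_continuous_onI continuous_intros)
    show ?thesis
      by (subst (1 2) nn_integral_complex_fubini(2)) (simp_all add: tr[of "\<lambda>x. g (Complex x _)"])
  qed
  have ver: "(\<integral>\<^sup>+z. g (Complex (Re z) (Im z + b * Re z)) \<partial>lborel) = (\<integral>\<^sup>+z. g z \<partial>lborel)"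
    if g[measurable]: "g \<in> borel_measurable borel" for g :: "complex \<Rightarrow> ennreal" and b
  proof -
    have [measurable]: "(\<lambda>z. Complex (Re z) (Im z + b * Re z)) \<in> borel_measurable borel"
      by (intro borel_measurable_continuous_onI continuous_intros)
    show ?thesis
      by (subst (1 2) nn_integral_complex_fubini(1)) (simp_all add: tr[of "\<lambda>x. g (Complex _ x)"])
  qed
  \<comment> \<open>For c = cis t these parameters are -tan (t/2) and sin t, so that the shears
    compose to the rotation as H V H; the tangent blows up at the excluded value c = -1.\<close>
  define a where "a = - Im c / (1 + Re c)"
  define b where "b = Im c"
  have n: "(Re c)\<^sup>2 + (Im c)\<^sup>2 = 1" using c(1) by (metis cmod_power2 one_power2)
  have pos: "1 + Re c \<noteq> 0"
  proof
    assume "1 + Re c = 0"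
    then have "Re c = -1" by simp
    with n have "Im c = 0" by simp
    with \<open>Re c = -1\<close> c(2) show False by (simp add: complex_eq_iff)
  qed
  have e1: "1 + a * b = Re c" using n pos by (simp add: a_def b_def field_simps power2_eq_square)
  have e2: "a * (1 + a * b) + a = - Im c"
  proof -
    have "a * (1 + a * b) + a = a * (1 + Re c)" unfolding e1 by (simp add: algebra_simps)
    also have "\<dots> = - Im c" using pos by (simp add: a_def)
    finally show ?thesis .
  qed
  define H where "H = (\<lambda>z. Complex (Re z + a * Im z) (Im z))"
  define V where "V = (\<lambda>z. Complex (Re z) (Im z + b * Re z))"
  have HVH: "H (V (H z)) = c * z" for z
  proof -
    have "Re (H (V (H z))) = (1 + a * b) * Re z + (a * (1 + a * b) + a) * Im z"
      by (simp add: H_def V_def algebra_simps)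
    moreover have "Im (H (V (H z))) = b * Re z + (1 + a * b) * Im z"
      by (simp add: H_def V_def algebra_simps)
    ultimately have "Re (H (V (H z))) = Re c * Re z + (- Im c) * Im z" "Im (H (V (H z))) = b * Re z + Re c * Im z"
      by (simp_all only: e1 e2[unfolded e1])
    then show ?thesis by (simp add: complex_eq_iff b_def)
  qed
  have [measurable]: "H \<in> borel_measurable borel" "V \<in> borel_measurable borel" unfolding H_def V_def
    by (intro borel_measurable_continuous_onI continuous_intros)+
  have hor': "(\<integral>\<^sup>+z. g (H z) \<partial>lborel) = (\<integral>\<^sup>+z. g z \<partial>lborel)"
    if "g \<in> borel_measurable borel" for g :: "complex \<Rightarrow> ennreal"
    using hor[OF that, of a] unfolding H_def .
  have ver': "(\<integral>\<^sup>+z. g (V z) \<partial>lborel) = (\<integral>\<^sup>+z. g z \<partial>lborel)"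
    if "g \<in> borel_measurable borel" for g :: "complex \<Rightarrow> ennreal"
    using ver[OF that, of b] unfolding V_def .
  have "(\<integral>\<^sup>+z. f (c * z) \<partial>lborel) = (\<integral>\<^sup>+z. f (H (V (H z))) \<partial>lborel)" by (simp add: HVH)
  also have "\<dots> = (\<integral>\<^sup>+z. f (H (V z)) \<partial>lborel)" by (rule hor'[of "\<lambda>z. f (H (V z))"]) simp
  also have "\<dots> = (\<integral>\<^sup>+z. f (H z) \<partial>lborel)" by (rule ver'[of "\<lambda>z. f (H z)"]) simp
  also have "\<dots> = (\<integral>\<^sup>+z. f z \<partial>lborel)" by (rule hor') simp
  finally show ?thesis .
qed

lemma nn_integral_rotate:
  fixes f :: "complex \<Rightarrow> ennreal"
  assumes [measurable]: "f \<in> borel_measurable borel" and c: "cmod c = 1"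
  shows "(\<integral>\<^sup>+z. f (c * z) \<partial>lborel) = (\<integral>\<^sup>+z. f z \<partial>lborel)"
proof (cases "c = -1")
  case True
  \<comment> \<open>The remaining rotation, by -1, is the square of the rotation by \<i>.\<close>
  have "(\<integral>\<^sup>+z. f (\<i> * (\<i> * z)) \<partial>lborel) = (\<integral>\<^sup>+z. f (\<i> * z) \<partial>lborel)"
    by (rule nn_integral_rotate_aux[of "\<lambda>z. f (\<i> * z)"]) (auto simp: complex_eq_iff)
  also have "\<dots> = (\<integral>\<^sup>+z. f z \<partial>lborel)"
    by (rule nn_integral_rotate_aux) (auto simp: complex_eq_iff)
  finally show ?thesis using True by (simp flip: mult.assoc)
qed (use nn_integral_rotate_aux assms in blast)

lemma lborel_rotate:
  assumes "cmod c = 1" shows "distr lborel lborel ((*) c) = lborel"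
proof (rule measure_eqI)
  fix A assume "A \<in> sets (distr lborel lborel ((*) c))"
  then have [measurable]: "A \<in> sets borel" by simp
  have "emeasure (distr lborel lborel ((*) c)) A = (\<integral>\<^sup>+z. indicator A z \<partial>distr lborel lborel ((*) c))"
    by simp
  also have "\<dots> = (\<integral>\<^sup>+z. indicator A (c * z) \<partial>lborel)"
    by (subst nn_integral_distr) auto
  also have "\<dots> = emeasure lborel A"
    using assms by (subst nn_integral_rotate) auto
  finally show "emeasure (distr lborel lborel ((*) c)) A = emeasure lborel A" .
qed simp

lemma integral_rotate:
  fixes f :: "complex \<Rightarrow> 'b :: {banach, second_countable_topology}"
  assumes [measurable]: "f \<in> borel_measurable borel" and "cmod c = 1"
  shows "(LINT z|lborel. f (c * z)) = (LINT z|lborel. f z)"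
  using integral_distr[of "(*) c" lborel lborel f] lborel_rotate[OF assms(2)] by simp

lemma
  fixes f :: "complex \<Rightarrow> 'b :: {banach, second_countable_topology}"
  assumes [measurable]: "f \<in> borel_measurable borel"
  shows integral_translate: "(LINT z|lborel. f (l + z)) = (LINT z|lborel. f z)"
    and integrable_translate_iff: "integrable lborel (\<lambda>z. f (l + z)) \<longleftrightarrow> integrable lborel f"
proof -
  have d: "distr lborel lborel ((+) l) = (lborel :: complex measure)"
    using lborel_distr_plus[of l] by (simp cong: distr_cong)
  show "(LINT z|lborel. f (l + z)) = (LINT z|lborel. f z)"
    using integral_distr[of "(+) l" lborel lborel f] d by simp
  show "integrable lborel (\<lambda>z. f (l + z)) \<longleftrightarrow> integrable lborel f"
    using integrable_distr_eq[of "(+) l" lborel lborel f] d by simp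
qed

lemma nn_integral_translate:
  fixes f :: "complex \<Rightarrow> ennreal"
  assumes [measurable]: "f \<in> borel_measurable borel"
  shows "(\<integral>\<^sup>+z. f (l + z) \<partial>lborel) = (\<integral>\<^sup>+z. f z \<partial>lborel)"
proof -
  have d: "distr lborel lborel ((+) l) = (lborel :: complex measure)"
    using lborel_distr_plus[of l] by (simp cong: distr_cong)
  show ?thesis using nn_integral_distr[of "(+) l" lborel lborel f] d by simp
qed

lemma nn_integral_dilate:
  fixes f :: "complex \<Rightarrow> ennreal"
  assumes [measurable]: "f \<in> borel_measurable borel" and k: "k > 0"
  shows "(\<integral>\<^sup>+z. f z \<partial>lborel) = ennreal (k\<^sup>2) * (\<integral>\<^sup>+z. f (of_real k * z) \<partial>lborel)"
proof -
  have "(lborel :: complex measure) = density (distr lborel borel (\<lambda>x. 0 + k *\<^sub>R x)) (\<lambda>_. \<bar>k\<bar>^DIM(complex))"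
    using k by (intro lborel_affine) auto
  then have e: "(lborel :: complex measure) = density (distr lborel borel (\<lambda>x. of_real k * x)) (\<lambda>_. ennreal (k\<^sup>2))"
    by (simp add: scaleR_conv_of_real)
  show ?thesis
    by (subst e, subst nn_integral_density) (auto simp: nn_integral_distr nn_integral_cmult)
qed

lemma integrable_gauss:
  assumes "b > 0" shows "integrable lborel (\<lambda>z. exp (- b * (cmod z)\<^sup>2))"
proof -
  define I where "I = (\<integral>\<^sup>+x. ennreal (exp (- b * x\<^sup>2)) \<partial>(lborel :: real measure))"
  have "integrable lborel (\<lambda>x. exp (- b * x\<^sup>2))"
  proof -
    define s where "s = sqrt (1 / (2 * b))"
    have s: "s > 0" "s\<^sup>2 = 1 / (2 * b)" using assms by (auto simp: s_def)
    have "integrable lborel (\<lambda>x. sqrt (2 * pi * s\<^sup>2) * normal_density 0 s x)"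
      using s(1) by (intro integrable_mult_right integrable_normal_density)
    also have "(\<lambda>x. sqrt (2 * pi * s\<^sup>2) * normal_density 0 s x) = (\<lambda>x. exp (- b * x\<^sup>2))"
      using s assms by (auto simp: normal_density_def fun_eq_iff mult.commute)
    finally show ?thesis .
  qed
  then have fin: "I < \<infinity>" unfolding I_def integrable_iff_bounded by simp
  have "(\<integral>\<^sup>+z. ennreal (exp (- b * (cmod z)\<^sup>2)) \<partial>lborel) =
     (\<integral>\<^sup>+x. \<integral>\<^sup>+y. ennreal (exp (- b * x\<^sup>2)) * ennreal (exp (- b * y\<^sup>2)) \<partial>lborel \<partial>lborel)"
    by (subst nn_integral_complex_fubini(1)) (simp_all add: cmod_power2 exp_add[symmetric] ennreal_mult'[symmetric] algebra_simps)
  also have "\<dots> = I * I" by (simp add: nn_integral_cmult nn_integral_multc I_def)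
  also have "\<dots> < \<infinity>" using fin by (simp add: ennreal_mult_less_top)
  finally show ?thesis by (simp add: integrable_iff_bounded)
qed

subsection \<open>Zeros of entire functions\<close>

text \<open>Divisibility instead of vanishing derivatives: sums, multiples and translations then
  need no Leibniz rule. \<open>vanish_iff\<close> links it to the derivatives in the definition of
  the vanishing space.\<close>

definition vanish :: "complex \<Rightarrow> nat \<Rightarrow> (complex \<Rightarrow> complex) \<Rightarrow> bool" where
  "vanish l m f \<longleftrightarrow> (\<exists>g. g holomorphic_on UNIV \<and> (\<forall>z. f z = (z - l) ^ m * g z))"

lemma entire_factor:
  assumes "f holomorphic_on UNIV"
  obtains g where "g holomorphic_on UNIV" "\<And>z. f z = f l + (z - l) * g z"
proof
  show "(\<lambda>z. if z = l then deriv f l else (f z - f l) / (z - l)) holomorphic_on UNIV"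
    using pole_lemma[of f UNIV l] assms by simp
qed auto

lemma entire_taylor:
  assumes "f holomorphic_on UNIV"
  obtains c g where "g holomorphic_on UNIV" "\<And>z. f z = (\<Sum>i<m. c i * (z - l) ^ i) + (z - l) ^ m * g z"
proof -
  have "\<exists>c g. g holomorphic_on UNIV \<and> (\<forall>z. f z = (\<Sum>i<m. c i * (z - l) ^ i) + (z - l) ^ m * g z)"
  proof (induction m)
    case 0
    then show ?case using assms by auto
  next
    case (Suc m)
    then obtain c g where g: "g holomorphic_on UNIV" "\<And>z. f z = (\<Sum>i<m. c i * (z - l) ^ i) + (z - l) ^ m * g z"
      by blast
    obtain h where h: "h holomorphic_on UNIV" "\<And>z. g z = g l + (z - l) * h z"
      using entire_factor[OF g(1)] by blast
    have "f z = (\<Sum>i<Suc m. (c(m := g l)) i * (z - l) ^ i) + (z - l) ^ Suc m * h z" for z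
      using g(2)[of z] h(2)[of z] by (simp add: algebra_simps)
    with h(1) show ?case by blast
  qed
  then show ?thesis using that by blast
qed

lemma higher_deriv_power_mult:
  assumes "g holomorphic_on UNIV"
  shows "j < m \<Longrightarrow> (deriv ^^ j) (\<lambda>z. (z - l) ^ m * g z) l = 0"
    and "(deriv ^^ m) (\<lambda>z. (z - l) ^ m * g z) l = fact m * g l"
proof -
  have 1: "(deriv ^^ j) (\<lambda>z. (z - l) ^ m * g z) l
     = (\<Sum>i = 0..j. of_nat (j choose i) * (deriv ^^ i) (\<lambda>z. (z - l) ^ m) l * (deriv ^^ (j - i)) g l)" for j
    by (rule higher_deriv_mult[of _ UNIV]) (use assms in \<open>auto intro!: holomorphic_intros\<close>)
  have 2: "(deriv ^^ i) (\<lambda>z. (z - l) ^ m) l = (if i = m then fact m else 0)" if "i \<le> m" for i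
    using that by (subst higher_deriv_power) (auto simp: pochhammer_fact)
  show "(deriv ^^ j) (\<lambda>z. (z - l) ^ m * g z) l = 0" if "j < m"
    unfolding 1 using that by (intro sum.neutral) (auto simp: 2)
  have "(deriv ^^ m) (\<lambda>z. (z - l) ^ m * g z) l = (\<Sum>i = 0..m. if i = m then fact m * g l else 0)"
    unfolding 1 by (intro sum.cong) (auto simp: 2)
  then show "(deriv ^^ m) (\<lambda>z. (z - l) ^ m * g z) l = fact m * g l" by simp
qed

lemma vanish_Suc:
  assumes "g holomorphic_on UNIV" "\<And>z. f z = (z - l) ^ m * g z" "g l = 0"
  shows "vanish l (Suc m) f"
proof -
  obtain h where h: "h holomorphic_on UNIV" "\<And>z. g z = g l + (z - l) * h z"
    using entire_factor[OF assms(1)] by blast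
  have "f z = (z - l) ^ Suc m * h z" for z
  proof -
    have "g z = (z - l) * h z" using h(2)[of z] assms(3) by (simp only: add_0)
    then show ?thesis by (simp only: assms(2)[of z] power_Suc mult_ac)
  qed
  then show ?thesis unfolding vanish_def using h(1) by blast
qed

lemma vanish_iff:
  assumes f: "f holomorphic_on UNIV"
  shows "vanish l m f \<longleftrightarrow> (\<forall>j<m. (deriv ^^ j) f l = 0)"
proof
  assume "vanish l m f"
  then obtain g where g: "g holomorphic_on UNIV" "f = (\<lambda>z. (z - l) ^ m * g z)"
    unfolding vanish_def by auto
  show "\<forall>j<m. (deriv ^^ j) f l = 0"
    unfolding g(2) using higher_deriv_power_mult(1)[OF g(1)] by blast
next
  show "\<forall>j<m. (deriv ^^ j) f l = 0 \<Longrightarrow> vanish l m f"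
  proof (induction m)
    case 0
    then show ?case using f by (auto simp: vanish_def)
  next
    case (Suc m)
    then obtain g where g: "g holomorphic_on UNIV" "f = (\<lambda>z. (z - l) ^ m * g z)"
      unfolding vanish_def by auto
    have "fact m * g l = 0"
      using Suc.prems higher_deriv_power_mult(2)[OF g(1), of m l] unfolding g(2) by simp
    then show ?case using g by (intro vanish_Suc[of g]) auto
  qed
qed

lemma vanish_entire: "vanish l m f \<Longrightarrow> f holomorphic_on UNIV"
proof -
  assume "vanish l m f"
  then obtain g where g: "g holomorphic_on UNIV" "f = (\<lambda>z. (z - l) ^ m * g z)"
    unfolding vanish_def by auto
  show ?thesis unfolding g(2) by (intro holomorphic_intros g(1))
qed

lemma vanish_0: "f holomorphic_on UNIV \<Longrightarrow> vanish l 0 f"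
  by (auto simp: vanish_def)

lemma vanish_zero: "vanish l m (\<lambda>z. 0)"
  unfolding vanish_def by (intro exI[of _ "\<lambda>z. 0"]) auto

lemma vanish_add:
  assumes "vanish l m f" "vanish l m g" shows "vanish l m (\<lambda>z. f z + g z)"
proof -
  obtain f' g' where "f' holomorphic_on UNIV" "\<And>z. f z = (z - l) ^ m * f' z"
      "g' holomorphic_on UNIV" "\<And>z. g z = (z - l) ^ m * g' z"
    using assms unfolding vanish_def by blast
  then show ?thesis unfolding vanish_def
    by (intro exI[of _ "\<lambda>z. f' z + g' z"]) (auto intro!: holomorphic_intros simp: algebra_simps)
qed

lemma vanish_mult:
  assumes "vanish l m f" "g holomorphic_on UNIV" shows "vanish l m (\<lambda>z. g z * f z)"
proof -
  obtain f' where "f' holomorphic_on UNIV" "\<And>z. f z = (z - l) ^ m * f' z"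
    using assms unfolding vanish_def by blast
  then show ?thesis unfolding vanish_def using assms(2)
    by (intro exI[of _ "\<lambda>z. g z * f' z"]) (auto intro!: holomorphic_intros)
qed

lemma vanish_cmult: "vanish l m f \<Longrightarrow> vanish l m (\<lambda>z. c * f z)"
  by (rule vanish_mult) (auto intro!: holomorphic_intros)

lemma vanish_sum:
  "(\<And>i. i \<in> I \<Longrightarrow> vanish l m (f i)) \<Longrightarrow> vanish l m (\<lambda>z. \<Sum>i\<in>I. f i z)"
  by (induction I rule: infinite_finite_induct) (auto intro: vanish_add simp: vanish_zero)

subsection \<open>The area mean value property\<close>

text \<open>The rotation by pi / n turns z^n into -z^n and fixes the radial factor, so the integral
  equals its own negative.\<close>

lemma integral_power_radial:
  fixes \<phi> :: "real \<Rightarrow> real"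
  assumes [measurable]: "\<phi> \<in> borel_measurable borel" and n: "n \<noteq> 0"
  shows "(LINT z|lborel. z ^ n * of_real (\<phi> (cmod z)) :: complex) = 0"
proof -
  define c where "c = cis (pi / n)"
  have "c ^ n = cis (real n * (pi / n))" unfolding c_def by (rule Complex.DeMoivre)
  also have "real n * (pi / n) = pi" using n by simp
  finally have c: "c ^ n = -1" by (simp only: cis_pi)
  have c': "cmod c = 1" by (simp add: c_def)
  have "(LINT z|lborel. (c * z) ^ n * of_real (\<phi> (cmod (c * z))) :: complex) =
        (LINT z|lborel. z ^ n * of_real (\<phi> (cmod z)))"
    by (rule integral_rotate) (use c' in auto)
  also have "(\<lambda>z. (c * z) ^ n * of_real (\<phi> (cmod (c * z))) :: complex) = (\<lambda>z. - (z ^ n * of_real (\<phi> (cmod z))))"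
    by (simp add: c c' norm_mult power_mult_distrib)
  finally show ?thesis by simp
qed

text \<open>In the power series of G only the constant term survives integration against a radial
  weight. The cut-off at R justifies termwise integration, because the Taylor coefficients times R^n
  are absolutely summable.\<close>

lemma mean_value_ball:
  fixes \<phi> :: "real \<Rightarrow> real"
  assumes G: "G holomorphic_on UNIV" and [measurable]: "\<phi> \<in> borel_measurable borel"
    and int: "integrable lborel (\<lambda>z::complex. \<phi> (cmod z))" and R: "R > 0"
  defines "\<psi> \<equiv> (\<lambda>t. indicator {..R} t * \<phi> t)"
  shows "(LINT z|lborel. G z * of_real (\<psi> (cmod z))) = G 0 * of_real (LINT z|lborel. \<psi> (cmod (z::complex)))"
proof -
  have [measurable]: "\<psi> \<in> borel_measurable borel" unfolding \<psi>_def by measurable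
  have int': "integrable lborel (\<lambda>z::complex. \<psi> (cmod z))"
    unfolding \<psi>_def by (rule Bochner_Integration.integrable_bound[OF int]) (auto split: split_indicator)
  define a where "a = (\<lambda>n. (deriv ^^ n) G 0 / fact n)"
  have sums: "(\<lambda>n. a n * z ^ n) sums G z" for z
    using holomorphic_power_series[of G 0 "norm z + 1" z] G by (auto simp: a_def intro: holomorphic_on_subset)
  have summ: "summable (\<lambda>n. norm (a n) * R ^ n)"
    using powser_insidea[OF sums_summable[OF sums[of "of_real (R + 1)"]], of "of_real R"] R by (simp add: norm_mult norm_power)
  define f where "f = (\<lambda>n z. a n * (z ^ n * of_real (\<psi> (cmod z))))"
  have [measurable]: "f n \<in> borel_measurable borel" for n unfolding f_def by measurable
  have bd: "norm (f n z) \<le> (norm (a n) * R ^ n) * \<bar>\<psi> (cmod z)\<bar>" for n z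
  proof (cases "cmod z \<le> R")
    case True
    then have "cmod z ^ n * \<bar>\<psi> (cmod z)\<bar> \<le> R ^ n * \<bar>\<psi> (cmod z)\<bar>"
      by (intro mult_right_mono power_mono) auto
    then have "norm (a n) * (cmod z ^ n * \<bar>\<psi> (cmod z)\<bar>) \<le> norm (a n) * (R ^ n * \<bar>\<psi> (cmod z)\<bar>)"
      by (intro mult_left_mono) auto
    then show ?thesis
      unfolding f_def norm_mult norm_power norm_of_real mult.assoc .
  next
    case False
    then have "\<psi> (cmod z) = 0" unfolding \<psi>_def by simp
    then show ?thesis unfolding f_def by simp
  qed
  have intf: "integrable lborel (f n)" for n
    by (rule Bochner_Integration.integrable_bound[of _ "\<lambda>z. (norm (a n) * R ^ n) * \<bar>\<psi> (cmod z)\<bar>"])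
       (use bd R int' in \<open>auto intro!: AE_I2 order_trans[OF _ abs_ge_self]\<close>)
  have sumf: "summable (\<lambda>n. norm (f n z))" for z
    by (rule summable_comparison_test'[OF summable_mult2[OF summ, of "\<bar>\<psi> (cmod z)\<bar>"]]) (use bd in auto)
  have "(\<lambda>n. integral\<^sup>L lborel (f n)) sums (LINT z|lborel. (\<Sum>n. f n z))"
  proof (rule sums_integral[OF intf])
    show "summable (\<lambda>n. LINT z|lborel. norm (f n z))"
    proof (rule summable_comparison_test'[OF summable_mult2[OF summ, of "LINT z|lborel. \<bar>\<psi> (cmod (z::complex))\<bar>"]])
      fix n
      have "(LINT z|lborel. norm (f n z)) \<le> (LINT z|lborel. (norm (a n) * R ^ n) * \<bar>\<psi> (cmod z)\<bar>)"
        by (rule integral_mono) (use intf bd int' in auto)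
      then show "norm (LINT z|lborel. norm (f n z)) \<le> norm (a n) * R ^ n * (LINT z|lborel. \<bar>\<psi> (cmod (z::complex))\<bar>)"
        by simp
    qed
  qed (use sumf in auto)
  also have "(\<lambda>z. \<Sum>n. f n z) = (\<lambda>z. G z * of_real (\<psi> (cmod z)))"
  proof
    fix z
    have "(\<lambda>n. f n z) sums (G z * of_real (\<psi> (cmod z)))"
      using sums_mult2[OF sums, of z "of_real (\<psi> (cmod z))"] by (simp only: f_def mult.assoc)
    then show "(\<Sum>n. f n z) = G z * of_real (\<psi> (cmod z))" by (rule sums_unique[symmetric])
  qed
  finally have s1: "(\<lambda>n. integral\<^sup>L lborel (f n)) sums (LINT z|lborel. G z * of_real (\<psi> (cmod z)))" .
  have "integral\<^sup>L lborel (f n) = (if n = 0 then G 0 * of_real (LINT z|lborel. \<psi> (cmod (z::complex))) else 0)" for n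
  proof (cases "n = 0")
    case True
    then show ?thesis unfolding f_def a_def by (simp add: integral_complex_of_real)
  next
    case False
    then show ?thesis unfolding f_def by (simp add: integral_power_radial)
  qed
  then have "(\<lambda>n. integral\<^sup>L lborel (f n)) sums (G 0 * of_real (LINT z|lborel. \<psi> (cmod (z::complex))))"
    using sums_single[of 0 "\<lambda>_. G 0 * of_real (LINT z|lborel. \<psi> (cmod (z::complex)))"] by (simp only:)
  with s1 show ?thesis using sums_unique2 by blast
qed

text \<open>The cut-off is removed by dominated convergence, with majorants supplied by the two
  integrability assumptions.\<close>

lemma mean_value_radial:
  fixes \<phi> :: "real \<Rightarrow> real"
  assumes G: "G holomorphic_on UNIV" and [measurable]: "\<phi> \<in> borel_measurable borel"
    and int: "integrable lborel (\<lambda>z::complex. \<phi> (cmod z))"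
    and intG: "integrable lborel (\<lambda>z::complex. G z * of_real (\<phi> (cmod z)))"
  shows "(LINT z|lborel. G z * of_real (\<phi> (cmod z))) = G 0 * of_real (LINT z|lborel. \<phi> (cmod (z::complex)))"
proof (rule LIMSEQ_unique)
  have [measurable]: "G \<in> borel_measurable borel"
    by (intro borel_measurable_continuous_onI holomorphic_on_imp_continuous_on G)
  let ?\<psi> = "\<lambda>n t. indicator {..real (Suc n)} t * \<phi> t"
  have ev: "\<forall>\<^sub>F n in sequentially. indicator {..real (Suc n)} t = (1::real)" for t
    by (rule eventually_sequentiallyI[of "nat \<lceil>\<bar>t\<bar>\<rceil>"]) (auto split: split_indicator; linarith)
  show "(\<lambda>n. LINT z|lborel. G z * of_real (?\<psi> n (cmod z))) \<longlonglongrightarrow> (LINT z|lborel. G z * of_real (\<phi> (cmod z)))"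
  proof (rule integral_dominated_convergence[where w="\<lambda>z. norm (G z * of_real (\<phi> (cmod z)))"])
    show "AE z in lborel. (\<lambda>n. G z * of_real (?\<psi> n (cmod z))) \<longlonglongrightarrow> G z * of_real (\<phi> (cmod z))"
    proof (rule AE_I2, rule tendsto_eventually)
      fix z show "\<forall>\<^sub>F n in sequentially. G z * of_real (?\<psi> n (cmod z)) = G z * of_real (\<phi> (cmod z))"
        using ev[of "cmod z"] by eventually_elim simp
    qed
    show "integrable lborel (\<lambda>z. norm (G z * of_real (\<phi> (cmod z))))" using intG by (rule integrable_norm)
    show "AE z in lborel. norm (G z * of_real (?\<psi> n (cmod z))) \<le> norm (G z * of_real (\<phi> (cmod z)))" for n
      by (auto split: split_indicator)
  qed auto
  have "(\<lambda>n. LINT z|lborel. ?\<psi> n (cmod (z::complex))) \<longlonglongrightarrow> (LINT z|lborel. \<phi> (cmod (z::complex)))"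
  proof (rule integral_dominated_convergence[where w="\<lambda>z. norm (\<phi> (cmod z))"])
    show "AE z::complex in lborel. (\<lambda>n. ?\<psi> n (cmod z)) \<longlonglongrightarrow> \<phi> (cmod z)"
    proof (rule AE_I2, rule tendsto_eventually)
      fix z :: complex show "\<forall>\<^sub>F n in sequentially. ?\<psi> n (cmod z) = \<phi> (cmod z)"
        using ev[of "cmod z"] by eventually_elim simp
    qed
  qed (use int in \<open>auto simp: norm_mult split: split_indicator\<close>)
  then have lim: "(\<lambda>n. G 0 * of_real (LINT z|lborel. ?\<psi> n (cmod (z::complex)))) \<longlonglongrightarrow> G 0 * of_real (LINT z|lborel. \<phi> (cmod (z::complex)))"
    by (intro tendsto_intros)
  have eq: "(LINT z|lborel. G z * of_real (?\<psi> n (cmod z))) = G 0 * of_real (LINT z|lborel. ?\<psi> n (cmod (z::complex)))" for n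
    by (rule mean_value_ball[OF G assms(2) int]) (simp only: of_nat_0_less_iff zero_less_Suc)
  show "(\<lambda>n. LINT z|lborel. G z * of_real (?\<psi> n (cmod z))) \<longlonglongrightarrow> G 0 * of_real (LINT z|lborel. \<phi> (cmod (z::complex)))"
    unfolding eq by (rule lim)
qed

subsection \<open>Power means\<close>

text \<open>A convex function lies above its tangent; Young's inequality with the exponents q and q
  / (q - 1) yields this without differentiation.\<close>

lemma powr_tangent:
  fixes x y q :: real
  assumes "q > 1" "x \<ge> 0" "y > 0"
  shows "y powr q + q * y powr (q - 1) * (x - y) \<le> x powr q"
proof -
  define r where "r = q / (q - 1)"
  have r: "r > 1" "1 / q + 1 / r = 1" "(q - 1) * r = q" using assms by (auto simp: r_def field_simps)
  have "x * y powr (q - 1) \<le> x powr q / q + (y powr (q - 1)) powr r / r"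
    by (rule Youngs_inequality) (use assms r in auto)
  also have "(y powr (q - 1)) powr r = y powr q" using r by (simp add: powr_powr)
  also have "y powr q / r = y powr q * (1 / r)" by simp
  also have "1 / r = 1 - 1 / q" using r(2) by linarith
  finally have "q * (x * y powr (q - 1)) \<le> q * (x powr q / q + y powr q * (1 - 1 / q))"
    using assms by (intro mult_left_mono) auto
  also have "\<dots> = x powr q + q * y powr q - y powr q" using assms by (simp add: field_simps)
  finally have "q * y powr (q - 1) * x \<le> x powr q + q * y powr q - y powr q" by (simp add: mult_ac)
  moreover have "y powr (q - 1) * y = y powr q" using assms by (simp add: powr_diff)
  ultimately show ?thesis by (simp add: algebra_simps)
qed

text \<open>Jensen's inequality for a weight that need not be normalised. It serves Gaussian
  weights, the Poisson kernel and, through counting measure, finite sums over points of the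
  divisor.\<close>

lemma power_mean:
  fixes w g :: "'a \<Rightarrow> real"
  assumes "\<And>x. 0 \<le> w x" "\<And>x. 0 \<le> g x" "q > 1"
    and iw: "integrable M w" and iwg: "integrable M (\<lambda>x. w x * g x)"
    and iwq: "integrable M (\<lambda>x. w x * g x powr q)"
  shows "(LINT x|M. w x * g x) powr q \<le> (LINT x|M. w x) powr (q - 1) * (LINT x|M. w x * g x powr q)"
proof -
  define A where "A = (LINT x|M. w x * g x)"
  define c where "c = (LINT x|M. w x)"
  define B where "B = (LINT x|M. w x * g x powr q)"
  have nn: "A \<ge> 0" "c \<ge> 0" "B \<ge> 0" using assms by (auto simp: A_def c_def B_def)
  show ?thesis
  proof (cases "A = 0")
    case True
    then show ?thesis using nn assms(3) unfolding A_def[symmetric] B_def[symmetric] by simp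
  next
    case False
    then have A: "A > 0" using nn by simp
    have c: "c > 0"
    proof (rule ccontr)
      assume "\<not> c > 0"
      then have "c = 0" using nn by simp
      then have "AE x in M. w x = 0"
        using integral_nonneg_eq_0_iff_AE[OF iw] assms(1) by (auto simp: c_def)
      then have "AE x in M. w x * g x = 0" by eventually_elim simp
      then have "A = (LINT x|M. 0)" unfolding A_def by (intro integral_cong_AE) (use iwg in auto)
      with A show False by simp
    qed
    \<comment> \<open>The weighted mean of g: the linear term of the tangent taken there integrates
      to zero.\<close>
    define y where "y = A / c"
    have y: "y > 0" using A c by (simp add: y_def)
    have cy: "c * y = A" using c by (simp add: y_def)
    have "c * y powr q = (y powr q - q * y powr (q - 1) * y) * c + q * y powr (q - 1) * A"
      unfolding cy[symmetric] by (simp add: algebra_simps)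
    also have "\<dots> = (LINT x|M. (y powr q - q * y powr (q - 1) * y) * w x + q * y powr (q - 1) * (w x * g x))"
      using iw iwg by (simp add: A_def c_def)
    also have "\<dots> \<le> B" unfolding B_def
    proof (rule integral_mono)
      fix x
      have "w x * (y powr q + q * y powr (q - 1) * (g x - y)) \<le> w x * g x powr q"
        by (intro mult_left_mono powr_tangent assms y)
      then show "(y powr q - q * y powr (q - 1) * y) * w x + q * y powr (q - 1) * (w x * g x) \<le> w x * g x powr q"
        by (simp add: algebra_simps)
    qed (use iw iwg iwq in auto)
    finally have "c powr (q - 1) * (c * y powr q) \<le> c powr (q - 1) * B"
      by (intro mult_left_mono) auto
    moreover have "c powr (q - 1) * (c * y powr q) = A powr q"
      using c A by (simp add: y_def powr_divide powr_diff)
    ultimately show ?thesis unfolding A_def[symmetric] B_def[symmetric] c_def[symmetric] by simp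
  qed
qed

lemma powr_add_le:
  fixes a b q :: real
  assumes "a \<ge> 0" "b \<ge> 0" "q \<ge> 0"
  shows "(a + b) powr q \<le> 2 powr q * (a powr q + b powr q)"
proof -
  have "(a + b) powr q \<le> (2 * max a b) powr q" using assms by (intro powr_mono2) auto
  also have "\<dots> = 2 powr q * max a b powr q" using assms by (simp add: powr_mult)
  also have "max a b powr q \<le> a powr q + b powr q" by (simp add: max_def)
  finally show ?thesis by simp
qed

lemma power_gauss_bound:
  fixes b :: real assumes "b > 0"
  obtains K where "K > 0" "\<And>x. x \<ge> 0 \<Longrightarrow> x ^ j \<le> K * exp (b * x\<^sup>2)"
proof
  have ex: "t ^ j \<le> fact j * exp t" if "t \<ge> 0" for t :: real
  proof -
    have "(\<Sum>n\<in>{j}. t ^ n /\<^sub>R fact n) \<le> exp t" unfolding exp_def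
      using that by (intro sum_le_suminf summable_exp_generic) auto
    then show ?thesis by (simp add: field_simps)
  qed
  show "0 < 1 + fact j / b ^ j" using assms by (intro add_pos_pos divide_pos_pos) auto
  fix x :: real assume x: "x \<ge> 0"
  have "x ^ j \<le> 1 + (x\<^sup>2) ^ j"
  proof (cases "x \<le> 1")
    case True
    then show ?thesis using x power_le_one[OF x True, of j] by (simp add: add_increasing2)
  next
    case False
    then have "x ^ j \<le> (x\<^sup>2) ^ j" unfolding power_mult[symmetric] by (intro power_increasing) auto
    then show ?thesis by simp
  qed
  also have "(x\<^sup>2) ^ j = (b * x\<^sup>2) ^ j / b ^ j" using assms by (simp add: power_mult_distrib)
  also have "\<dots> \<le> fact j * exp (b * x\<^sup>2) / b ^ j"
    using assms by (intro divide_right_mono ex) auto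
  also have "1 \<le> exp (b * x\<^sup>2)" using assms by simp
  finally show "x ^ j \<le> (1 + fact j / b ^ j) * exp (b * x\<^sup>2)" by (simp add: algebra_simps)
qed

lemma poly_gauss:
  fixes b :: real assumes "b > 0"
  shows "integrable lborel (\<lambda>z. cmod z ^ j * exp (- b * (cmod z)\<^sup>2))"
    and "\<exists>K>0. \<forall>z. cmod z ^ j * exp (- b * (cmod z)\<^sup>2) \<le> K * exp (- (b / 2) * (cmod z)\<^sup>2)"
proof -
  obtain K where K: "K > 0" "\<And>x. x \<ge> 0 \<Longrightarrow> x ^ j \<le> K * exp (b / 2 * x\<^sup>2)"
    using power_gauss_bound[of "b / 2" j] assms by auto
  have bd: "cmod z ^ j * exp (- b * (cmod z)\<^sup>2) \<le> K * exp (- (b / 2) * (cmod z)\<^sup>2)" for z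
  proof -
    have "cmod z ^ j * exp (- b * (cmod z)\<^sup>2) \<le> (K * exp (b / 2 * (cmod z)\<^sup>2)) * exp (- b * (cmod z)\<^sup>2)"
      using K by (intro mult_right_mono) auto
    also have "\<dots> = K * exp (- (b / 2) * (cmod z)\<^sup>2)" by (simp add: mult.assoc exp_add[symmetric])
    finally show ?thesis .
  qed
  then show "\<exists>K>0. \<forall>z. cmod z ^ j * exp (- b * (cmod z)\<^sup>2) \<le> K * exp (- (b / 2) * (cmod z)\<^sup>2)"
    using K by blast
  show "integrable lborel (\<lambda>z. cmod z ^ j * exp (- b * (cmod z)\<^sup>2))"
    by (rule Bochner_Integration.integrable_bound[of _ "\<lambda>z. K * exp (- (b / 2) * (cmod z)\<^sup>2)"])
       (use integrable_gauss[of "b / 2"] assms K bd in \<open>auto intro!: AE_I2 order_trans[OF _ abs_ge_self]\<close>)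
qed

lemma cnj_borel_measurable [measurable]: "cnj \<in> borel_measurable borel"
  by (intro borel_measurable_continuous_onI continuous_intros)

lemma entire_measurable: "f holomorphic_on UNIV \<Longrightarrow> f \<in> borel_measurable borel"
  by (intro borel_measurable_continuous_onI holomorphic_on_imp_continuous_on)

subsection \<open>Fock spaces\<close>

locale fock =
  fixes p \<alpha> :: real
  assumes p2: "2 < p" and \<alpha>0: "0 < \<alpha>"
begin

text \<open>The exponent conjugate to p, in which the pieces of the annihilating functional are
  measured.\<close>

definition s where "s = p / (p - 1)"

lemma s_facts: "1 < s" "s < 2" "(p - 1) * s = p" "1 / p + 1 / s = 1" "p / s = p - 1"
  using p2 by (auto simp: s_def field_simps)

abbreviation FS where "FS \<equiv> fock_space p \<alpha>"

definition wmod :: "(complex \<Rightarrow> complex) \<Rightarrow> complex \<Rightarrow> real" where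
  "wmod f z = cmod (f z) * exp (- \<alpha> * (cmod z)\<^sup>2 / 2)"

text \<open>The p-th power of the Fock norm. It matches the sums of p-th powers in the interpolation
  problem and avoids roots, at the price of a factor 2 powr p in the triangle inequality.\<close>

definition mass :: "(complex \<Rightarrow> complex) \<Rightarrow> real" where
  "mass f = (LINT z|lborel. wmod f z powr p)"

lemma FS_iff: "f \<in> FS \<longleftrightarrow> f holomorphic_on UNIV \<and> integrable lborel (\<lambda>z. wmod f z powr p)"
  by (simp add: fock_space_def wmod_def)

lemma FS_entire: "f \<in> FS \<Longrightarrow> f holomorphic_on UNIV"
  by (simp add: FS_iff)

lemma FS_integrable: "f \<in> FS \<Longrightarrow> integrable lborel (\<lambda>z. wmod f z powr p)"
  by (simp add: FS_iff)

lemma wmod_nonneg [simp]: "0 \<le> wmod f z"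
  by (simp add: wmod_def)

lemma wmod_measurable [measurable]: "f \<in> borel_measurable borel \<Longrightarrow> wmod f \<in> borel_measurable borel"
proof -
  assume [measurable]: "f \<in> borel_measurable borel"
  have [measurable]: "(\<lambda>z::complex. exp (- \<alpha> * (cmod z)\<^sup>2 / 2)) \<in> borel_measurable borel"
    by (intro borel_measurable_continuous_onI continuous_intros) auto
  show ?thesis unfolding wmod_def by measurable
qed

lemma mass_nonneg [simp]: "0 \<le> mass f"
  by (simp add: mass_def)

lemma fock_norm_eq: "fock_norm p \<alpha> f = mass f powr (1 / p)"
proof -
  have "cmod (f z) powr p * exp (- p * \<alpha> * (cmod z)\<^sup>2 / 2) = wmod f z powr p" for z
    by (simp add: wmod_def powr_mult exp_powr_real algebra_simps)
  then show ?thesis by (simp add: fock_norm_def mass_def)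
qed

lemma fock_norm_nonneg [simp]: "0 \<le> fock_norm p \<alpha> f"
  by (simp add: fock_norm_eq)

lemma fock_norm_powr: "fock_norm p \<alpha> f powr p = mass f"
  using p2 by (simp add: fock_norm_eq powr_powr)

lemma vanishing_space_iff: "f \<in> vanishing_space p \<alpha> m l \<longleftrightarrow> f \<in> FS \<and> vanish l (m l) f"
  using vanish_iff FS_entire by (auto simp: vanishing_space_def)

lemma wmod_zero [simp]: "wmod (\<lambda>z. 0) = (\<lambda>z. 0)"
  by (simp add: wmod_def fun_eq_iff)

lemma FS_zero [simp]: "(\<lambda>z. 0) \<in> FS"
  by (simp add: FS_iff)

lemma mass_zero [simp]: "mass (\<lambda>z. 0) = 0"
  by (simp add: mass_def)

lemma wmod_cmult: "wmod (\<lambda>z. c * f z) z = cmod c * wmod f z"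
  by (simp add: wmod_def norm_mult)

lemma wmod_add_le: "wmod (\<lambda>z. f z + g z) z \<le> wmod f z + wmod g z"
proof -
  have "wmod (\<lambda>z. f z + g z) z \<le> (cmod (f z) + cmod (g z)) * exp (- \<alpha> * (cmod z)\<^sup>2 / 2)"
    unfolding wmod_def by (intro mult_right_mono norm_triangle_ineq) auto
  then show ?thesis by (simp add: wmod_def algebra_simps)
qed

lemma FS_cmult: "f \<in> FS \<Longrightarrow> (\<lambda>z. c * f z) \<in> FS"
  and mass_cmult: "mass (\<lambda>z. c * f z) = cmod c powr p * mass f"
  by (auto simp: FS_iff wmod_cmult powr_mult mass_def intro!: holomorphic_intros)

lemma FS_add:
  assumes "f \<in> FS" "g \<in> FS"
  shows "(\<lambda>z. f z + g z) \<in> FS" "mass (\<lambda>z. f z + g z) \<le> 2 powr p * (mass f + mass g)"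
proof -
  have [measurable]: "f \<in> borel_measurable borel" "g \<in> borel_measurable borel"
    using assms by (auto intro: entire_measurable FS_entire)
  have bd: "wmod (\<lambda>z. f z + g z) z powr p \<le> 2 powr p * (wmod f z powr p + wmod g z powr p)" for z
  proof -
    have "wmod (\<lambda>z. f z + g z) z powr p \<le> (wmod f z + wmod g z) powr p"
      using p2 by (intro powr_mono2 wmod_add_le) auto
    also have "\<dots> \<le> 2 powr p * (wmod f z powr p + wmod g z powr p)"
      using p2 by (intro powr_add_le) auto
    finally show ?thesis .
  qed
  have i: "integrable lborel (\<lambda>z. 2 powr p * (wmod f z powr p + wmod g z powr p))"
    using assms by (auto intro: FS_integrable)
  have i2: "integrable lborel (\<lambda>z. wmod (\<lambda>z. f z + g z) z powr p)"
    by (rule Bochner_Integration.integrable_bound[OF i]) (use bd in \<open>auto intro!: AE_I2 order_trans[OF _ abs_ge_self]\<close>)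
  then show "(\<lambda>z. f z + g z) \<in> FS"
    using assms by (auto simp: FS_iff intro!: holomorphic_intros)
  have "mass (\<lambda>z. f z + g z) \<le> (LINT z|lborel. 2 powr p * (wmod f z powr p + wmod g z powr p))"
    unfolding mass_def by (intro integral_mono i i2 bd)
  then show "mass (\<lambda>z. f z + g z) \<le> 2 powr p * (mass f + mass g)"
    using assms by (simp add: mass_def FS_integrable)
qed

lemma FS_diff:
  assumes "f \<in> FS" "g \<in> FS"
  shows "(\<lambda>z. f z - g z) \<in> FS" "mass (\<lambda>z. f z - g z) \<le> 2 powr p * (mass f + mass g)"
  using FS_add[OF assms(1) FS_cmult[OF assms(2), of "-1"]] mass_cmult[of "-1" g] by simp_all

lemma FS_sum: "(\<And>i. i \<in> I \<Longrightarrow> f i \<in> FS) \<Longrightarrow> (\<lambda>z. \<Sum>i\<in>I. f i z) \<in> FS"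
  by (induction I rule: infinite_finite_induct) (auto intro: FS_add)

lemma mass_sum_le:
  assumes "finite I"
  shows "\<exists>K\<ge>0. \<forall>f. (\<forall>i\<in>I. f i \<in> FS) \<longrightarrow> mass (\<lambda>z. \<Sum>i\<in>I. f i z) \<le> K * (\<Sum>i\<in>I. mass (f i))"
  using assms
proof induction
  case empty
  then show ?case by (auto intro: exI[of _ 0])
next
  case (insert a I)
  then obtain K where K: "K \<ge> 0" "\<And>f. \<forall>i\<in>I. f i \<in> FS \<Longrightarrow> mass (\<lambda>z. \<Sum>i\<in>I. f i z) \<le> K * (\<Sum>i\<in>I. mass (f i))"
    by blast
  have "mass (\<lambda>z. \<Sum>i\<in>insert a I. f i z) \<le> 2 powr p * (1 + K) * (\<Sum>i\<in>insert a I. mass (f i))"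
    if f: "\<forall>i\<in>insert a I. f i \<in> FS" for f
  proof -
    have S: "(\<Sum>i\<in>I. mass (f i)) \<ge> 0" by (simp add: sum_nonneg)
    have "mass (\<lambda>z. f a z + (\<Sum>i\<in>I. f i z)) \<le> 2 powr p * (mass (f a) + mass (\<lambda>z. \<Sum>i\<in>I. f i z))"
      using f by (intro FS_add FS_sum) auto
    also have "\<dots> \<le> 2 powr p * (mass (f a) + K * (\<Sum>i\<in>I. mass (f i)))"
      using K(2)[of f] f by (intro mult_left_mono add_left_mono) auto
    also have "\<dots> \<le> 2 powr p * ((1 + K) * (mass (f a) + (\<Sum>i\<in>I. mass (f i))))"
      using K(1) S by (intro mult_left_mono) (auto simp: algebra_simps)
    finally show ?thesis using insert.hyps by (simp add: mult.assoc)
  qed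
  then show ?case using K(1) by (intro exI[of _ "2 powr p * (1 + K)"]) auto
qed

subsection \<open>Weyl translations\<close>

text \<open>The Weyl operator that moves l to the origin. The exponential compensates the change of
  the Gaussian weight under translation, and with this normalisation the inverse is
  \<open>shift (- l)\<close> without any leftover phase.\<close>

definition shift :: "complex \<Rightarrow> (complex \<Rightarrow> complex) \<Rightarrow> complex \<Rightarrow> complex" where
  "shift l f u = f (l + u) * exp (- of_real \<alpha> * cnj l * u - of_real (\<alpha> * (cmod l)\<^sup>2 / 2))"

lemma wmod_shift: "wmod (shift l f) u = wmod f (l + u)"
proof -
  have "(cmod (l + u))\<^sup>2 = (cmod l)\<^sup>2 + (cmod u)\<^sup>2 + 2 * Re (cnj l * u)"
    unfolding cmod_power2 by (simp add: power2_eq_square algebra_simps)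
  then have e: "- (\<alpha> * Re (cnj l * u)) - \<alpha> * (cmod l)\<^sup>2 / 2 - \<alpha> * (cmod u)\<^sup>2 / 2 = - \<alpha> * (cmod (l + u))\<^sup>2 / 2"
    by (simp add: algebra_simps)
  have "wmod (shift l f) u
      = cmod (f (l + u)) * (exp (- (\<alpha> * Re (cnj l * u)) - \<alpha> * (cmod l)\<^sup>2 / 2) * exp (- \<alpha> * (cmod u)\<^sup>2 / 2))"
    by (simp add: wmod_def shift_def norm_mult mult.assoc)
  also have "\<dots> = wmod f (l + u)"
    unfolding exp_add[symmetric] wmod_def e[symmetric] by (simp add: algebra_simps)
  finally show ?thesis .
qed

lemma shift_entire: "f holomorphic_on UNIV \<Longrightarrow> shift l f holomorphic_on UNIV"
  unfolding shift_def
  by (intro holomorphic_intros holomorphic_on_compose_gen[of "\<lambda>u. l + u" UNIV f UNIV, unfolded o_def]) auto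

lemma shift_inverse: "shift (- l) (shift l f) = f"
proof
  fix u
  have "cnj l * l = of_real ((cmod l)\<^sup>2)" by (metis complex_norm_square mult.commute)
  then have "- of_real \<alpha> * cnj l * (- l + u) - of_real (\<alpha> * (cmod l)\<^sup>2 / 2) +
      (- of_real \<alpha> * cnj (- l) * u - of_real (\<alpha> * (cmod (- l))\<^sup>2 / 2)) = 0"
    by (simp add: algebra_simps)
  then show "shift (- l) (shift l f) u = f u"
    by (simp only: shift_def mult.assoc exp_add[symmetric]) simp
qed

lemma shift_FS:
  assumes "f \<in> FS" shows "shift l f \<in> FS" "mass (shift l f) = mass f"
proof -
  have [measurable]: "f \<in> borel_measurable borel" using assms by (auto intro: entire_measurable FS_entire)
  show "shift l f \<in> FS"
    unfolding FS_iff wmod_shift using assms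
    by (auto intro: shift_entire FS_entire FS_integrable simp: integrable_translate_iff[of "\<lambda>z. wmod f z powr p"])
  show "mass (shift l f) = mass f"
    unfolding mass_def wmod_shift by (rule integral_translate[of "\<lambda>z. wmod f z powr p"]) measurable
qed

lemma shift_diff: "shift l (\<lambda>z. f z - g z) = (\<lambda>z. shift l f z - shift l g z)"
  by (simp add: shift_def fun_eq_iff algebra_simps)

lemma vanish_shift: "vanish a m f \<Longrightarrow> vanish (a - l) m (shift l f)"
proof -
  assume "vanish a m f"
  then obtain g where g: "g holomorphic_on UNIV" "\<And>z. f z = (z - a) ^ m * g z"
    unfolding vanish_def by blast
  have "shift l f u = (u - (a - l)) ^ m * shift l g u" for u
    unfolding shift_def g(2) by (simp add: algebra_simps)
  with shift_entire[OF g(1)] show ?thesis unfolding vanish_def by blast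
qed

lemma vanish_shift_iff: "vanish l m f \<longleftrightarrow> vanish 0 m (shift l f)"
  using vanish_shift[of l m f l] vanish_shift[of 0 m "shift l f" "- l"] by (auto simp: shift_inverse)

subsection \<open>Bounded functionals and moments\<close>

text \<open>The power mean with weight H, followed by H \<le> K, shows that a bounded integrable
  weight defines a bounded functional. Moments, and through them point evaluations, are estimated in
  this way.\<close>

lemma FS_pair:
  assumes [measurable]: "H \<in> borel_measurable borel" and H: "\<And>z. 0 \<le> H z" "\<And>z. H z \<le> K" and iH: "integrable lborel H"
  shows "f \<in> FS \<Longrightarrow> integrable lborel (\<lambda>z::complex. H z * wmod f z)"
    and "f \<in> FS \<Longrightarrow> (LINT z|lborel. H z * wmod f z) powr p \<le> ((LINT z|lborel. H z) powr (p - 1) * K) * mass f"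
proof -
  assume f: "f \<in> FS"
  have [measurable]: "f \<in> borel_measurable borel" using f by (auto intro: entire_measurable FS_entire)
  have K: "K \<ge> 0" using H[of 0] by simp
  have i1: "integrable lborel (\<lambda>z. H z * wmod f z powr p)"
    by (rule Bochner_Integration.integrable_bound[of _ "\<lambda>z. K * wmod f z powr p"])
       (use H FS_integrable[OF f] in \<open>auto simp: abs_mult intro!: AE_I2 mult_right_mono order_trans[OF _ abs_ge_self]\<close>)
  \<comment> \<open>Dominates the product by H plus H times the p-th power, both known to be
    integrable.\<close>
  have le: "x \<le> 1 + x powr p" if "x \<ge> 0" for x :: real
  proof (cases "x \<le> 1")
    case False
    then have "x powr 1 \<le> x powr p" using p2 by (intro powr_mono) auto
    then show ?thesis using False by simp
  qed (simp add: add_increasing2)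
  show i2: "integrable lborel (\<lambda>z. H z * wmod f z)"
  proof (rule Bochner_Integration.integrable_bound[OF Bochner_Integration.integrable_add[OF iH i1]])
    have "H z * wmod f z \<le> H z + H z * wmod f z powr p" for z
      using mult_left_mono[OF le[of "wmod f z"] H(1)[of z]] by (simp add: algebra_simps)
    then show "AE z in lborel. norm (H z * wmod f z) \<le> norm (H z + H z * wmod f z powr p)"
      using H(1) by (auto intro!: AE_I2 order_trans[OF _ abs_ge_self])
  qed auto
  have "(LINT z|lborel. H z * wmod f z) powr p \<le> (LINT z|lborel. H z) powr (p - 1) * (LINT z|lborel. H z * wmod f z powr p)"
    by (rule power_mean) (use H iH i1 i2 p2 in auto)
  also have "(LINT z|lborel. H z * wmod f z powr p) \<le> (LINT z|lborel. K * wmod f z powr p)"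
    using H by (intro integral_mono i1 mult_right_mono integrable_mult_right FS_integrable f) auto
  also have "\<dots> = K * mass f" by (simp add: mass_def)
  finally show "(LINT z|lborel. H z * wmod f z) powr p \<le> ((LINT z|lborel. H z) powr (p - 1) * K) * mass f"
    by (simp add: mult.assoc mult_left_mono)
qed

text \<open>Up to the factor \<open>gmoment j\<close>, the j-th Taylor coefficient at 0 of the
  translate of f (see \<open>moment_taylor\<close>). As an area integral it is visibly bounded on
  the Fock space, and the bound is the same for all l because translations preserve the
  norm.\<close>

definition moment :: "complex \<Rightarrow> nat \<Rightarrow> (complex \<Rightarrow> complex) \<Rightarrow> complex" where
  "moment l j f = (LINT u|lborel. shift l f u * cnj u ^ j * of_real (exp (- \<alpha> * (cmod u)\<^sup>2)))"

lemma FS_moment: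
  shows "f \<in> FS \<Longrightarrow> integrable lborel (\<lambda>u. shift l f u * cnj u ^ j * of_real (exp (- \<alpha> * (cmod u)\<^sup>2)))"
    and "\<exists>C\<ge>0. \<forall>f\<in>FS. \<forall>l. cmod (moment l j f) powr p \<le> C * mass f"
proof -
  define H where "H u = cmod u ^ j * exp (- (\<alpha> / 2) * (cmod u)\<^sup>2)" for u
  obtain K where K: "K > 0" "\<And>u. H u \<le> K * exp (- (\<alpha> / 2 / 2) * (cmod u)\<^sup>2)"
    using poly_gauss(2)[of "\<alpha> / 2" j] \<alpha>0 unfolding H_def by auto
  have HK: "H u \<le> K" for u
    by (rule order_trans[OF K(2)]) (use K(1) \<alpha>0 in auto)
  have iH: "integrable lborel H" unfolding H_def using poly_gauss(1)[of "\<alpha> / 2" j] \<alpha>0 by simp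
  have [measurable]: "H \<in> borel_measurable borel" unfolding H_def by measurable
  have H0: "0 \<le> H u" for u by (simp add: H_def)
  \<comment> \<open>Half of the Gaussian is absorbed by \<open>wmod\<close>; the other half makes
    the power of u bounded and integrable.\<close>
  have n: "norm (shift l f u * cnj u ^ j * of_real (exp (- \<alpha> * (cmod u)\<^sup>2))) = H u * wmod (shift l f) u" for l f u
    by (simp add: H_def wmod_def norm_mult norm_power mult.assoc exp_add[symmetric])
  have i: "integrable lborel (\<lambda>u. shift l f u * cnj u ^ j * of_real (exp (- \<alpha> * (cmod u)\<^sup>2)))" if "f \<in> FS" for l f
  proof -
    have [measurable]: "shift l f \<in> borel_measurable borel"
      using that by (auto intro: entire_measurable FS_entire shift_entire)
    show ?thesis
      by (rule Bochner_Integration.integrable_bound[OF FS_pair(1)[OF _ H0 HK iH shift_FS(1)[OF that]]])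
         (use n H0 in \<open>auto intro!: AE_I2\<close>)
  qed
  then show "f \<in> FS \<Longrightarrow> integrable lborel (\<lambda>u. shift l f u * cnj u ^ j * of_real (exp (- \<alpha> * (cmod u)\<^sup>2)))" .
  define C where "C = (LINT z|lborel. H z) powr (p - 1) * K"
  have "cmod (moment l j f) powr p \<le> C * mass f" if f: "f \<in> FS" for f l
  proof -
    have "cmod (moment l j f) \<le> (LINT u|lborel. H u * wmod (shift l f) u)"
      unfolding moment_def n[symmetric] by (rule integral_norm_bound)
    then have "cmod (moment l j f) powr p \<le> (LINT u|lborel. H u * wmod (shift l f) u) powr p"
      using p2 by (intro powr_mono2) auto
    also have "\<dots> \<le> C * mass (shift l f)" unfolding C_def
      by (rule FS_pair(2)[OF _ H0 HK iH shift_FS(1)[OF f]]) measurable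
    finally show ?thesis using shift_FS(2)[OF f] by simp
  qed
  moreover have "C \<ge> 0" unfolding C_def using K by simp
  ultimately show "\<exists>C\<ge>0. \<forall>f\<in>FS. \<forall>l. cmod (moment l j f) powr p \<le> C * mass f" by blast
qed

lemma moment_diff: "f \<in> FS \<Longrightarrow> g \<in> FS \<Longrightarrow> moment l j (\<lambda>z. f z - g z) = moment l j f - moment l j g"
  unfolding moment_def shift_diff left_diff_distrib by (intro Bochner_Integration.integral_diff FS_moment)

lemma moment_add: "f \<in> FS \<Longrightarrow> g \<in> FS \<Longrightarrow> moment l j (\<lambda>z. f z + g z) = moment l j f + moment l j g"
proof -
  have "shift l (\<lambda>z. f z + g z) = (\<lambda>z. shift l f z + shift l g z)"
    by (simp add: shift_def fun_eq_iff algebra_simps)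
  then show "f \<in> FS \<Longrightarrow> g \<in> FS \<Longrightarrow> moment l j (\<lambda>z. f z + g z) = moment l j f + moment l j g"
    unfolding moment_def by (simp only: distrib_right) (intro Bochner_Integration.integral_add FS_moment)
qed

lemma moment_cmult: "moment l j (\<lambda>z. c * f z) = c * moment l j f"
proof -
  have "shift l (\<lambda>z. c * f z) = (\<lambda>z. c * shift l f z)"
    by (simp add: shift_def fun_eq_iff algebra_simps)
  then show ?thesis unfolding moment_def by (simp add: mult.assoc)
qed

text \<open>The squared norm of u^j for the Gaussian measure, hence the only nonzero moment of a
  centred monomial.\<close>

definition gmoment :: "nat \<Rightarrow> real" where
  "gmoment j = (LINT u|lborel. cmod u ^ (2 * j) * exp (- \<alpha> * (cmod u)\<^sup>2))"

lemma gmoment_pos: "gmoment j > 0"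
proof -
  have i: "integrable lborel (\<lambda>u. cmod u ^ (2 * j) * exp (- \<alpha> * (cmod u)\<^sup>2))"
    using poly_gauss(1)[of \<alpha> "2 * j"] \<alpha>0 by simp
  have nn: "gmoment j \<ge> 0" by (simp add: gmoment_def)
  have "gmoment j \<noteq> 0"
  proof
    assume "gmoment j = 0"
    then have "AE u::complex in lborel. cmod u ^ (2 * j) * exp (- \<alpha> * (cmod u)\<^sup>2) = 0"
      using integral_nonneg_eq_0_iff_AE[OF i] by (auto simp: gmoment_def)
    then have "AE u::complex in lborel. u \<in> {0}" by eventually_elim auto
    with AE_lborel_singleton[of 0] have "AE u::complex in lborel. \<not> True" by eventually_elim auto
    from emeasure_eq_0_AE[OF this] show False by simp
  qed
  with nn show ?thesis by simp
qed

lemma integral_monomials: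
  "integrable lborel (\<lambda>u. u ^ i * cnj u ^ j * of_real (exp (- \<alpha> * (cmod u)\<^sup>2)))"
  "(LINT u|lborel. u ^ i * cnj u ^ j * of_real (exp (- \<alpha> * (cmod u)\<^sup>2))) = (if i = j then of_real (gmoment j) else 0)"
proof -
  show "integrable lborel (\<lambda>u. u ^ i * cnj u ^ j * of_real (exp (- \<alpha> * (cmod u)\<^sup>2)))"
    by (rule Bochner_Integration.integrable_bound[OF poly_gauss(1)[OF \<alpha>0, of "i + j"]])
       (auto simp: norm_mult norm_power power_add)
  have sq: "u ^ n * cnj u ^ n = of_real (cmod u ^ (2 * n))" for u n
    by (simp add: power_mult_distrib[symmetric] power_mult complex_norm_square[symmetric])
  have gt: "(LINT u|lborel. u ^ i * cnj u ^ j * of_real (exp (- \<alpha> * (cmod u)\<^sup>2))) = 0" if "i > j" for i j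
  proof -
    have "u ^ i * cnj u ^ j * of_real (exp (- \<alpha> * (cmod u)\<^sup>2))
        = u ^ (i - j) * of_real ((\<lambda>t. t ^ (2 * j) * exp (- \<alpha> * t\<^sup>2)) (cmod u))" for u
    proof -
      have "u ^ i = u ^ (i - j) * u ^ j" using that by (simp flip: power_add)
      then show ?thesis using sq[of u j] by (simp add: mult.assoc)
    qed
    moreover have "(LINT u|lborel. u ^ (i - j) * of_real ((\<lambda>t. t ^ (2 * j) * exp (- \<alpha> * t\<^sup>2)) (cmod u)) :: complex) = 0"
      by (rule integral_power_radial) (use that in auto)
    ultimately show ?thesis by (simp only:)
  qed
  show "(LINT u|lborel. u ^ i * cnj u ^ j * of_real (exp (- \<alpha> * (cmod u)\<^sup>2))) = (if i = j then of_real (gmoment j) else 0)"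
  proof (cases i j rule: linorder_cases)
    case equal
    then show ?thesis unfolding gmoment_def
      by (simp only: sq if_True refl of_real_mult[symmetric] integral_complex_of_real)
  next
    case greater
    then show ?thesis using gt by simp
  next
    case less
    have "cnj (LINT u|lborel. u ^ j * cnj u ^ i * of_real (exp (- \<alpha> * (cmod u)\<^sup>2)))
      = (LINT u|lborel. u ^ i * cnj u ^ j * of_real (exp (- \<alpha> * (cmod u)\<^sup>2)))"
      by (subst Bochner_Integration.integral_cnj[symmetric]) (simp add: mult_ac)
    then show ?thesis using gt[OF less] less by simp
  qed
qed

text \<open>Monomials are orthogonal for the Gaussian measure. The remainder of order m, integrated
  against cnj u ^ j with j < m, is an entire function vanishing at 0 times a radial factor, so the
  mean value property kills it.\<close>

lemma moment_taylor:
  assumes f: "f \<in> FS" and g: "g holomorphic_on UNIV"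
    and eq: "\<And>u. shift l f u = (\<Sum>i<m. c i * u ^ i) + u ^ m * g u" and j: "j < m"
  shows "moment l j f = c j * of_real (gmoment j)"
proof -
  define w where "w u = complex_of_real (exp (- \<alpha> * (cmod u)\<^sup>2))" for u
  have i1: "integrable lborel (\<lambda>u. \<Sum>i<m. c i * (u ^ i * cnj u ^ j * w u))"
    unfolding w_def by (intro Bochner_Integration.integrable_sum integrable_mult_right integral_monomials)
  have e: "shift l f u * cnj u ^ j * w u = (\<Sum>i<m. c i * (u ^ i * cnj u ^ j * w u)) + u ^ m * g u * cnj u ^ j * w u" for u
    unfolding eq by (simp add: distrib_right sum_distrib_right mult.assoc)
  have i0: "integrable lborel (\<lambda>u. shift l f u * cnj u ^ j * w u)" using FS_moment(1)[OF f] by (simp add: w_def)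
  have i2: "integrable lborel (\<lambda>u. u ^ m * g u * cnj u ^ j * w u)"
    using Bochner_Integration.integrable_diff[OF i0 i1] unfolding e by simp
  have e2: "u ^ m * g u * cnj u ^ j * w u = (u ^ (m - j) * g u) * of_real ((\<lambda>t. t ^ (2 * j) * exp (- \<alpha> * t\<^sup>2)) (cmod u))" for u
  proof -
    have "u ^ m = u ^ (m - j) * u ^ j" using j by (simp flip: power_add)
    moreover have "u ^ j * cnj u ^ j = of_real (cmod u ^ (2 * j))"
      by (simp add: power_mult_distrib[symmetric] power_mult complex_norm_square[symmetric])
    ultimately show ?thesis by (simp add: w_def mult_ac)
  qed
  have "(LINT u|lborel. u ^ m * g u * cnj u ^ j * w u) = 0"
  proof -
    have "(LINT u|lborel. (u ^ (m - j) * g u) * of_real ((\<lambda>t. t ^ (2 * j) * exp (- \<alpha> * t\<^sup>2)) (cmod u))) =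
      (0 ^ (m - j) * g 0) * of_real (LINT u|lborel. (\<lambda>t. t ^ (2 * j) * exp (- \<alpha> * t\<^sup>2)) (cmod (u::complex)))"
    proof (rule mean_value_radial)
      show "(\<lambda>u. u ^ (m - j) * g u) holomorphic_on UNIV" using g by (intro holomorphic_intros)
      show "integrable lborel (\<lambda>u::complex. (\<lambda>t. t ^ (2 * j) * exp (- \<alpha> * t\<^sup>2)) (cmod u))"
        using poly_gauss(1)[OF \<alpha>0, of "2 * j"] by simp
      show "integrable lborel (\<lambda>u. (u ^ (m - j) * g u) * of_real ((\<lambda>t. t ^ (2 * j) * exp (- \<alpha> * t\<^sup>2)) (cmod u)))"
        using i2 unfolding e2 .
    qed measurable
    then show ?thesis unfolding e2 using j by simp
  qed
  then have "moment l j f = (LINT u|lborel. (\<Sum>i<m. c i * (u ^ i * cnj u ^ j * w u)))"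
    unfolding moment_def w_def[symmetric] e by (subst Bochner_Integration.integral_add[OF i1 i2]) simp
  also have "\<dots> = (\<Sum>i<m. c i * (LINT u|lborel. u ^ i * cnj u ^ j * w u))"
    unfolding w_def by (subst Bochner_Integration.integral_sum) (intro integrable_mult_right integral_monomials, simp only: integral_mult_right_zero)
  also have "\<dots> = (\<Sum>i<m. if i = j then c j * of_real (gmoment j) else 0)"
    unfolding w_def integral_monomials(2) by (intro sum.cong) auto
  finally show ?thesis using j by simp
qed

text \<open>Expresses vanishing to order m through finitely many bounded linear functionals, the
  form needed both for the dual description of the extremal function and for closedness of the
  vanishing space.\<close>

lemma vanish_iff_moments:
  assumes f: "f \<in> FS"
  shows "vanish l m f \<longleftrightarrow> (\<forall>j<m. moment l j f = 0)"
proof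
  assume "vanish l m f"
  then obtain g where "g holomorphic_on UNIV" "\<And>u. shift l f u = u ^ m * g u"
    unfolding vanish_shift_iff[of l m f] unfolding vanish_def by auto
  then show "\<forall>j<m. moment l j f = 0" using moment_taylor[OF f, where g=g and l=l and m=m and c="\<lambda>_. 0"] by simp
next
  assume z: "\<forall>j<m. moment l j f = 0"
  obtain c g where g: "g holomorphic_on UNIV" "\<And>u. shift l f u = (\<Sum>i<m. c i * (u - 0) ^ i) + (u - 0) ^ m * g u"
    using entire_taylor[OF shift_entire[OF FS_entire[OF f]], where m=m and l=0] by blast
  have "c j = 0" if "j < m" for j
    using moment_taylor[OF f g(1), where l=l and m=m and c=c and j=j] g(2) that z gmoment_pos[of j] by auto
  then have "shift l f u = (u - 0) ^ m * g u" for u using g(2) by simp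
  then show "vanish l m f" unfolding vanish_shift_iff[of l m f] unfolding vanish_def using g(1) by blast
qed

text \<open>The zeroth moment at z is the value of the translate at 0 times
  \<open>gmoment 0\<close>, and that value has modulus \<open>wmod f z\<close>.\<close>

lemma pointwise_bound:
  obtains A where "A > 0" "\<And>f z. f \<in> FS \<Longrightarrow> wmod f z powr p \<le> A * mass f"
proof -
  obtain C where C: "C \<ge> 0" "\<And>f l. f \<in> FS \<Longrightarrow> cmod (moment l 0 f) powr p \<le> C * mass f"
    using FS_moment(2)[of 0] by blast
  have k: "gmoment 0 > 0" by (rule gmoment_pos)
  have "wmod f z powr p \<le> (C + 1) / gmoment 0 powr p * mass f" if f: "f \<in> FS" for f z
  proof -
    obtain g where g: "g holomorphic_on UNIV" "\<And>u. shift z f u = shift z f 0 + (u - 0) * g u"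
      using entire_factor[OF shift_entire[OF FS_entire[OF f]], where l=0] by blast
    have m: "moment z 0 f = shift z f 0 * of_real (gmoment 0)"
    proof (rule moment_taylor[OF f g(1), where l=z and m=1 and c="\<lambda>_. shift z f 0" and j=0])
      show "shift z f u = (\<Sum>i<1. shift z f 0 * u ^ i) + u ^ 1 * g u" for u using g(2)[of u] by simp
    qed simp
    have "wmod f z = cmod (shift z f 0)" using wmod_shift[of z f 0] by (simp add: wmod_def)
    then have "wmod f z * gmoment 0 = cmod (moment z 0 f)" using k m by (simp add: norm_mult)
    then have "(wmod f z * gmoment 0) powr p \<le> C * mass f" using C(2)[OF f] by simp
    also have "\<dots> \<le> (C + 1) * mass f" by (intro mult_right_mono) auto
    finally show ?thesis using k by (simp add: powr_mult field_simps)
  qed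
  moreover have "(C + 1) / gmoment 0 powr p > 0" using C(1) k by simp
  ultimately show ?thesis using that by blast
qed


subsection \<open>Normal families\<close>

text \<open>The pointwise bound makes the sequence locally bounded, so Montel's theorem gives a
  limit; Fatou controls its mass, and convergence of derivatives preserves every interpolation
  condition that holds eventually. The varying bounds b allow minimising sequences as well as
  uniformly bounded ones.\<close>

lemma compactness:
  assumes f: "\<And>n::nat. f n \<in> FS" and b: "\<And>n. mass (f n) \<le> b n" "b \<longlonglongrightarrow> B"
  obtains g r where "strict_mono (r :: nat \<Rightarrow> nat)" "g \<in> FS" "mass g \<le> B"
    "\<And>l m h. h holomorphic_on UNIV \<Longrightarrow> (\<forall>\<^sub>F n in sequentially. vanish l m (\<lambda>z. f (r n) z - h z)) \<Longrightarrow>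
       vanish l m (\<lambda>z. g z - h z)"
proof -
  obtain B' where B': "\<And>n. b n \<le> B'"
  proof -
    obtain K where "\<And>n. norm (b n) \<le> K"
      using BseqE[OF convergent_imp_Bseq[OF convergentI[OF b(2)]]] by blast
    then show ?thesis using that[of K] by (auto simp: abs_le_iff)
  qed
  obtain A where A: "A > 0" "\<And>f z. f \<in> FS \<Longrightarrow> wmod f z powr p \<le> A * mass f"
    using pointwise_bound by blast
  define S where "S = {h \<in> FS. mass h \<le> B'}"
  have fS: "f n \<in> S" for n using f b(1)[of n] B'[of n] by (auto simp: S_def)
  have bound: "cmod (h z) \<le> (A * B') powr (1 / p) * exp (\<alpha> * (cmod z)\<^sup>2 / 2)" if "h \<in> S" for h z
  proof -
    have "wmod h z powr p \<le> A * mass h" using A(2) that by (auto simp: S_def)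
    also have "\<dots> \<le> A * B'" using that A(1) by (intro mult_left_mono) (auto simp: S_def)
    finally have "(wmod h z powr p) powr (1 / p) \<le> (A * B') powr (1 / p)"
      using p2 by (intro powr_mono2) auto
    then have "wmod h z \<le> (A * B') powr (1 / p)" using p2 by (simp add: powr_powr)
    then have "wmod h z * exp (\<alpha> * (cmod z)\<^sup>2 / 2) \<le> (A * B') powr (1 / p) * exp (\<alpha> * (cmod z)\<^sup>2 / 2)"
      by (intro mult_right_mono) auto
    moreover have "wmod h z * exp (\<alpha> * (cmod z)\<^sup>2 / 2) = cmod (h z)"
      unfolding wmod_def mult.assoc exp_add[symmetric] by simp
    ultimately show ?thesis by simp
  qed
  obtain g r where gr: "g holomorphic_on UNIV" "strict_mono (r :: nat \<Rightarrow> nat)"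
    "\<And>x. ((\<lambda>n. f (r n) x) \<longlongrightarrow> g x) sequentially"
    "\<And>K. compact K \<Longrightarrow> uniform_limit K (f \<circ> r) g sequentially"
  proof (rule Montel[of UNIV S f])
    show "h holomorphic_on UNIV" if "h \<in> S" for h using that FS_entire by (auto simp: S_def)
    show "\<exists>B. \<forall>h\<in>S. \<forall>z\<in>K. cmod (h z) \<le> B" if K: "compact K" for K
    proof -
      obtain R where R: "R > 0" "\<And>z. z \<in> K \<Longrightarrow> cmod z \<le> R"
        using compact_imp_bounded[OF K] unfolding bounded_pos by auto
      have "cmod (h z) \<le> (A * B') powr (1 / p) * exp (\<alpha> * R\<^sup>2 / 2)" if "h \<in> S" "z \<in> K" for h z
      proof (rule order_trans[OF bound[OF that(1)]], intro mult_left_mono)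
        show "exp (\<alpha> * (cmod z)\<^sup>2 / 2) \<le> exp (\<alpha> * R\<^sup>2 / 2)"
          using R(2)[OF that(2)] \<alpha>0 by (simp add: power_mono)
      qed simp
      then show ?thesis by blast
    qed
    show "range f \<subseteq> S" using fS by auto
  qed auto
  have [measurable]: "g \<in> borel_measurable borel" "f n \<in> borel_measurable borel" for n
    using gr(1) f by (auto intro: entire_measurable FS_entire)
  have B0: "B \<ge> 0"
    using b(2) by (rule LIMSEQ_le_const) (use b(1) order_trans[OF mass_nonneg] in blast)
  have lim: "(\<lambda>n. ennreal (wmod (f (r n)) z powr p)) \<longlonglongrightarrow> ennreal (wmod g z powr p)" for z
  proof -
    have "(\<lambda>n. wmod (f (r n)) z) \<longlonglongrightarrow> wmod g z" unfolding wmod_def using gr(3) by (intro tendsto_intros)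
    then have "(\<lambda>n. wmod (f (r n)) z powr p) \<longlonglongrightarrow> wmod g z powr p"
      using p2 by (intro tendsto_powr2) (auto intro!: always_eventually)
    then show ?thesis by (intro tendsto_ennrealI)
  qed
  have "(\<integral>\<^sup>+z. ennreal (wmod g z powr p) \<partial>lborel) = (\<integral>\<^sup>+z. liminf (\<lambda>n. ennreal (wmod (f (r n)) z powr p)) \<partial>lborel)"
    using lim_imp_Liminf[OF _ lim] by simp
  also have "\<dots> \<le> liminf (\<lambda>n. \<integral>\<^sup>+z. ennreal (wmod (f (r n)) z powr p) \<partial>lborel)"
    by (rule nn_integral_liminf) measurable
  also have "\<dots> = liminf (\<lambda>n. ennreal (mass (f (r n))))"
    unfolding mass_def using FS_integrable[OF f] by (subst nn_integral_eq_integral) auto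
  also have "\<dots> \<le> liminf (\<lambda>n. ennreal (b (r n)))"
    by (intro Liminf_mono always_eventually) (auto intro: ennreal_leI b(1))
  also have "\<dots> = ennreal B"
    using LIMSEQ_subseq_LIMSEQ[OF b(2) gr(2)] unfolding o_def
    by (intro lim_imp_Liminf tendsto_ennrealI) auto
  finally have nn: "(\<integral>\<^sup>+z. ennreal (wmod g z powr p) \<partial>lborel) \<le> ennreal B" .
  have gF: "g \<in> FS" unfolding FS_iff
  proof (intro conjI gr(1) integrableI_bounded)
    have "(\<integral>\<^sup>+z. ennreal (norm (wmod g z powr p)) \<partial>lborel) \<le> ennreal B" using nn by simp
    also have "\<dots> < \<infinity>" by simp
    finally show "(\<integral>\<^sup>+z. ennreal (norm (wmod g z powr p)) \<partial>lborel) < \<infinity>" .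
  qed measurable
  have "ennreal (mass g) \<le> ennreal B"
    using nn nn_integral_eq_integral[OF FS_integrable[OF gF]] by (simp add: mass_def)
  then have gB: "mass g \<le> B" using B0 by simp
  show ?thesis
  proof (rule that[OF gr(2) gF gB])
    fix l m h assume h: "h holomorphic_on UNIV" and ev: "\<forall>\<^sub>F n in sequentially. vanish l m (\<lambda>z. f (r n) z - h z)"
    have sub: "k holomorphic_on UNIV \<Longrightarrow> k holomorphic_on ball l 1" for k
      by (rule holomorphic_on_subset) auto
    have d: "(deriv ^^ j) (\<lambda>z. k z - h z) l = (deriv ^^ j) k l - (deriv ^^ j) h l"
      if "k holomorphic_on UNIV" for k j
      using that h by (intro higher_deriv_diff[of _ UNIV]) auto
    have "(deriv ^^ j) (\<lambda>z. g z - h z) l = 0" if j: "j < m" for j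
    proof -
      have "uniform_limit (ball l 1) (f \<circ> r) g sequentially"
        using gr(4)[of "cball l 1"] by (rule uniform_limit_on_subset) auto
      then have "(\<lambda>n. (deriv ^^ j) ((f \<circ> r) n) l) \<longlonglongrightarrow> (deriv ^^ j) g l"
        by (rule higher_deriv_complex_uniform_limit)
          (auto intro!: always_eventually sub FS_entire f)
      then have L: "(\<lambda>n. (deriv ^^ j) (f (r n)) l - (deriv ^^ j) h l) \<longlonglongrightarrow> (deriv ^^ j) g l - (deriv ^^ j) h l"
        unfolding o_def by (intro tendsto_intros)
      have E: "\<forall>\<^sub>F n in sequentially. (deriv ^^ j) (f (r n)) l - (deriv ^^ j) h l = 0"
        using ev
      proof eventually_elim
        case (elim n)
        then have "(deriv ^^ j) (\<lambda>z. f (r n) z - h z) l = 0"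
          using vanish_iff[OF vanish_entire[OF elim], of l m] j by blast
        then show ?case using d[OF FS_entire[OF f[of "r n"]], of j] by simp
      qed
      have "(deriv ^^ j) g l - (deriv ^^ j) h l = 0"
        by (rule LIMSEQ_unique[OF L tendsto_eventually[OF E]])
      then show ?thesis using d[OF gr(1)] by simp
    qed
    then show "vanish l m (\<lambda>z. g z - h z)"
      using vanish_iff[of "\<lambda>z. g z - h z" l m] gr(1) h by (auto intro: holomorphic_intros)
  qed
qed

subsection \<open>Necessity: functions vanishing to high order are small on large discs\<close>

text \<open>Divide the translate by u^m and use the maximum principle on the circle of radius r =
  sqrt (m / \<alpha>). There \<alpha> r^2 = m, so the comparison function u^m with its Gaussian
  weight peaks exactly on that circle and falls off like a Gaussian in the distance to it.\<close>

lemma inner_decay: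
  assumes v: "vanish l m f" and K: "\<And>z. wmod f z \<le> K" and t: "0 \<le> t" "cmod (z - l) \<le> sqrt (m / \<alpha>) - t"
  shows "wmod f z \<le> K * exp (- \<alpha> * t\<^sup>2 / 2)"
proof -
  define r where "r = sqrt (m / \<alpha>)"
  define u where "u = z - l"
  have u: "cmod u \<le> r - t" using t by (simp add: r_def u_def)
  have r0: "r \<ge> 0" using \<alpha>0 by (simp add: r_def)
  have r2: "\<alpha> * r\<^sup>2 = m" using \<alpha>0 by (simp add: r_def)
  have K0: "K \<ge> 0" using K[of 0] wmod_nonneg order_trans by blast
  have wz: "wmod f z = wmod (shift l f) u" by (simp add: wmod_shift u_def)
  show ?thesis
  proof (cases "r = 0")
    case True
    then have "t = 0" using u t norm_ge_zero[of u] by linarith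
    then show ?thesis using K by simp
  next
    case False
    then have r: "r > 0" using r0 by simp
    obtain g where g: "g holomorphic_on UNIV" "\<And>u. shift l f u = u ^ m * g u"
      using v unfolding vanish_shift_iff[of l m f] unfolding vanish_def by auto
    have "cmod (g u) \<le> K * exp (\<alpha> * r\<^sup>2 / 2) / r ^ m"
    proof (rule maximum_modulus_frontier[of g "cball 0 r"])
      fix v :: complex assume "v \<in> frontier (cball 0 r)"
      then have v: "cmod v = r" by (simp add: frontier_cball r)
      have "wmod (shift l f) v \<le> K" using K by (simp add: wmod_shift)
      then have "r ^ m * cmod (g v) * exp (- \<alpha> * r\<^sup>2 / 2) \<le> K"
        by (simp add: wmod_def g norm_mult norm_power v)
      then have "(r ^ m * cmod (g v) * exp (- \<alpha> * r\<^sup>2 / 2)) * exp (\<alpha> * r\<^sup>2 / 2) \<le> K * exp (\<alpha> * r\<^sup>2 / 2)"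
        by (intro mult_right_mono) auto
      moreover have "(r ^ m * cmod (g v) * exp (- \<alpha> * r\<^sup>2 / 2)) * exp (\<alpha> * r\<^sup>2 / 2) = r ^ m * cmod (g v)"
        unfolding mult.assoc exp_add[symmetric] by simp
      ultimately have "r ^ m * cmod (g v) \<le> K * exp (\<alpha> * r\<^sup>2 / 2)" by linarith
      then show "cmod (g v) \<le> K * exp (\<alpha> * r\<^sup>2 / 2) / r ^ m"
        using r by (simp add: pos_le_divide_eq mult.commute)
    qed (use g u t in \<open>auto intro: holomorphic_on_subset continuous_on_subset holomorphic_on_imp_continuous_on\<close>)
    then have "wmod f z \<le> cmod u ^ m * (K * exp (\<alpha> * r\<^sup>2 / 2) / r ^ m) * exp (- \<alpha> * (cmod u)\<^sup>2 / 2)"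
      unfolding wz unfolding wmod_def g norm_mult norm_power by (intro mult_right_mono mult_left_mono) auto
    also have "\<dots> = K * ((cmod u / r) ^ m * exp (\<alpha> * r\<^sup>2 / 2 - \<alpha> * (cmod u)\<^sup>2 / 2))"
    proof -
      have "exp (\<alpha> * r\<^sup>2 / 2 - \<alpha> * (cmod u)\<^sup>2 / 2) = exp (\<alpha> * r\<^sup>2 / 2) * exp (- \<alpha> * (cmod u)\<^sup>2 / 2)"
        unfolding exp_add[symmetric] by simp
      then show ?thesis by (simp add: power_divide)
    qed
    \<comment> \<open>The inequality 1 + x \<le> exp x, raised to the power m = \<alpha> r^2; the
      exponents then complete the square of r - |u|.\<close>
    also have "\<dots> \<le> K * (exp (\<alpha> * r\<^sup>2 * (cmod u / r - 1)) * exp (\<alpha> * r\<^sup>2 / 2 - \<alpha> * (cmod u)\<^sup>2 / 2))"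
    proof (intro mult_left_mono mult_right_mono K0)
      have "(cmod u / r) ^ m \<le> exp (cmod u / r - 1) ^ m"
        using exp_ge_add_one_self[of "cmod u / r - 1"] r by (intro power_mono) auto
      then show "(cmod u / r) ^ m \<le> exp (\<alpha> * r\<^sup>2 * (cmod u / r - 1))"
        unfolding r2 exp_of_nat_mult .
    qed auto
    also have "\<dots> = K * exp (- \<alpha> * (r - cmod u)\<^sup>2 / 2)"
    proof -
      have "\<alpha> * r\<^sup>2 * (cmod u / r - 1) = \<alpha> * (r * cmod u) - \<alpha> * r\<^sup>2"
        using r by (simp add: field_simps power2_eq_square)
      then have "\<alpha> * r\<^sup>2 * (cmod u / r - 1) + (\<alpha> * r\<^sup>2 / 2 - \<alpha> * (cmod u)\<^sup>2 / 2) = - \<alpha> * (r - cmod u)\<^sup>2 / 2"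
        by (simp add: power2_diff algebra_simps add_divide_distrib diff_divide_distrib)
      then show ?thesis unfolding exp_add[symmetric] by simp
    qed
    also have "\<dots> \<le> K * exp (- \<alpha> * t\<^sup>2 / 2)"
    proof -
      have "t\<^sup>2 \<le> (r - cmod u)\<^sup>2" using t u by (intro power_mono) auto
      then show ?thesis using \<alpha>0 K0 by (intro mult_left_mono) auto
    qed
    finally show ?thesis .
  qed
qed

section \<open>Coherent states and the separation constant\<close>

lemma one_FS: "(\<lambda>_. 1) \<in> FS"
proof -
  have "(exp (- \<alpha> * (cmod z)\<^sup>2 / 2)) powr p = exp (- (p * \<alpha> / 2) * (cmod z)\<^sup>2)" for z
    by (simp add: exp_powr_real algebra_simps)
  then show ?thesis unfolding FS_iff wmod_def using integrable_gauss[of "p * \<alpha> / 2"] p2 \<alpha>0 by simp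
qed

text \<open>The normalised reproducing kernel at w, obtained as a translate of the constant 1; its
  weighted modulus is a Gaussian centred at w with maximum 1.\<close>

definition coherent :: "complex \<Rightarrow> complex \<Rightarrow> complex" where
  "coherent w = shift (- w) (\<lambda>_. 1)"

lemma coherent: "coherent w \<in> FS" "mass (coherent w) = mass (\<lambda>_. 1)" "wmod (coherent w) z \<le> 1" "wmod (coherent w) w = 1"
  using shift_FS[OF one_FS] \<alpha>0 unfolding coherent_def wmod_shift by (auto simp: wmod_def)

lemma separation_constant:
  assumes M: "M \<ge> 0"
  obtains c where "c > 0"
    "\<And>l m l' m' w f. \<lbrakk>f \<in> FS; mass f \<le> M; vanish l m (\<lambda>z. f z - coherent w z); vanish l' m' f;
      cmod (w - l) \<le> sqrt (real m / \<alpha>) - c; cmod (w - l') \<le> sqrt (real m' / \<alpha>) - c\<rbrakk> \<Longrightarrow> False"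
proof -
  obtain A where A: "A > 0" "\<And>f z. f \<in> FS \<Longrightarrow> wmod f z powr p \<le> A * mass f"
    using pointwise_bound by blast
  define B where "B = (A * M) powr (1 / p)"
  have B0: "B \<ge> 0" by (simp add: B_def)
  \<comment> \<open>Chosen so that exp (-\<alpha> c^2 / 2) = 1 / (2 B + 2). At w the functions f and
    f - \<open>coherent w\<close>, bounded by B and B + 1, then add up to less than 1, the value of
    the coherent state there.\<close>
  define c where "c = sqrt (2 * ln (2 * B + 2) / \<alpha>)"
  have ln: "ln (2 * B + 2) > 0" using B0 by simp
  have c: "c > 0" "\<alpha> * c\<^sup>2 / 2 = ln (2 * B + 2)" using \<alpha>0 ln by (auto simp: c_def)
  have e: "exp (- \<alpha> * c\<^sup>2 / 2) = 1 / (2 * B + 2)" using c(2) B0 by (simp add: exp_minus field_simps)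
  show ?thesis
  proof (rule that[OF c(1)])
    fix l m l' m' w f
    assume f: "f \<in> FS" "mass f \<le> M" and v: "vanish l m (\<lambda>z. f z - coherent w z)" "vanish l' m' f"
      and d: "cmod (w - l) \<le> sqrt (real m / \<alpha>) - c" "cmod (w - l') \<le> sqrt (real m' / \<alpha>) - c"
    have fB: "wmod f z \<le> B" for z
    proof -
      have "wmod f z powr p \<le> A * M"
        using order_trans[OF A(2)[OF f(1), of z] mult_left_mono[OF f(2), of A]] A(1) by simp
      then have "(wmod f z powr p) powr (1 / p) \<le> B" unfolding B_def using p2 by (intro powr_mono2) auto
      then show ?thesis using p2 by (simp add: powr_powr)
    qed
    have tri: "wmod (\<lambda>z. f z - coherent w z) z \<le> wmod f z + wmod (coherent w) z"
      "wmod (coherent w) z \<le> wmod f z + wmod (\<lambda>z. f z - coherent w z) z" for z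
    proof -
      define e where "e = exp (- \<alpha> * (cmod z)\<^sup>2 / 2)"
      have e: "e \<ge> 0" by (simp add: e_def)
      have "cmod (f z - coherent w z) \<le> cmod (f z) + cmod (coherent w z)" by (rule norm_triangle_ineq4)
      from mult_right_mono[OF this e]
      show "wmod (\<lambda>z. f z - coherent w z) z \<le> wmod f z + wmod (coherent w) z"
        unfolding wmod_def e_def[symmetric] distrib_right .
      have "cmod (coherent w z) \<le> cmod (f z) + cmod (f z - coherent w z)"
        using norm_triangle_ineq4[of "f z" "f z - coherent w z"] by simp
      from mult_right_mono[OF this e]
      show "wmod (coherent w) z \<le> wmod f z + wmod (\<lambda>z. f z - coherent w z) z"
        unfolding wmod_def e_def[symmetric] distrib_right .
    qed
    have "wmod f w \<le> B * exp (- \<alpha> * c\<^sup>2 / 2)"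
      by (rule inner_decay[OF v(2) fB _ d(2)]) (use c in auto)
    moreover have "wmod (\<lambda>z. f z - coherent w z) w \<le> (B + 1) * exp (- \<alpha> * c\<^sup>2 / 2)"
    proof (rule inner_decay[OF v(1) _ _ d(1)])
      fix z show "wmod (\<lambda>z. f z - coherent w z) z \<le> B + 1"
        using tri(1)[of z] fB[of z] coherent(3)[of w z] by linarith
    qed (use c in auto)
    ultimately have "1 \<le> B * exp (- \<alpha> * c\<^sup>2 / 2) + (B + 1) * exp (- \<alpha> * c\<^sup>2 / 2)"
      using tri(2)[of w] coherent(4)[of w] by linarith
    also have "\<dots> = (2 * B + 1) / (2 * B + 2)" unfolding e by (simp add: add_divide_distrib)
    also have "\<dots> < 1" using B0 by simp
    finally show False by simp
  qed
qed

end

subsection \<open>The Poisson kernel and dilations of polynomials\<close>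

lemma has_integral_set_lborel:
  fixes f :: "'a::euclidean_space \<Rightarrow> 'b::euclidean_space"
  assumes "set_integrable lborel S f"
  shows "(f has_integral (LINT x:S|lborel. f x)) S"
  using set_borel_integral_eq_integral[OF assms] by (simp add: has_integral_integrable_integral)

lemma has_integral_norm_le:
  fixes f :: "'n::euclidean_space \<Rightarrow> 'a::banach"
  assumes "(f has_integral a) S" "(g has_integral b) S" "\<And>x. x \<in> S \<Longrightarrow> norm (f x) \<le> g x"
  shows "norm a \<le> b"
  using integral_norm_bound_integral[of f S g] assms by (auto simp: has_integral_integrable_integral)

text \<open>The Poisson kernel of the unit disc at the real point \<delta>, with the circle
  parametrised over the unit interval so that its total mass is 1.\<close>

definition poisson :: "real \<Rightarrow> real \<Rightarrow> real" where
  "poisson \<delta> t = (1 - \<delta>\<^sup>2) / (cmod (cis (2 * pi * t) - of_real \<delta>))\<^sup>2"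

lemma poisson_continuous: "0 \<le> \<delta> \<Longrightarrow> \<delta> < 1 \<Longrightarrow> continuous_on S (poisson \<delta>)"
  and poisson_nonneg: "0 \<le> \<delta> \<Longrightarrow> \<delta> < 1 \<Longrightarrow> 0 \<le> poisson \<delta> t"
proof -
  assume d: "0 \<le> \<delta>" "\<delta> < 1"
  have ne: "cis (2 * pi * t) - of_real \<delta> \<noteq> 0" for t
  proof
    assume "cis (2 * pi * t) - of_real \<delta> = 0"
    then have "cmod (cis (2 * pi * t)) = cmod (of_real \<delta>)" by simp
    with d show False by simp
  qed
  show "continuous_on S (poisson \<delta>)"
    unfolding poisson_def by (intro continuous_intros) (use ne in auto)
  show "0 \<le> poisson \<delta> t" unfolding poisson_def using d by (auto intro!: divide_nonneg_nonneg simp: power_le_one)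
qed

text \<open>Cauchy's formula at \<delta> for G times (1 - \<delta>^2) / (1 - \<delta> \<zeta>): the
  extra factor equals 1 at \<delta> and converts the Cauchy kernel on the unit circle into the
  Poisson kernel.\<close>

lemma poisson_formula:
  assumes G: "G holomorphic_on UNIV" and d: "0 \<le> \<delta>" "\<delta> < 1"
  shows "((\<lambda>t. of_real (poisson \<delta> t) * G (cis (2 * pi * t) * v)) has_integral G (of_real \<delta> * v)) {0..1}"
proof -
  define H where "H \<zeta> = G (\<zeta> * v) * (1 - of_real (\<delta>\<^sup>2)) / (1 - of_real \<delta> * \<zeta>)" for \<zeta>
  have ne: "1 - of_real \<delta> * \<zeta> \<noteq> 0" if "cmod \<zeta> \<le> 1" for \<zeta> :: complex
  proof
    assume "1 - of_real \<delta> * \<zeta> = 0"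
    then have "cmod (of_real \<delta> * \<zeta>) = 1" by simp
    then have "\<delta> * cmod \<zeta> = 1" using d by (simp add: norm_mult)
    moreover have "\<delta> * cmod \<zeta> \<le> \<delta> * 1" using that d by (intro mult_left_mono) auto
    ultimately show False using d by simp
  qed
  have hol: "H holomorphic_on cball 0 1"
  proof -
    have "(\<lambda>\<zeta>. G (\<zeta> * v)) holomorphic_on cball 0 1"
      by (rule holomorphic_on_compose_gen[of "\<lambda>\<zeta>. \<zeta> * v" _ G UNIV, unfolded o_def]) (auto intro!: holomorphic_intros G)
    then show ?thesis unfolding H_def by (intro holomorphic_intros) (use ne in auto)
  qed
  have "((\<lambda>\<zeta>. H \<zeta> / (\<zeta> - of_real \<delta>)) has_contour_integral (2 * of_real pi * \<i> * H (of_real \<delta>))) (circlepath 0 1)"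
    by (rule Cauchy_integral_circlepath_simple[OF hol]) (use d in auto)
  moreover have "H (of_real \<delta>) = G (of_real \<delta> * v)"
    using ne[of "of_real \<delta>"] d by (simp add: H_def power2_eq_square)
  ultimately have "((\<lambda>t. H (circlepath 0 1 t) / (circlepath 0 1 t - of_real \<delta>) *
      vector_derivative (circlepath 0 1) (at t within {0..1})) has_integral (2 * of_real pi * \<i> * G (of_real \<delta> * v))) {0..1}"
    by (simp add: has_contour_integral_def)
  then have "((\<lambda>t. 2 * of_real pi * \<i> * (of_real (poisson \<delta> t) * G (cis (2 * pi * t) * v))) has_integral
      (2 * of_real pi * \<i> * G (of_real \<delta> * v))) {0..1}"
  proof (rule has_integral_eq[rotated])
    fix t :: real assume t: "t \<in> {0..1}"
    define \<zeta> where "\<zeta> = cis (2 * pi * t)"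
    have z: "circlepath 0 1 t = \<zeta>" by (simp add: circlepath \<zeta>_def cis_conv_exp mult_ac)
    have z1: "cmod \<zeta> = 1" "\<zeta> * cnj \<zeta> = 1" by (simp_all add: \<zeta>_def cis_mult cis_cnj)
    have vd: "vector_derivative (circlepath 0 1) (at t within {0..1}) = 2 * of_real pi * \<i> * \<zeta>"
      using t by (subst vector_derivative_circlepath01) (simp_all add: \<zeta>_def cis_conv_exp mult_ac)
    have zd: "\<zeta> - of_real \<delta> \<noteq> 0"
    proof
      assume "\<zeta> - of_real \<delta> = 0"
      then have "cmod \<zeta> = cmod (of_real \<delta>)" by simp
      with z1 d show False by simp
    qed
    have "of_real ((cmod (\<zeta> - of_real \<delta>))\<^sup>2) = (\<zeta> - of_real \<delta>) * (cnj \<zeta> - of_real \<delta>)"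
      by (simp only: complex_norm_square complex_cnj_diff complex_cnj_complex_of_real)
    moreover have "\<zeta> * (cnj \<zeta> - of_real \<delta>) = 1 - of_real \<delta> * \<zeta>"
      using z1 by (simp add: algebra_simps)
    ultimately have eq: "of_real ((cmod (\<zeta> - of_real \<delta>))\<^sup>2) * \<zeta> = (\<zeta> - of_real \<delta>) * (1 - of_real \<delta> * \<zeta>)"
      by (simp add: mult_ac)
    have "of_real ((cmod (\<zeta> - of_real \<delta>))\<^sup>2) \<noteq> (0 :: complex)" using zd by simp
    moreover have "\<zeta> \<noteq> 0" using z1 by auto
    ultimately have k: "\<zeta> / ((\<zeta> - of_real \<delta>) * (1 - of_real \<delta> * \<zeta>)) = 1 / of_real ((cmod (\<zeta> - of_real \<delta>))\<^sup>2)"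
      unfolding eq[symmetric] by simp
    have "H \<zeta> / (\<zeta> - of_real \<delta>) * (2 * of_real pi * \<i> * \<zeta>) =
        2 * of_real pi * \<i> * (G (\<zeta> * v) * (1 - of_real (\<delta>\<^sup>2)) * (\<zeta> / ((\<zeta> - of_real \<delta>) * (1 - of_real \<delta> * \<zeta>))))"
      by (simp add: H_def mult_ac)
    also have "\<dots> = 2 * of_real pi * \<i> * (of_real (poisson \<delta> t) * G (\<zeta> * v))"
      unfolding k by (simp add: poisson_def \<zeta>_def[symmetric])
    finally show "H (circlepath 0 1 t) / (circlepath 0 1 t - of_real \<delta>) *
      vector_derivative (circlepath 0 1) (at t within {0..1}) =
      2 * of_real pi * \<i> * (of_real (poisson \<delta> t) * G (cis (2 * pi * t) * v))"
      unfolding z vd \<zeta>_def[symmetric] .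
  qed
  from has_integral_mult_right[OF this, of "1 / (2 * of_real pi * \<i>)"] show ?thesis by simp
qed

lemma poisson_measure:
  assumes "0 \<le> \<delta>" "\<delta> < 1"
  defines "w \<equiv> (\<lambda>t. indicator {0..1} t * poisson \<delta> t)"
  shows "w \<in> borel_measurable borel" "0 \<le> w t" "integrable lborel w" "(LINT t|lborel. w t) = 1"
proof -
  have i: "integrable lborel (\<lambda>t. indicator {0..1} t *\<^sub>R poisson \<delta> t)"
    by (rule borel_integrable_compact) (auto intro: poisson_continuous assms(1,2))
  then show iw: "integrable lborel w" by (simp add: w_def)
  then show "w \<in> borel_measurable borel" by auto
  show "0 \<le> w t" using poisson_nonneg[OF assms(1,2)] by (simp add: w_def)
  have "set_integrable lborel {0..1} (poisson \<delta>)" using i by (simp add: set_integrable_def)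
  then have "(poisson \<delta> has_integral (LINT t:{0..1}|lborel. poisson \<delta> t)) {0..1}"
    by (rule has_integral_set_lborel)
  moreover have "(poisson \<delta> has_integral 1) {0..1}"
    using has_integral_linear[OF poisson_formula[of "\<lambda>_. 1" \<delta> 0] bounded_linear_Re] assms(1,2) by (simp add: o_def)
  ultimately have "(LINT t:{0..1}|lborel. poisson \<delta> t) = 1" using has_integral_unique by blast
  then show "(LINT t|lborel. w t) = 1" by (simp add: w_def set_lebesgue_integral_def)
qed

text \<open>Subharmonicity of |G|^q, from the power mean for the probability measure given by the
  Poisson kernel. The nonnegative integral on the right is ready for Fubini.\<close>

lemma poisson_power:
  assumes G: "G holomorphic_on UNIV" and d: "0 \<le> \<delta>" "\<delta> < 1" and q: "q > 1"
  shows "ennreal (cmod (G (of_real \<delta> * v)) powr q)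
    \<le> (\<integral>\<^sup>+t. ennreal (indicator {0..1} t * poisson \<delta> t * cmod (G (cis (2 * pi * t) * v)) powr q) \<partial>lborel)"
proof -
  define w where "w t = indicator {0..1} t * poisson \<delta> t" for t
  define g where "g t = cmod (G (cis (2 * pi * t) * v))" for t
  note w = poisson_measure[OF d, folded w_def]
  have cG: "continuous_on S G" for S by (rule continuous_on_subset[OF holomorphic_on_imp_continuous_on[OF G]]) auto
  have cGt: "continuous_on S (\<lambda>t. G (cis (2 * pi * t) * v))" for S
    by (rule continuous_on_compose2[OF cG[of UNIV]]) (auto intro!: continuous_intros)
  have cg: "continuous_on S g" for S unfolding g_def by (intro continuous_intros cGt)
  have cq: "continuous_on S (\<lambda>t. g t powr q)" for S
    using q by (intro continuous_on_powr' continuous_intros cg) (auto simp: g_def)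
  have iwg: "integrable lborel (\<lambda>t. w t * g t)"
    using borel_integrable_compact[of "{0..1}" "\<lambda>t. poisson \<delta> t * g t"]
      continuous_on_mult[OF poisson_continuous[OF d] cg] by (simp add: w_def mult.assoc)
  have iwq: "integrable lborel (\<lambda>t. w t * g t powr q)"
    using borel_integrable_compact[of "{0..1}" "\<lambda>t. poisson \<delta> t * g t powr q"]
      continuous_on_mult[OF poisson_continuous[OF d] cq] by (simp add: w_def mult.assoc)
  have "set_integrable lborel {0..1} (\<lambda>t. poisson \<delta> t * g t)"
    using iwg by (simp add: set_integrable_def w_def mult.assoc)
  then have "((\<lambda>t. poisson \<delta> t * g t) has_integral (LINT t:{0..1}|lborel. poisson \<delta> t * g t)) {0..1}"
    by (rule has_integral_set_lborel)
  moreover have "(LINT t:{0..1}|lborel. poisson \<delta> t * g t) = (LINT t|lborel. w t * g t)"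
    by (simp add: set_lebesgue_integral_def w_def mult.assoc)
  ultimately have hg: "((\<lambda>t. poisson \<delta> t * g t) has_integral (LINT t|lborel. w t * g t)) {0..1}" by simp
  have "norm (G (of_real \<delta> * v)) \<le> (LINT t|lborel. w t * g t)"
    by (rule has_integral_norm_le[OF poisson_formula[OF G d, of v] hg])
       (simp add: norm_mult g_def poisson_nonneg[OF d])
  then have "norm (G (of_real \<delta> * v)) powr q \<le> (LINT t|lborel. w t * g t) powr q"
    using q by (intro powr_mono2) auto
  also have "\<dots> \<le> (LINT t|lborel. w t) powr (q - 1) * (LINT t|lborel. w t * g t powr q)"
    by (rule power_mean) (use w iwg iwq q in \<open>auto simp: g_def\<close>)
  also have "\<dots> = (LINT t|lborel. w t * g t powr q)" using w by simp
  finally have "ennreal (cmod (G (of_real \<delta> * v)) powr q) \<le> ennreal (LINT t|lborel. w t * g t powr q)"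
    by (rule ennreal_leI)
  also have "\<dots> = (\<integral>\<^sup>+t. ennreal (w t * g t powr q) \<partial>lborel)"
    by (rule nn_integral_eq_integral[symmetric]) (use iwq w in auto)
  finally show ?thesis unfolding w_def g_def .
qed

text \<open>Poisson's formula is applied to the reversed polynomial \<open>v\<^bsup>m-1\<^esup> Q(1/v)\<close>; after integration over
  circles the estimate says that normalised means of \<open>|Q|\<^sup>q\<close> decrease with the radius.\<close>

lemma poly_dilate_pointwise:
  fixes c :: "nat \<Rightarrow> complex" and m :: nat
  defines "Q \<equiv> (\<lambda>u. \<Sum>i<m. c i * u ^ i)"
  assumes m: "m \<ge> 1" and k: "\<kappa> > 1" and q: "q > 1" and u: "u \<noteq> 0"
  shows "ennreal (cmod (Q (of_real \<kappa> * u)) powr q)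
    \<le> ennreal ((\<kappa> ^ m) powr q) * (\<integral>\<^sup>+t. ennreal (indicator {0..1} t * poisson (1 / \<kappa>) t * cmod (Q (cis (- (2 * pi * t)) * u)) powr q) \<partial>lborel)"
proof -
  define G where "G v = (\<Sum>i<m. c i * v ^ (m - 1 - i))" for v
  have G: "G holomorphic_on UNIV" unfolding G_def by (intro holomorphic_intros)
  have QG: "Q y = y ^ (m - 1) * G (1 / y)" if "y \<noteq> 0" for y
  proof -
    have e: "y ^ (m - 1) * (c i * (1 / y) ^ (m - 1 - i)) = c i * y ^ i" if "i < m" for i
    proof -
      have "y ^ (m - 1) = y ^ (m - 1 - i) * y ^ i" using that by (simp flip: power_add)
      then show ?thesis using \<open>y \<noteq> 0\<close> by (simp add: power_divide)
    qed
    then show ?thesis unfolding Q_def G_def sum_distrib_left by (intro sum.cong[OF refl] e[symmetric]) simp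
  qed
  \<comment> \<open>After reversal, dilating by \<kappa> > 1 becomes evaluation at radius 1 /
    \<kappa> inside the unit disc.\<close>
  have d: "0 \<le> 1 / \<kappa>" "1 / \<kappa> < 1" using k by auto
  have g: "cmod (Q (cis (- (2 * pi * t)) * u)) = cmod u ^ (m - 1) * cmod (G (cis (2 * pi * t) * (1 / u)))" for t
  proof -
    have "1 / (cis (- (2 * pi * t)) * u) = cis (2 * pi * t) * (1 / u)"
      using cis_inverse[of "- (2 * pi * t)"] by (simp add: divide_inverse)
    then show ?thesis using u by (simp add: QG norm_mult norm_power)
  qed
  have "cmod (Q (of_real \<kappa> * u)) = \<kappa> ^ (m - 1) * cmod u ^ (m - 1) * cmod (G (of_real (1 / \<kappa>) * (1 / u)))"
    using u k by (simp add: QG norm_mult norm_power power_mult_distrib)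
  \<comment> \<open>The exponent m - 1 is rounded up to m, so that it can later be balanced exactly
    against m = \<alpha> r^2.\<close>
  also have "\<dots> \<le> \<kappa> ^ m * cmod u ^ (m - 1) * cmod (G (of_real (1 / \<kappa>) * (1 / u)))"
    using k by (intro mult_right_mono power_increasing) auto
  finally have "cmod (Q (of_real \<kappa> * u)) powr q \<le> (\<kappa> ^ m * cmod u ^ (m - 1) * cmod (G (of_real (1 / \<kappa>) * (1 / u)))) powr q"
    using q by (intro powr_mono2) auto
  also have "\<dots> = (\<kappa> ^ m) powr q * ((cmod u ^ (m - 1)) powr q * cmod (G (of_real (1 / \<kappa>) * (1 / u))) powr q)"
    using k by (simp add: powr_mult)
  finally have "ennreal (cmod (Q (of_real \<kappa> * u)) powr q) \<le>
      ennreal ((\<kappa> ^ m) powr q * ((cmod u ^ (m - 1)) powr q * cmod (G (of_real (1 / \<kappa>) * (1 / u))) powr q))"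
    by (rule ennreal_leI)
  also have "\<dots> =
      ennreal ((\<kappa> ^ m) powr q) * (ennreal ((cmod u ^ (m - 1)) powr q) * ennreal (cmod (G (of_real (1 / \<kappa>) * (1 / u))) powr q))"
    by (simp add: ennreal_mult)
  also have "\<dots> \<le> ennreal ((\<kappa> ^ m) powr q) * (ennreal ((cmod u ^ (m - 1)) powr q) *
      (\<integral>\<^sup>+t. ennreal (indicator {0..1} t * poisson (1 / \<kappa>) t * cmod (G (cis (2 * pi * t) * (1 / u))) powr q) \<partial>lborel))"
    by (intro mult_left_mono poisson_power G d q) auto
  also have "ennreal ((cmod u ^ (m - 1)) powr q) *
      (\<integral>\<^sup>+t. ennreal (indicator {0..1} t * poisson (1 / \<kappa>) t * cmod (G (cis (2 * pi * t) * (1 / u))) powr q) \<partial>lborel)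
    = (\<integral>\<^sup>+t. ennreal ((cmod u ^ (m - 1)) powr q) * ennreal (indicator {0..1} t * poisson (1 / \<kappa>) t * cmod (G (cis (2 * pi * t) * (1 / u))) powr q) \<partial>lborel)"
  proof (rule nn_integral_cmult[symmetric])
    have [measurable]: "(\<lambda>t. indicator {0..1} t * poisson (1 / \<kappa>) t) \<in> borel_measurable borel"
      using poisson_measure(1)[OF d] .
    have [measurable]: "(\<lambda>t. G (cis (2 * pi * t) * (1 / u))) \<in> borel_measurable borel"
      unfolding G_def by (intro borel_measurable_continuous_onI continuous_intros)
    show "(\<lambda>t. ennreal (indicator {0..1} t * poisson (1 / \<kappa>) t * cmod (G (cis (2 * pi * t) * (1 / u))) powr q)) \<in> borel_measurable lborel"
      by measurable
  qed
  also have "\<dots> = (\<integral>\<^sup>+t. ennreal (indicator {0..1} t * poisson (1 / \<kappa>) t * cmod (Q (cis (- (2 * pi * t)) * u)) powr q) \<partial>lborel)"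
    unfolding g using poisson_nonneg[OF d]
    by (intro nn_integral_cong) (simp add: ennreal_mult[symmetric] powr_mult mult_ac)
  finally show ?thesis .
qed

text \<open>Against a radial weight all rotates of Q have the same integral, so after Fubini the
  Poisson average contributes only its total mass 1.\<close>

lemma poly_dilate:
  fixes c :: "nat \<Rightarrow> complex" and \<phi> :: "real \<Rightarrow> ennreal" and m :: nat
  defines "Q \<equiv> (\<lambda>u. \<Sum>i<m. c i * u ^ i)"
  assumes m: "m \<ge> 1" and k: "\<kappa> > 1" and q: "q > 1" and [measurable]: "\<phi> \<in> borel_measurable borel"
  shows "(\<integral>\<^sup>+u. ennreal (cmod (Q (of_real \<kappa> * u)) powr q) * \<phi> (cmod u) \<partial>lborel)
    \<le> ennreal ((\<kappa> ^ m) powr q) * (\<integral>\<^sup>+u. ennreal (cmod (Q u) powr q) * \<phi> (cmod u) \<partial>lborel)"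
proof -
  have d: "0 \<le> 1 / \<kappa>" "1 / \<kappa> < 1" using k by auto
  define w where "w t = indicator {0..1} t * poisson (1 / \<kappa>) t" for t
  note w = poisson_measure[OF d, folded w_def]
  have [measurable]: "w \<in> borel_measurable borel" using w(1) .
  have [measurable]: "Q \<in> borel_measurable borel" unfolding Q_def by measurable
  define F where "F t u = ennreal (cmod (Q (cis (- (2 * pi * t)) * u)) powr q)" for t u
  have "(\<lambda>x. cis (- (2 * pi * fst x)) * snd x) \<in> borel_measurable (borel \<Otimes>\<^sub>M borel)"
    unfolding borel_prod by (intro borel_measurable_continuous_onI continuous_intros)
  then have mF[measurable]: "(\<lambda>x. F (fst x) (snd x)) \<in> borel_measurable (borel \<Otimes>\<^sub>M borel)"
    unfolding F_def by measurable
  have mF'[measurable (raw)]: "(\<lambda>x. F (f x) (g x)) \<in> borel_measurable N"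
    if "f \<in> borel_measurable N" "g \<in> borel_measurable N" for f :: "'x \<Rightarrow> real" and g N
    using measurable_compose[OF measurable_Pair[OF that] mF] by simp
  have rot: "(\<integral>\<^sup>+u. F t u * \<phi> (cmod u) \<partial>lborel) = (\<integral>\<^sup>+u. ennreal (cmod (Q u) powr q) * \<phi> (cmod u) \<partial>lborel)" for t
    using nn_integral_rotate[of "\<lambda>u. ennreal (cmod (Q u) powr q) * \<phi> (cmod u)" "cis (- (2 * pi * t))"]
    by (simp add: F_def norm_mult)
  have AE: "AE u::complex in lborel. u \<noteq> 0" by (rule AE_lborel_singleton)
  have "(\<integral>\<^sup>+u. ennreal (cmod (Q (of_real \<kappa> * u)) powr q) * \<phi> (cmod u) \<partial>lborel)
      \<le> (\<integral>\<^sup>+u. ennreal ((\<kappa> ^ m) powr q) * ((\<integral>\<^sup>+t. ennreal (w t) * F t u \<partial>lborel) * \<phi> (cmod u)) \<partial>lborel)"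
  proof (rule nn_integral_mono_AE, use AE in eventually_elim)
    fix u :: complex assume u: "u \<noteq> 0"
    have e: "ennreal (w t) * F t u = ennreal (indicator {0..1} t * poisson (1 / \<kappa>) t * cmod (Q (cis (- (2 * pi * t)) * u)) powr q)" for t
      using w(2)[of t] by (simp add: F_def w_def ennreal_mult[symmetric])
    show "ennreal (cmod (Q (of_real \<kappa> * u)) powr q) * \<phi> (cmod u)
      \<le> ennreal ((\<kappa> ^ m) powr q) * ((\<integral>\<^sup>+t. ennreal (w t) * F t u \<partial>lborel) * \<phi> (cmod u))"
      unfolding e mult.assoc[symmetric] Q_def
      by (intro mult_right_mono poly_dilate_pointwise m k q u) auto
  qed
  also have "\<dots> = ennreal ((\<kappa> ^ m) powr q) * (\<integral>\<^sup>+u. (\<integral>\<^sup>+t. ennreal (w t) * (F t u * \<phi> (cmod u)) \<partial>lborel) \<partial>lborel)"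
    by (subst nn_integral_cmult) (auto simp: nn_integral_multc[symmetric] mult.assoc)
  also have "(\<integral>\<^sup>+u. (\<integral>\<^sup>+t. ennreal (w t) * (F t u * \<phi> (cmod u)) \<partial>lborel) \<partial>lborel)
      = (\<integral>\<^sup>+t. (\<integral>\<^sup>+u. ennreal (w t) * (F t u * \<phi> (cmod u)) \<partial>lborel) \<partial>lborel)"
    by (rule lborel_pair.Fubini') (auto simp: case_prod_beta)
  also have "\<dots> = (\<integral>\<^sup>+t. ennreal (w t) * (\<integral>\<^sup>+u. ennreal (cmod (Q u) powr q) * \<phi> (cmod u) \<partial>lborel) \<partial>lborel)"
    by (intro nn_integral_cong) (simp add: nn_integral_cmult rot)
  also have "\<dots> = (\<integral>\<^sup>+t. ennreal (w t) \<partial>lborel) * (\<integral>\<^sup>+u. ennreal (cmod (Q u) powr q) * \<phi> (cmod u) \<partial>lborel)"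
    by (simp add: nn_integral_multc)
  also have "(\<integral>\<^sup>+t. ennreal (w t) \<partial>lborel) = 1"
    using nn_integral_eq_integral[OF w(3)] w(2,4) by simp
  finally show ?thesis by simp
qed

section \<open>Gaussian tails of polynomials outside their discs\<close>

context fock
begin

text \<open>The dilation by (r + t) / r carries the exterior of the disc of radius r to the exterior
  at depth t. It costs the growth factor of \<open>poly_dilate\<close>, which the Gaussian weight
  beats because \<alpha> r^2 = m. The bound is uniform in m: the area factor \<kappa>^2 is
  controlled since m \<ge> 1 forces 1 / r \<le> sqrt \<alpha>.\<close>

lemma polynomial_tail:
  fixes c :: "nat \<Rightarrow> complex" and m :: nat
  defines "Q \<equiv> (\<lambda>u. \<Sum>i<m. c i * u ^ i)"
  assumes m: "m \<ge> 1" and t: "t > 0"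
  shows "(\<integral>\<^sup>+y. ennreal (wmod Q y powr s) * indicator {y. sqrt (m / \<alpha>) + t \<le> cmod y} y \<partial>lborel)
    \<le> ennreal ((1 + t * sqrt \<alpha>)\<^sup>2 * exp (- \<alpha> * t\<^sup>2 / 2)) * (\<integral>\<^sup>+y. ennreal (wmod Q y powr s) \<partial>lborel)"
proof -
  define r where "r = sqrt (m / \<alpha>)"
  have r: "r > 0" "\<alpha> * r\<^sup>2 = m" using \<alpha>0 m by (auto simp: r_def)
  define \<kappa> where "\<kappa> = (r + t) / r"
  have k: "\<kappa> > 1" "\<kappa> * r = r + t" using r t by (auto simp: \<kappa>_def)
  have [measurable]: "Q \<in> borel_measurable borel" unfolding Q_def by measurable
  have ws: "wmod Q y powr s = cmod (Q y) powr s * exp (- s * \<alpha> * (cmod y)\<^sup>2 / 2)" for y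
    by (simp add: wmod_def powr_mult exp_powr_real mult_ac)
  define \<phi> where "\<phi> \<rho> = ennreal (exp (- s * \<alpha> * (\<kappa> * \<rho>)\<^sup>2 / 2)) * indicator {r..} \<rho>" for \<rho> :: real
  \<comment> \<open>The largest ratio of the dilated to the original Gaussian weight on |u| \<ge> r,
    attained at |u| = r.\<close>
  define E where "E = exp (- s * \<alpha> * (\<kappa>\<^sup>2 - 1) * r\<^sup>2 / 2)"
  have "(\<integral>\<^sup>+y. ennreal (wmod Q y powr s) * indicator {y. r + t \<le> cmod y} y \<partial>lborel)
     = ennreal (\<kappa>\<^sup>2) * (\<integral>\<^sup>+u. ennreal (wmod Q (of_real \<kappa> * u) powr s) * indicator {y. r + t \<le> cmod y} (of_real \<kappa> * u) \<partial>lborel)"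
    by (rule nn_integral_dilate) (use k in auto)
  also have "(\<integral>\<^sup>+u. ennreal (wmod Q (of_real \<kappa> * u) powr s) * indicator {y. r + t \<le> cmod y} (of_real \<kappa> * u) \<partial>lborel)
     = (\<integral>\<^sup>+u. ennreal (cmod (Q (of_real \<kappa> * u)) powr s) * \<phi> (cmod u) \<partial>lborel)"
  proof (intro nn_integral_cong)
    fix u :: complex
    have n: "cmod (of_real \<kappa> * u) = \<kappa> * cmod u" using k by (simp add: norm_mult)
    have iff: "r + t \<le> \<kappa> * cmod u \<longleftrightarrow> r \<le> cmod u"
      unfolding k(2)[symmetric] using k(1) by simp
    show "ennreal (wmod Q (of_real \<kappa> * u) powr s) * indicator {y. r + t \<le> cmod y} (of_real \<kappa> * u)
      = ennreal (cmod (Q (of_real \<kappa> * u)) powr s) * \<phi> (cmod u)"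
      unfolding ws \<phi>_def n by (simp add: n iff ennreal_mult mult.assoc split: split_indicator)
  qed
  also have "\<dots> \<le> ennreal ((\<kappa> ^ m) powr s) * (\<integral>\<^sup>+u. ennreal (cmod (Q u) powr s) * \<phi> (cmod u) \<partial>lborel)"
    unfolding Q_def by (rule poly_dilate) (use m k s_facts in \<open>auto simp: \<phi>_def[abs_def]\<close>)
  also have "(\<integral>\<^sup>+u. ennreal (cmod (Q u) powr s) * \<phi> (cmod u) \<partial>lborel) \<le> (\<integral>\<^sup>+u. ennreal E * ennreal (wmod Q u powr s) \<partial>lborel)"
  proof (intro nn_integral_mono)
    fix u :: complex
    have "exp (- s * \<alpha> * (\<kappa> * cmod u)\<^sup>2 / 2) \<le> E * exp (- s * \<alpha> * (cmod u)\<^sup>2 / 2)" if u: "r \<le> cmod u"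
    proof -
      have "r\<^sup>2 \<le> (cmod u)\<^sup>2" using u r by (intro power_mono) auto
      moreover have "\<kappa>\<^sup>2 - 1 \<ge> 0" using k by simp
      ultimately have "s * \<alpha> * ((\<kappa>\<^sup>2 - 1) * r\<^sup>2) \<le> s * \<alpha> * ((\<kappa>\<^sup>2 - 1) * (cmod u)\<^sup>2)"
        using s_facts \<alpha>0 by (intro mult_left_mono) auto
      then show ?thesis unfolding E_def exp_add[symmetric] by (simp add: power_mult_distrib algebra_simps)
    qed
    then have "cmod (Q u) powr s * exp (- s * \<alpha> * (\<kappa> * cmod u)\<^sup>2 / 2) \<le> E * wmod Q u powr s" if "r \<le> cmod u"
      using that unfolding ws by (subst mult.left_commute) (intro mult_left_mono, auto)
    then show "ennreal (cmod (Q u) powr s) * \<phi> (cmod u) \<le> ennreal E * ennreal (wmod Q u powr s)"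
      unfolding \<phi>_def by (auto split: split_indicator simp: ennreal_mult[symmetric] E_def intro!: ennreal_leI)
  qed
  also have "\<dots> = ennreal E * (\<integral>\<^sup>+u. ennreal (wmod Q u powr s) \<partial>lborel)"
    by (rule nn_integral_cmult) measurable
  finally have "(\<integral>\<^sup>+y. ennreal (wmod Q y powr s) * indicator {y. r + t \<le> cmod y} y \<partial>lborel)
     \<le> ennreal (\<kappa>\<^sup>2) * (ennreal ((\<kappa> ^ m) powr s) * (ennreal E * (\<integral>\<^sup>+u. ennreal (wmod Q u powr s) \<partial>lborel)))"
    by (simp add: mult_left_mono)
  also have "\<dots> = ennreal (\<kappa>\<^sup>2 * ((\<kappa> ^ m) powr s * E)) * (\<integral>\<^sup>+u. ennreal (wmod Q u powr s) \<partial>lborel)"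
    by (simp add: ennreal_mult E_def mult.assoc)
  also have "\<dots> \<le> ennreal ((1 + t * sqrt \<alpha>)\<^sup>2 * exp (- \<alpha> * t\<^sup>2 / 2)) * (\<integral>\<^sup>+u. ennreal (wmod Q u powr s) \<partial>lborel)"
  proof (intro mult_right_mono ennreal_leI mult_mono)
    have "1 / r \<le> sqrt \<alpha>"
    proof -
      have "1 \<le> \<alpha> * r\<^sup>2" using r(2) m by simp
      then have "1 \<le> sqrt \<alpha> * r" using r(1) \<alpha>0 real_sqrt_le_mono[of 1 "\<alpha> * r\<^sup>2"] by (simp add: real_sqrt_mult)
      then show ?thesis using r(1) by (simp add: field_simps)
    qed
    then have "t * (1 / r) \<le> t * sqrt \<alpha>" using t by (intro mult_left_mono) auto
    moreover have "\<kappa> = 1 + t * (1 / r)" using r by (simp add: \<kappa>_def field_simps)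
    ultimately show "\<kappa>\<^sup>2 \<le> (1 + t * sqrt \<alpha>)\<^sup>2" using k by (intro power_mono) auto
    \<comment> \<open>With m = \<alpha> r^2 the exponents combine through 2 (\<kappa> - 1) -
      (\<kappa>^2 - 1) = -(\<kappa> - 1)^2, and r (\<kappa> - 1) = t.\<close>
    have "\<kappa> ^ m \<le> exp (\<kappa> - 1) ^ m"
      using exp_ge_add_one_self[of "\<kappa> - 1"] k by (intro power_mono) auto
    then have "\<kappa> ^ m \<le> exp (\<alpha> * r\<^sup>2 * (\<kappa> - 1))" unfolding r(2) exp_of_nat_mult .
    then have "(\<kappa> ^ m) powr s \<le> exp (\<alpha> * r\<^sup>2 * (\<kappa> - 1)) powr s" using k s_facts by (intro powr_mono2) auto
    then have "(\<kappa> ^ m) powr s * E \<le> exp (\<alpha> * r\<^sup>2 * (\<kappa> - 1) * s) * E"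
      by (intro mult_right_mono) (auto simp: E_def exp_powr_real)
    also have "\<dots> = exp (- s * (\<alpha> * (r * (\<kappa> - 1))\<^sup>2 / 2))"
      unfolding E_def exp_add[symmetric] by (simp add: power2_eq_square algebra_simps add_divide_distrib diff_divide_distrib)
    also have "r * (\<kappa> - 1) = t" using k(2) by (simp add: algebra_simps)
    also have "exp (- s * (\<alpha> * t\<^sup>2 / 2)) \<le> exp (- 1 * (\<alpha> * t\<^sup>2 / 2))"
      using s_facts \<alpha>0 by (intro exp_le_cancel_iff[THEN iffD2] mult_right_mono) auto
    finally show "(\<kappa> ^ m) powr s * E \<le> exp (- \<alpha> * t\<^sup>2 / 2)" by simp
  qed (auto simp: E_def)
  finally show ?thesis unfolding r_def .
qed


lemma poly_integrable:
  assumes "q > 0"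
  shows "integrable lborel (\<lambda>u. wmod (\<lambda>u. \<Sum>i<m. c i * u ^ i) u powr q)"
proof -
  have "\<forall>i. \<exists>K>0. \<forall>z. cmod z ^ i * exp (- (\<alpha> / 2) * (cmod z)\<^sup>2) \<le> K * exp (- (\<alpha> / 2 / 2) * (cmod z)\<^sup>2)"
    using poly_gauss(2)[of "\<alpha> / 2"] \<alpha>0 by auto
  then obtain K where K: "\<And>i. K i > 0"
    "\<And>i z. cmod z ^ i * exp (- (\<alpha> / 2) * (cmod z)\<^sup>2) \<le> K i * exp (- (\<alpha> / 2 / 2) * (cmod z)\<^sup>2)" by metis
  define B where "B = (\<Sum>i<m. cmod (c i) * K i)"
  have B: "B \<ge> 0" unfolding B_def by (intro sum_nonneg mult_nonneg_nonneg norm_ge_zero less_imp_le K(1))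
  have bd: "wmod (\<lambda>u. \<Sum>i<m. c i * u ^ i) u \<le> B * exp (- (\<alpha> / 2 / 2) * (cmod u)\<^sup>2)" for u
  proof -
    have "cmod (\<Sum>i<m. c i * u ^ i) \<le> (\<Sum>i<m. cmod (c i) * cmod u ^ i)"
      by (rule order_trans[OF norm_sum]) (simp add: norm_mult norm_power)
    then have "wmod (\<lambda>u. \<Sum>i<m. c i * u ^ i) u \<le> (\<Sum>i<m. cmod (c i) * cmod u ^ i) * exp (- (\<alpha> / 2) * (cmod u)\<^sup>2)"
      unfolding wmod_def by (simp add: mult_right_mono)
    also have "\<dots> = (\<Sum>i<m. cmod (c i) * (cmod u ^ i * exp (- (\<alpha> / 2) * (cmod u)\<^sup>2)))"
      by (simp add: sum_distrib_right mult.assoc)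
    also have "\<dots> \<le> (\<Sum>i<m. cmod (c i) * (K i * exp (- (\<alpha> / 2 / 2) * (cmod u)\<^sup>2)))"
      by (intro sum_mono mult_left_mono K) auto
    finally show ?thesis by (simp add: B_def sum_distrib_right mult.assoc)
  qed
  have i: "integrable lborel (\<lambda>u. B powr q * exp (- (q * \<alpha> / 4) * (cmod (u::complex))\<^sup>2))"
    using integrable_gauss[of "q * \<alpha> / 4"] \<alpha>0 assms by simp
  have [measurable]: "(\<lambda>u. \<Sum>i<m. c i * u ^ i) \<in> borel_measurable borel" by measurable
  show ?thesis
  proof (rule Bochner_Integration.integrable_bound[OF i])
    have "wmod (\<lambda>u. \<Sum>i<m. c i * u ^ i) u powr q \<le> B powr q * exp (- (q * \<alpha> / 4) * (cmod u)\<^sup>2)" for u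
    proof -
      have "wmod (\<lambda>u. \<Sum>i<m. c i * u ^ i) u powr q \<le> (B * exp (- (\<alpha> / 2 / 2) * (cmod u)\<^sup>2)) powr q"
        using assms by (intro powr_mono2 bd) auto
      also have "\<dots> = B powr q * exp (- (q * \<alpha> / 4) * (cmod u)\<^sup>2)"
        using B by (simp add: powr_mult exp_powr_real mult_ac)
      finally show ?thesis .
    qed
    then show "AE u in lborel. norm (wmod (\<lambda>u. \<Sum>i<m. c i * u ^ i) u powr q)
        \<le> norm (B powr q * exp (- (q * \<alpha> / 4) * (cmod u)\<^sup>2))"
      by (intro AE_I2) simp
  qed measurable
qed

text \<open>The rates balance as 1/4 + 1/8 - 1/2 = -1/8: the growing weight costs \<alpha>/4 after
  (x + 1)^2 \<le> 2 x^2 + 2, and the polynomial factor costs \<alpha>/8. Replacing x^2 by x prepares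
  a geometric series.\<close>

lemma tail_coefficient_bound:
  assumes x: "x \<ge> 1"
  shows "exp (\<alpha> / 8 * (x + 1)\<^sup>2) * ((1 + x * sqrt \<alpha>)\<^sup>2 * exp (- \<alpha> * x\<^sup>2 / 2)) \<le> 18 * exp (\<alpha> / 4) * exp (- \<alpha> / 8 * x)"
proof -
  have a: "exp (\<alpha> / 8 * (x + 1)\<^sup>2) \<le> exp (\<alpha> / 4) * exp (\<alpha> * x\<^sup>2 / 4)"
  proof -
    have "(x + 1)\<^sup>2 \<le> 2 * x\<^sup>2 + 2" using zero_le_power2[of "x - 1"] by (simp add: power2_eq_square algebra_simps)
    then have "\<alpha> / 8 * (x + 1)\<^sup>2 \<le> \<alpha> / 8 * (2 * x\<^sup>2 + 2)" using \<alpha>0 by (intro mult_left_mono) auto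
    then show ?thesis unfolding exp_add[symmetric] by (simp add: algebra_simps)
  qed
  have b: "(1 + x * sqrt \<alpha>)\<^sup>2 \<le> 18 * exp (\<alpha> * x\<^sup>2 / 8)"
  proof -
    have "(1 + x * sqrt \<alpha>)\<^sup>2 \<le> 2 + 2 * (x * sqrt \<alpha>)\<^sup>2"
      using zero_le_power2[of "x * sqrt \<alpha> - 1"] by (simp add: power2_eq_square algebra_simps)
    also have "(x * sqrt \<alpha>)\<^sup>2 = \<alpha> * x\<^sup>2" using \<alpha>0 by (simp add: power_mult_distrib)
    also have "2 + 2 * (\<alpha> * x\<^sup>2) = 2 + 16 * (\<alpha> * x\<^sup>2 / 8)" by simp
    also have "\<dots> \<le> 2 * exp (\<alpha> * x\<^sup>2 / 8) + 16 * exp (\<alpha> * x\<^sup>2 / 8)"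
    proof -
      have "1 \<le> exp (\<alpha> * x\<^sup>2 / 8)" using \<alpha>0 by simp
      moreover have "\<alpha> * x\<^sup>2 / 8 \<le> exp (\<alpha> * x\<^sup>2 / 8)" using exp_ge_add_one_self[of "\<alpha> * x\<^sup>2 / 8"] by linarith
      ultimately show ?thesis by linarith
    qed
    finally show ?thesis by simp
  qed
  have "exp (\<alpha> / 8 * (x + 1)\<^sup>2) * ((1 + x * sqrt \<alpha>)\<^sup>2 * exp (- \<alpha> * x\<^sup>2 / 2))
     \<le> (exp (\<alpha> / 4) * exp (\<alpha> * x\<^sup>2 / 4)) * ((18 * exp (\<alpha> * x\<^sup>2 / 8)) * exp (- \<alpha> * x\<^sup>2 / 2))"
    by (intro mult_mono a b) auto
  also have "\<dots> = 18 * exp (\<alpha> / 4) * (exp (\<alpha> * x\<^sup>2 / 4) * (exp (\<alpha> * x\<^sup>2 / 8) * exp (- \<alpha> * x\<^sup>2 / 2)))" by simp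
  also have "exp (\<alpha> * x\<^sup>2 / 4) * (exp (\<alpha> * x\<^sup>2 / 8) * exp (- \<alpha> * x\<^sup>2 / 2)) = exp (- \<alpha> / 8 * x\<^sup>2)"
    unfolding exp_add[symmetric] by (simp add: algebra_simps)
  also have "exp (- \<alpha> / 8 * x\<^sup>2) \<le> exp (- \<alpha> / 8 * x)"
  proof -
    have "x * 1 \<le> x * x" using x by (intro mult_left_mono) auto
    then show ?thesis using \<alpha>0 by (simp add: power2_eq_square)
  qed
  finally show ?thesis by simp
qed

text \<open>The tail survives a growing Gaussian weight, which is later spent to sum the tails of
  infinitely many possible neighbours. The factor decaying in C is what a large separation makes
  small.\<close>

lemma weighted_tail:
  obtains K where "K > 0"
    "\<And>m c C. \<lbrakk>m \<ge> 1; C \<ge> 1\<rbrakk> \<Longrightarrow>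
      (\<integral>\<^sup>+y. ennreal (exp (\<alpha> / 8 * (cmod y - sqrt (real m / \<alpha>))\<^sup>2) * wmod (\<lambda>u. \<Sum>i<m. c i * u ^ i) y powr s)
         * indicator {y. sqrt (real m / \<alpha>) + C \<le> cmod y} y \<partial>lborel)
      \<le> ennreal (K * exp (- \<alpha> / 8 * C)) * (\<integral>\<^sup>+y. ennreal (wmod (\<lambda>u. \<Sum>i<m. c i * u ^ i) y powr s) \<partial>lborel)"
proof -
  define e where "e = exp (- \<alpha> / 8)"
  have e: "0 < e" "e < 1" using \<alpha>0 by (auto simp: e_def)
  define K where "K = 18 * exp (\<alpha> / 4) / (1 - e)"
  have K: "K > 0" using e by (simp add: K_def)
  show ?thesis
  proof (rule that[OF K])
    fix m :: nat and c :: "nat \<Rightarrow> complex" and C :: real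
    assume m: "m \<ge> 1" and C: "C \<ge> 1"
    define Q where "Q = (\<lambda>u. \<Sum>i<m. c i * u ^ i)"
    define r where "r = sqrt (real m / \<alpha>)"
    define I where "I = (\<integral>\<^sup>+y. ennreal (wmod Q y powr s) \<partial>lborel)"
    have [measurable]: "Q \<in> borel_measurable borel" unfolding Q_def by measurable
    \<comment> \<open>The exterior is cut into annuli of width 1: on each one the weight is replaced
      by its value at the outer radius, and the annulus by the full exterior, to which
      \<open>polynomial_tail\<close> applies.\<close>
    define f where "f k y = ennreal (exp (\<alpha> / 8 * (C + real k + 1)\<^sup>2)) *
        (ennreal (wmod Q y powr s) * indicator {y. r + (C + real k) \<le> cmod y} y)" for k :: nat and y
    have "(\<integral>\<^sup>+y. ennreal (exp (\<alpha> / 8 * (cmod y - r)\<^sup>2) * wmod Q y powr s) * indicator {y. r + C \<le> cmod y} y \<partial>lborel)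
        \<le> (\<integral>\<^sup>+y. (\<Sum>k. f k y) \<partial>lborel)"
    proof (intro nn_integral_mono)
      fix y :: complex
      show "ennreal (exp (\<alpha> / 8 * (cmod y - r)\<^sup>2) * wmod Q y powr s) * indicator {y. r + C \<le> cmod y} y \<le> (\<Sum>k. f k y)"
      proof (cases "r + C \<le> cmod y")
        case True
        define k where "k = nat \<lfloor>cmod y - r - C\<rfloor>"
        have k: "real k \<le> cmod y - r - C" "cmod y - r - C < real k + 1"
          using True by (auto simp: k_def)
        have "(cmod y - r)\<^sup>2 \<le> (C + real k + 1)\<^sup>2" using k C by (intro power_mono) auto
        then have "exp (\<alpha> / 8 * (cmod y - r)\<^sup>2) \<le> exp (\<alpha> / 8 * (C + real k + 1)\<^sup>2)" using \<alpha>0 by simp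
        then have "ennreal (exp (\<alpha> / 8 * (cmod y - r)\<^sup>2) * wmod Q y powr s) \<le> f k y"
          using k by (simp add: f_def ennreal_mult'[symmetric] ennreal_leI mult_right_mono)
        also have "\<dots> \<le> (\<Sum>k. f k y)"
          using sum_le_suminf[of "\<lambda>k. f k y" "{k}"] by simp
        finally show ?thesis using True by simp
      qed simp
    qed
    also have "\<dots> = (\<Sum>k. \<integral>\<^sup>+y. f k y \<partial>lborel)"
      by (rule nn_integral_suminf) (simp add: f_def)
    also have "\<dots> \<le> (\<Sum>k. ennreal (18 * exp (\<alpha> / 4) * exp (- \<alpha> / 8 * C) * e ^ k) * I)"
    proof (intro suminf_le summableI)
      fix k
      have "(\<integral>\<^sup>+y. f k y \<partial>lborel) = ennreal (exp (\<alpha> / 8 * (C + real k + 1)\<^sup>2)) *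
          (\<integral>\<^sup>+y. ennreal (wmod Q y powr s) * indicator {y. r + (C + real k) \<le> cmod y} y \<partial>lborel)"
        unfolding f_def by (rule nn_integral_cmult) measurable
      also have "\<dots> \<le> ennreal (exp (\<alpha> / 8 * (C + real k + 1)\<^sup>2)) *
          (ennreal ((1 + (C + real k) * sqrt \<alpha>)\<^sup>2 * exp (- \<alpha> * (C + real k)\<^sup>2 / 2)) * I)"
        unfolding I_def Q_def r_def using m C by (intro mult_left_mono polynomial_tail) auto
      also have "\<dots> = ennreal (exp (\<alpha> / 8 * (C + real k + 1)\<^sup>2) *
          ((1 + (C + real k) * sqrt \<alpha>)\<^sup>2 * exp (- \<alpha> * (C + real k)\<^sup>2 / 2))) * I"
        by (simp add: ennreal_mult mult.assoc)
      also have "\<dots> \<le> ennreal (18 * exp (\<alpha> / 4) * exp (- \<alpha> / 8 * (C + real k))) * I"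
        using C by (intro mult_right_mono ennreal_leI tail_coefficient_bound) auto
      also have "exp (- \<alpha> / 8 * (C + real k)) = exp (- \<alpha> / 8 * C) * e ^ k"
        unfolding e_def exp_of_nat_mult[symmetric] exp_add[symmetric] by (simp add: algebra_simps)
      finally show "(\<integral>\<^sup>+y. f k y \<partial>lborel) \<le> ennreal (18 * exp (\<alpha> / 4) * exp (- \<alpha> / 8 * C) * e ^ k) * I"
        by (simp add: mult.assoc)
    qed
    also have "\<dots> = (\<Sum>k. ennreal (18 * exp (\<alpha> / 4) * exp (- \<alpha> / 8 * C) * e ^ k)) * I"
      by (rule ennreal_suminf_multc)
    also have "(\<Sum>k. ennreal (18 * exp (\<alpha> / 4) * exp (- \<alpha> / 8 * C) * e ^ k))
        = ennreal (18 * exp (\<alpha> / 4) * exp (- \<alpha> / 8 * C) * (1 / (1 - e)))"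
    proof (rule suminf_ennreal_eq)
      show "(\<lambda>k. 18 * exp (\<alpha> / 4) * exp (- \<alpha> / 8 * C) * e ^ k) sums
          (18 * exp (\<alpha> / 4) * exp (- \<alpha> / 8 * C) * (1 / (1 - e)))"
        by (intro sums_mult geometric_sums) (use e in simp)
    qed (use e in simp)
    also have "18 * exp (\<alpha> / 4) * exp (- \<alpha> / 8 * C) * (1 / (1 - e)) = K * exp (- \<alpha> / 8 * C)"
      by (simp add: K_def)
    finally show "(\<integral>\<^sup>+y. ennreal (exp (\<alpha> / 8 * (cmod y - sqrt (real m / \<alpha>))\<^sup>2) * wmod (\<lambda>u. \<Sum>i<m. c i * u ^ i) y powr s)
         * indicator {y. sqrt (real m / \<alpha>) + C \<le> cmod y} y \<partial>lborel)
      \<le> ennreal (K * exp (- \<alpha> / 8 * C)) * (\<integral>\<^sup>+y. ennreal (wmod (\<lambda>u. \<Sum>i<m. c i * u ^ i) y powr s) \<partial>lborel)"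
      unfolding Q_def r_def I_def .
  qed
qed

end

subsection \<open>Packing of disjoint discs\<close>

text \<open>Each disc contains a unit ball as close to z as the distance from z to the smaller disc
  of radius r l. These balls are disjoint, and each carries a portion of a fixed Gaussian integral
  comparable to its summand, so the bound is independent of the radii and of the number of
  discs.\<close>

lemma packing:
  fixes b :: real
  assumes b: "b > 0"
  obtains Z where "Z \<ge> 1"
    "\<And>A r C z. \<lbrakk>finite A; \<And>l. l \<in> A \<Longrightarrow> r l \<ge> 0; C \<ge> 1; disjoint_family_on (\<lambda>l. ball l (r l + C)) A;
        \<And>l. l \<in> A \<Longrightarrow> r l + C \<le> cmod (z - l)\<rbrakk>
      \<Longrightarrow> (\<Sum>l\<in>A. exp (- b * (cmod (z - l) - r l)\<^sup>2)) \<le> Z"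
proof -
  define \<Gamma> where "\<Gamma> = (LINT w|lborel. exp (- (b / 2) * (cmod w)\<^sup>2))"
  define \<beta> where "\<beta> = measure lborel (ball (0::complex) 1)"
  have \<beta>: "\<beta> > 0" unfolding \<beta>_def by (rule content_ball_pos) simp
  have \<beta>': "measure lborel (ball w 1) = \<beta>" for w :: complex by (simp add: \<beta>_def content_ball)
  have ig: "integrable lborel (\<lambda>w. exp (- (b / 2) * (cmod w)\<^sup>2))" using integrable_gauss[of "b / 2"] b by simp
  show ?thesis
  proof (rule that[of "max 1 (exp b * \<Gamma> / \<beta>)"])
    fix A :: "complex set" and r :: "complex \<Rightarrow> real" and C :: real and z :: complex
    assume A: "finite A" and r: "\<And>l. l \<in> A \<Longrightarrow> r l \<ge> 0" and C: "C \<ge> 1"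
      and dis: "disjoint_family_on (\<lambda>l. ball l (r l + C)) A"
      and z: "\<And>l. l \<in> A \<Longrightarrow> r l + C \<le> cmod (z - l)"
    \<comment> \<open>The point of the closed disc of radius r l nearest to z; C \<ge> 1 keeps the
      unit ball around it inside the enlarged disc.\<close>
    define w where "w l = l + of_real (r l / cmod (z - l)) * (z - l)" for l
    \<comment> \<open>The halved rate pays for replacing \<open>w l\<close> by an arbitrary point of
      its unit ball, since (\<tau> + 1)^2 \<le> 2 \<tau>^2 + 2.\<close>
    define g where "g y = exp (- (b / 2) * (cmod (z - y))\<^sup>2)" for y
    have g': "g (z + y) = exp (- (b / 2) * (cmod y)\<^sup>2)" for y by (simp add: g_def)
    have [measurable]: "g \<in> borel_measurable borel" unfolding g_def by measurable
    have ig': "integrable lborel g" using integrable_translate_iff[of g z] ig unfolding g' by simp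
    have Lg: "(LINT y|lborel. g y) = \<Gamma>" using integral_translate[of g z] unfolding g' \<Gamma>_def by simp
    have pos: "cmod (z - l) > 0" if "l \<in> A" for l using r[OF that] z[OF that] C by linarith
    have wl: "cmod (w l - l) = r l" if "l \<in> A" for l
      using pos[OF that] r[OF that] by (simp add: w_def norm_mult norm_divide)
    have zw: "cmod (z - w l) = cmod (z - l) - r l" if "l \<in> A" for l
    proof -
      have "z - w l = of_real (1 - r l / cmod (z - l)) * (z - l)" by (simp add: w_def algebra_simps)
      then have "cmod (z - w l) = \<bar>1 - r l / cmod (z - l)\<bar> * cmod (z - l)" by (simp only: norm_mult norm_of_real)
      also have "1 - r l / cmod (z - l) \<ge> 0" using pos[OF that] z[OF that] C by (simp add: field_simps)
      then have "\<bar>1 - r l / cmod (z - l)\<bar> = 1 - r l / cmod (z - l)" by simp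
      finally show ?thesis using pos[OF that] by (simp add: algebra_simps)
    qed
    have sub: "ball (w l) 1 \<subseteq> ball l (r l + C)" if "l \<in> A" for l
    proof
      fix y assume "y \<in> ball (w l) 1"
      then have "dist l y < r l + C" using wl[OF that] dist_triangle[of l y "w l"] C by (simp add: dist_norm norm_minus_commute)
      then show "y \<in> ball l (r l + C)" by simp
    qed
    have disw: "(\<Sum>l\<in>A. indicator (ball (w l) 1) y) \<le> (1::real)" for y
    proof (cases "\<exists>l\<in>A. y \<in> ball (w l) 1")
      case True
      then obtain l where l: "l \<in> A" "y \<in> ball (w l) 1" by blast
      have "indicator (ball (w l') 1) y = (0::real)" if "l' \<in> A - {l}" for l'
      proof -
        have "y \<notin> ball l' (r l' + C)"
          using dis l sub[OF l(1)] that unfolding disjoint_family_on_def by blast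
        then show ?thesis using sub[of l'] that by (auto simp: indicator_def)
      qed
      then have "(\<Sum>l\<in>A. indicator (ball (w l) 1) y) = (indicator (ball (w l) 1) y :: real)"
        using A l by (simp add: sum.remove[of A l])
      then show ?thesis by (simp add: indicator_def)
    next
      case False
      then have "(\<Sum>l\<in>A. indicator (ball (w l) 1) y) = (0::real)" by (intro sum.neutral) (auto simp: indicator_def)
      then show ?thesis by simp
    qed
    have ii: "integrable lborel (\<lambda>y. indicator (ball (w l) 1) y * g y)" for l
      using integrable_mult_indicator[OF _ ig', of "ball (w l) 1"] by simp
    have "\<beta> * exp (- b * (cmod (z - l) - r l)\<^sup>2) \<le> exp b * (LINT y|lborel. indicator (ball (w l) 1) y * g y)"
      if l: "l \<in> A" for l
    proof -
      have "\<beta> * exp (- b * (cmod (z - l) - r l)\<^sup>2) = (LINT y|lborel. indicator (ball (w l) 1) y * exp (- b * (cmod (z - l) - r l)\<^sup>2))"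
        using \<beta>'[of "w l"] by simp
      also have "\<dots> \<le> (LINT y|lborel. exp b * (indicator (ball (w l) 1) y * g y))"
      proof (intro integral_mono integrable_mult_right ii)
        show "integrable lborel (\<lambda>y. indicator (ball (w l) 1) y * exp (- b * (cmod (z - l) - r l)\<^sup>2))"
          using emeasure_lborel_ball_finite[of "w l" 1] by (intro integrable_mult_left integrable_real_indicator) auto
        fix y
        show "indicator (ball (w l) 1) y * exp (- b * (cmod (z - l) - r l)\<^sup>2) \<le> exp b * (indicator (ball (w l) 1) y * g y)"
        proof (cases "y \<in> ball (w l) 1")
          case True
          define \<tau> where "\<tau> = cmod (z - l) - r l"
          have "cmod (z - y) \<le> \<tau> + 1"
            using True zw[OF l] norm_triangle_ineq[of "z - w l" "w l - y"] by (simp add: \<tau>_def dist_norm)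
          then have "(cmod (z - y))\<^sup>2 \<le> (\<tau> + 1)\<^sup>2" by (intro power_mono) auto
          also have "\<dots> \<le> 2 * \<tau>\<^sup>2 + 2" using zero_le_power2[of "\<tau> - 1"] by (simp add: power2_eq_square algebra_simps)
          finally have "b / 2 * (cmod (z - y))\<^sup>2 \<le> b / 2 * (2 * \<tau>\<^sup>2 + 2)" using b by (intro mult_left_mono) auto
          then have "exp (- b * \<tau>\<^sup>2) \<le> exp b * g y"
            unfolding g_def exp_add[symmetric] by (simp add: algebra_simps)
          then show ?thesis using True by (simp add: \<tau>_def)
        qed simp
      qed
      finally show ?thesis by simp
    qed
    then have "(\<Sum>l\<in>A. \<beta> * exp (- b * (cmod (z - l) - r l)\<^sup>2)) \<le> (\<Sum>l\<in>A. exp b * (LINT y|lborel. indicator (ball (w l) 1) y * g y))"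
      by (rule sum_mono)
    also have "\<dots> = exp b * (LINT y|lborel. (\<Sum>l\<in>A. indicator (ball (w l) 1) y) * g y)"
      by (simp add: sum_distrib_left sum_distrib_right Bochner_Integration.integral_sum[OF ii])
    also have "\<dots> \<le> exp b * (LINT y|lborel. g y)"
    proof (intro mult_left_mono integral_mono ig')
      show "integrable lborel (\<lambda>y. (\<Sum>l\<in>A. indicator (ball (w l) 1) y) * g y)"
        unfolding sum_distrib_right by (intro Bochner_Integration.integrable_sum ii)
      fix y show "(\<Sum>l\<in>A. indicator (ball (w l) 1) y) * g y \<le> g y"
        using mult_right_mono[OF disw[of y], of "g y"] by (simp add: g_def)
    qed simp
    finally have "\<beta> * (\<Sum>l\<in>A. exp (- b * (cmod (z - l) - r l)\<^sup>2)) \<le> exp b * \<Gamma>"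
      by (simp add: sum_distrib_left Lg)
    then have "(\<Sum>l\<in>A. exp (- b * (cmod (z - l) - r l)\<^sup>2)) \<le> exp b * \<Gamma> / \<beta>"
      using \<beta> by (simp add: pos_le_divide_eq mult.commute)
    then show "(\<Sum>l\<in>A. exp (- b * (cmod (z - l) - r l)\<^sup>2)) \<le> max 1 (exp b * \<Gamma> / \<beta>)" by simp
  qed simp
qed

section \<open>Norms of well separated pieces\<close>

context fock
begin

text \<open>At a given z at most one enlarged disc is active, and its piece differs from the whole
  sum only by the tails of the others. After integration these tails amount to at most half of the
  left-hand side if C0 is large, and can be absorbed; this turns the pointwise factor 4 into
  8.\<close>

lemma separated_pieces:
  obtains C0 where "C0 \<ge> 1"
    "\<And>A m c e. \<lbrakk>finite A; \<And>l. l \<in> A \<Longrightarrow> m l \<ge> 1; disjoint_family_on (\<lambda>l. ball l (sqrt (real (m l) / \<alpha>) + C0)) A;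
       \<And>l. l \<in> A \<Longrightarrow> e l \<in> borel_measurable borel;
       \<And>l z. l \<in> A \<Longrightarrow> cmod (e l z) = wmod (\<lambda>u. \<Sum>i<m l. c l i * u ^ i) (z - l)\<rbrakk>
     \<Longrightarrow> (\<Sum>l\<in>A. \<integral>\<^sup>+u. ennreal (wmod (\<lambda>u. \<Sum>i<m l. c l i * u ^ i) u powr s) \<partial>lborel)
       \<le> 8 * (\<integral>\<^sup>+z. ennreal (cmod (\<Sum>l\<in>A. e l z) powr s) \<partial>lborel)"
proof -
  obtain K where K: "K > 0"
    "\<And>m c C. \<lbrakk>m \<ge> 1; C \<ge> 1\<rbrakk> \<Longrightarrow>
      (\<integral>\<^sup>+y. ennreal (exp (\<alpha> / 8 * (cmod y - sqrt (real m / \<alpha>))\<^sup>2) * wmod (\<lambda>u. \<Sum>i<m. c i * u ^ i) y powr s)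
         * indicator {y. sqrt (real m / \<alpha>) + C \<le> cmod y} y \<partial>lborel)
      \<le> ennreal (K * exp (- \<alpha> / 8 * C)) * (\<integral>\<^sup>+y. ennreal (wmod (\<lambda>u. \<Sum>i<m. c i * u ^ i) y powr s) \<partial>lborel)"
  proof (rule weighted_tail, goal_cases)
    case (1 K)
    show ?case by (rule 1(1)[OF 1(2) 1(3)])
  qed
  have b8: "\<alpha> / 8 > 0" using \<alpha>0 by simp
  obtain Z where Z: "Z \<ge> 1"
    "\<And>A r C z. \<lbrakk>finite A; \<And>l. l \<in> A \<Longrightarrow> r l \<ge> 0; C \<ge> 1; disjoint_family_on (\<lambda>l. ball l (r l + C)) A;
        \<And>l. l \<in> A \<Longrightarrow> r l + C \<le> cmod (z - l)\<rbrakk>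
      \<Longrightarrow> (\<Sum>l\<in>A. exp (- (\<alpha> / 8) * (cmod (z - l) - r l)\<^sup>2)) \<le> Z"
  proof (rule packing[OF b8], goal_cases)
    case (1 Z)
    show ?case by (rule 1(1)[OF 1(2) 1(3)])
  qed
  \<comment> \<open>The total coefficient of the tails in the pointwise bound \<open>pw\<close>,
    times the constant of \<open>weighted_tail\<close>; C0 is then chosen to bring D exp (-\<alpha>
    C0 / 8) below one half.\<close>
  define D where "D = (4 * Z + 1) * K"
  have D: "D > 0" using Z(1) K(1) by (simp add: D_def)
  define C0 where "C0 = max 1 (8 / \<alpha> * ln (2 * D))"
  have C0: "C0 \<ge> 1" by (simp add: C0_def)
  have small: "D * exp (- \<alpha> / 8 * C0) \<le> 1 / 2"
  proof -
    have "8 / \<alpha> * ln (2 * D) \<le> C0" by (simp add: C0_def)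
    then have "\<alpha> / 8 * (8 / \<alpha> * ln (2 * D)) \<le> \<alpha> / 8 * C0" using \<alpha>0 by (intro mult_left_mono) auto
    moreover have "\<alpha> / 8 * (8 / \<alpha> * ln (2 * D)) = ln (2 * D)" using \<alpha>0 by simp
    ultimately have "ln (2 * D) \<le> \<alpha> / 8 * C0" by linarith
    then have "exp (- \<alpha> / 8 * C0) \<le> exp (- ln (2 * D))" by simp
    also have "\<dots> = inverse (2 * D)" unfolding exp_minus using D by simp
    finally have "D * exp (- \<alpha> / 8 * C0) \<le> D * inverse (2 * D)" using D by (intro mult_left_mono) auto
    also have "\<dots> = 1 / 2" using D by (simp add: field_simps)
    finally show ?thesis .
  qed
  show ?thesis
  proof (rule that[OF C0])
    fix A :: "complex set" and m :: "complex \<Rightarrow> nat" and c :: "complex \<Rightarrow> nat \<Rightarrow> complex" and e :: "complex \<Rightarrow> complex \<Rightarrow> complex"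
    assume A: "finite A" and m: "\<And>l. l \<in> A \<Longrightarrow> m l \<ge> 1"
      and dis: "disjoint_family_on (\<lambda>l. ball l (sqrt (real (m l) / \<alpha>) + C0)) A"
      and me: "\<And>l. l \<in> A \<Longrightarrow> e l \<in> borel_measurable borel"
      and ce: "\<And>l z. l \<in> A \<Longrightarrow> cmod (e l z) = wmod (\<lambda>u. \<Sum>i<m l. c l i * u ^ i) (z - l)"
    define r where "r l = sqrt (real (m l) / \<alpha>)" for l
    have r0: "r l \<ge> 0" for l using \<alpha>0 by (simp add: r_def)
    define Q where "Q l = (\<lambda>u. \<Sum>i<m l. c l i * u ^ i)" for l
    have [measurable]: "Q l \<in> borel_measurable borel" for l unfolding Q_def by measurable
    define H where "H l z = wmod (Q l) (z - l)" for l z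
    have H0: "H l z \<ge> 0" for l z by (simp add: H_def)
    define \<eta> where "\<eta> z = (\<Sum>l\<in>A. e l z)" for z
    define E where "E l z = exp (\<alpha> / 8 * (cmod (z - l) - r l)\<^sup>2) * H l z powr s * indicator {z. r l + C0 \<le> cmod (z - l)} z" for l z
    have E0: "E l z \<ge> 0" for l z by (simp add: E_def)
    have [measurable]: "H l \<in> borel_measurable borel" "E l \<in> borel_measurable borel" for l
      unfolding H_def E_def by measurable
    define J where "J l = (\<integral>\<^sup>+u. ennreal (wmod (Q l) u powr s) \<partial>lborel)" for l
    have H_int: "(\<integral>\<^sup>+z. ennreal (H l z powr s) \<partial>lborel) = J l" for l
      using nn_integral_translate[of "\<lambda>u. ennreal (H l u powr s)" l] by (simp add: J_def H_def)
    have E_int: "(\<integral>\<^sup>+z. ennreal (E l z) \<partial>lborel) \<le> ennreal (K * exp (- \<alpha> / 8 * C0)) * J l" if "l \<in> A" for l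
    proof -
      have "(\<integral>\<^sup>+z. ennreal (E l z) \<partial>lborel) = (\<integral>\<^sup>+z. ennreal (E l (l + z)) \<partial>lborel)"
        by (rule nn_integral_translate[symmetric]) measurable
      also have "\<dots> = (\<integral>\<^sup>+y. ennreal (exp (\<alpha> / 8 * (cmod y - r l)\<^sup>2) * wmod (Q l) y powr s) * indicator {y. r l + C0 \<le> cmod y} y \<partial>lborel)"
        by (intro nn_integral_cong) (auto simp: E_def H_def split: split_indicator)
      also have "\<dots> \<le> ennreal (K * exp (- \<alpha> / 8 * C0)) * J l"
        unfolding J_def Q_def r_def by (rule K(2)[OF m[OF that] C0])
      finally show ?thesis .
    qed
    \<comment> \<open>The power mean over the distant points with decaying Gaussian weights, whose
      sum is at most Z by packing. The compensating growing factor appears to the power s - 1 \<le>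
      1 and is therefore covered by the weight in E.\<close>
    have S_bound: "(\<Sum>l\<in>{l\<in>A. r l + C0 \<le> cmod (z - l)}. H l z) powr s \<le> Z * (\<Sum>l\<in>A. E l z)" for z
    proof -
      define B where "B = {l\<in>A. r l + C0 \<le> cmod (z - l)}"
      have B: "finite B" "B \<subseteq> A" using A by (auto simp: B_def)
      define \<tau> where "\<tau> l = cmod (z - l) - r l" for l
      define w where "w l = exp (- (\<alpha> / 8) * (\<tau> l)\<^sup>2)" for l
      define g where "g l = exp (\<alpha> / 8 * (\<tau> l)\<^sup>2) * H l z" for l
      have wg: "w l * g l = H l z" for l
        unfolding w_def g_def mult.assoc[symmetric] exp_add[symmetric] by simp
      have wgs: "w l * g l powr s \<le> E l z" if "l \<in> B" for l
      proof -
        have "w l * g l powr s = exp ((s - 1) * (\<alpha> / 8 * (\<tau> l)\<^sup>2)) * H l z powr s"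
        proof -
          have "g l powr s = exp (\<alpha> / 8 * (\<tau> l)\<^sup>2 * s) * H l z powr s"
            unfolding g_def using H0[of l z] by (simp add: powr_mult exp_powr_real)
          then have "w l * g l powr s = (exp (- (\<alpha> / 8) * (\<tau> l)\<^sup>2) * exp (\<alpha> / 8 * (\<tau> l)\<^sup>2 * s)) * H l z powr s"
            by (simp only: w_def mult.assoc)
          also have "exp (- (\<alpha> / 8) * (\<tau> l)\<^sup>2) * exp (\<alpha> / 8 * (\<tau> l)\<^sup>2 * s) = exp ((s - 1) * (\<alpha> / 8 * (\<tau> l)\<^sup>2))"
            unfolding exp_add[symmetric] by (rule arg_cong[of _ _ exp]) (simp only: algebra_simps)
          finally show ?thesis .
        qed
        also have "\<dots> \<le> exp (1 * (\<alpha> / 8 * (\<tau> l)\<^sup>2)) * H l z powr s"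
          using s_facts \<alpha>0 by (intro mult_right_mono exp_le_cancel_iff[THEN iffD2]) auto
        also have "\<dots> = E l z" using that by (simp add: E_def B_def \<tau>_def)
        finally show ?thesis .
      qed
      have "(LINT l|count_space B. w l * g l) powr s
          \<le> (LINT l|count_space B. w l) powr (s - 1) * (LINT l|count_space B. w l * g l powr s)"
        by (rule power_mean) (use s_facts B in \<open>auto simp: w_def g_def H0 integrable_count_space\<close>)
      then have "(\<Sum>l\<in>B. H l z) powr s \<le> (\<Sum>l\<in>B. w l) powr (s - 1) * (\<Sum>l\<in>B. w l * g l powr s)"
        using B by (simp add: lebesgue_integral_count_space_finite wg)
      also have "\<dots> \<le> Z * (\<Sum>l\<in>A. E l z)"
      proof (intro mult_mono)
        have "(\<Sum>l\<in>B. w l) \<le> Z" unfolding w_def \<tau>_def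
          by (rule Z(2)[OF B(1) r0 C0]) (use dis B in \<open>auto simp: r_def B_def intro: disjoint_family_on_mono\<close>)
        then have "(\<Sum>l\<in>B. w l) powr (s - 1) \<le> Z powr (s - 1)"
          using s_facts by (intro powr_mono2) (auto intro: sum_nonneg simp: w_def)
        also have "\<dots> \<le> Z powr 1" using Z(1) s_facts by (intro powr_mono) auto
        finally show "(\<Sum>l\<in>B. w l) powr (s - 1) \<le> Z" using Z(1) by simp
        have "(\<Sum>l\<in>B. w l * g l powr s) \<le> (\<Sum>l\<in>B. E l z)" by (rule sum_mono) (rule wgs)
        also have "\<dots> \<le> (\<Sum>l\<in>A. E l z)" by (rule sum_mono2) (use A B E0 in auto)
        finally show "(\<Sum>l\<in>B. w l * g l powr s) \<le> (\<Sum>l\<in>A. E l z)" .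
      qed (use Z(1) in \<open>auto intro!: sum_nonneg simp: w_def\<close>)
      finally show ?thesis unfolding B_def .
    qed
    have pw: "(\<Sum>l\<in>A. H l z powr s) \<le> 4 * cmod (\<eta> z) powr s + (4 * Z + 1) * (\<Sum>l\<in>A. E l z)" for z
    proof -
      define B where "B = {l\<in>A. r l + C0 \<le> cmod (z - l)}"
      have BA: "B \<subseteq> A" "finite B" using A by (auto simp: B_def)
      define S where "S = (\<Sum>l\<in>B. H l z)"
      have S0: "S \<ge> 0" unfolding S_def by (intro sum_nonneg H0)
      have outer: "(\<Sum>l\<in>B. H l z powr s) \<le> (\<Sum>l\<in>A. E l z)"
      proof -
        have "(\<Sum>l\<in>B. H l z powr s) \<le> (\<Sum>l\<in>B. E l z)"
        proof (intro sum_mono)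
          fix l assume "l \<in> B"
          have "1 * H l z powr s \<le> exp (\<alpha> / 8 * (cmod (z - l) - r l)\<^sup>2) * H l z powr s"
            using \<alpha>0 by (intro mult_right_mono) auto
          then show "H l z powr s \<le> E l z" using \<open>l \<in> B\<close> by (simp add: E_def B_def)
        qed
        also have "\<dots> \<le> (\<Sum>l\<in>A. E l z)" by (rule sum_mono2) (use A BA E0 in auto)
        finally show ?thesis .
      qed
      \<comment> \<open>Disjointness of the enlarged discs leaves at most one point in A - B; its
        piece is the total minus the pieces seen from outside their discs.\<close>
      have inner: "(\<Sum>l\<in>A - B. H l z powr s) \<le> 4 * (cmod (\<eta> z) powr s + S powr s)"
      proof (cases "A - B = {}")
        case True
        show ?thesis unfolding True using S0 by simp
      next
        case False
        then obtain l where l: "l \<in> A" "l \<notin> B" by blast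
        have mb: "z \<in> ball l (r l + C0)" if "l \<in> A" "l \<notin> B" for l
        proof -
          have "cmod (z - l) < r l + C0" using that unfolding B_def by auto
          then show ?thesis unfolding mem_ball dist_norm norm_minus_commute[of l z] .
        qed
        have dis': "disjoint_family_on (\<lambda>l. ball l (r l + C0)) A" using dis unfolding r_def .
        have AB: "A - B = {l}"
        proof -
          have "l' = l" if "l' \<in> A" "l' \<notin> B" for l'
          proof (rule ccontr)
            assume "l' \<noteq> l"
            then have "ball l' (r l' + C0) \<inter> ball l (r l + C0) = {}"
              using disjoint_family_onD[OF dis' that(1) l(1)] by blast
            with mb[OF l] mb[OF that] show False by blast
          qed
          then show ?thesis using l by blast
        qed
        then have Al: "A = insert l B" using BA l by blast
        have "\<eta> z = e l z + (\<Sum>l\<in>B. e l z)" unfolding \<eta>_def Al using BA l by simp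
        then have "e l z = \<eta> z - (\<Sum>l\<in>B. e l z)" by simp
        then have "cmod (e l z) \<le> cmod (\<eta> z) + cmod (\<Sum>l\<in>B. e l z)" by (metis norm_triangle_ineq4)
        also have "cmod (\<Sum>l\<in>B. e l z) \<le> S" unfolding S_def
          by (rule order_trans[OF norm_sum]) (use BA ce in \<open>auto simp: H_def Q_def intro!: sum_mono\<close>)
        finally have "H l z \<le> cmod (\<eta> z) + S" using ce[OF l(1)] by (simp add: H_def Q_def)
        then have "H l z powr s \<le> (cmod (\<eta> z) + S) powr s" using s_facts H0 by (intro powr_mono2) auto
        also have "\<dots> \<le> 2 powr s * (cmod (\<eta> z) powr s + S powr s)" using s_facts S0 by (intro powr_add_le) auto
        also have "\<dots> \<le> 2 powr 2 * (cmod (\<eta> z) powr s + S powr s)"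
          using s_facts by (intro mult_right_mono powr_mono) auto
        finally show ?thesis unfolding AB by simp
      qed
      have "(\<Sum>l\<in>A. H l z powr s) = (\<Sum>l\<in>A - B. H l z powr s) + (\<Sum>l\<in>B. H l z powr s)"
        using sum.subset_diff[OF BA(1) A] .
      also have "\<dots> \<le> 4 * (cmod (\<eta> z) powr s + Z * (\<Sum>l\<in>A. E l z)) + (\<Sum>l\<in>A. E l z)"
      proof (rule add_mono[OF order_trans[OF inner] outer])
        have "S powr s \<le> Z * (\<Sum>l\<in>A. E l z)" using S_bound[of z] unfolding S_def B_def .
        then show "4 * (cmod (\<eta> z) powr s + S powr s) \<le> 4 * (cmod (\<eta> z) powr s + Z * (\<Sum>l\<in>A. E l z))"
          by (intro mult_left_mono add_left_mono) auto
      qed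
      finally show ?thesis by (simp add: algebra_simps)
    qed
    have [measurable]: "\<eta> \<in> borel_measurable borel" unfolding \<eta>_def using me by (intro borel_measurable_sum) auto
    have Jfin: "J l < \<infinity>" for l
      using poly_integrable[where q=s and m="m l" and c="c l"] s_facts unfolding integrable_iff_bounded J_def Q_def by simp
    define X where "X = (\<Sum>l\<in>A. J l)"
    define Y where "Y = (\<integral>\<^sup>+z. ennreal (cmod (\<eta> z) powr s) \<partial>lborel)"
    have "X = (\<Sum>l\<in>A. \<integral>\<^sup>+z. ennreal (H l z powr s) \<partial>lborel)"
      by (simp only: X_def H_int)
    also have "\<dots> = (\<integral>\<^sup>+z. (\<Sum>l\<in>A. ennreal (H l z powr s)) \<partial>lborel)"
      by (rule nn_integral_sum[symmetric]) simp
    also have "\<dots> \<le> (\<integral>\<^sup>+z. ennreal 4 * ennreal (cmod (\<eta> z) powr s) + ennreal (4 * Z + 1) * (\<Sum>l\<in>A. ennreal (E l z)) \<partial>lborel)"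
    proof (intro nn_integral_mono)
      fix z
      have "(\<Sum>l\<in>A. ennreal (H l z powr s)) = ennreal (\<Sum>l\<in>A. H l z powr s)"
        by (rule sum_ennreal) simp
      also have "\<dots> \<le> ennreal (4 * cmod (\<eta> z) powr s + (4 * Z + 1) * (\<Sum>l\<in>A. E l z))"
        by (rule ennreal_leI[OF pw])
      also have "\<dots> = ennreal (4 * cmod (\<eta> z) powr s) + ennreal ((4 * Z + 1) * (\<Sum>l\<in>A. E l z))"
        using Z(1) by (intro ennreal_plus mult_nonneg_nonneg sum_nonneg E0) auto
      also have "ennreal (4 * cmod (\<eta> z) powr s) = ennreal 4 * ennreal (cmod (\<eta> z) powr s)"
        by (rule ennreal_mult) auto
      also have "ennreal ((4 * Z + 1) * (\<Sum>l\<in>A. E l z)) = ennreal (4 * Z + 1) * ennreal (\<Sum>l\<in>A. E l z)"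
        using Z(1) by (intro ennreal_mult sum_nonneg E0) auto
      also have "ennreal (\<Sum>l\<in>A. E l z) = (\<Sum>l\<in>A. ennreal (E l z))"
        by (rule sum_ennreal[symmetric]) (rule E0)
      finally show "(\<Sum>l\<in>A. ennreal (H l z powr s))
          \<le> ennreal 4 * ennreal (cmod (\<eta> z) powr s) + ennreal (4 * Z + 1) * (\<Sum>l\<in>A. ennreal (E l z))" .
    qed
    also have "\<dots> = (\<integral>\<^sup>+z. ennreal 4 * ennreal (cmod (\<eta> z) powr s) \<partial>lborel)
        + (\<integral>\<^sup>+z. ennreal (4 * Z + 1) * (\<Sum>l\<in>A. ennreal (E l z)) \<partial>lborel)"
      by (rule nn_integral_add) measurable
    also have "(\<integral>\<^sup>+z. ennreal 4 * ennreal (cmod (\<eta> z) powr s) \<partial>lborel) = ennreal 4 * Y"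
      unfolding Y_def by (rule nn_integral_cmult) measurable
    also have "(\<integral>\<^sup>+z. ennreal (4 * Z + 1) * (\<Sum>l\<in>A. ennreal (E l z)) \<partial>lborel)
        = ennreal (4 * Z + 1) * (\<integral>\<^sup>+z. (\<Sum>l\<in>A. ennreal (E l z)) \<partial>lborel)"
      by (rule nn_integral_cmult) measurable
    also have "(\<integral>\<^sup>+z. (\<Sum>l\<in>A. ennreal (E l z)) \<partial>lborel) = (\<Sum>l\<in>A. \<integral>\<^sup>+z. ennreal (E l z) \<partial>lborel)"
      by (rule nn_integral_sum) simp
    also have "ennreal 4 * Y + ennreal (4 * Z + 1) * (\<Sum>l\<in>A. \<integral>\<^sup>+z. ennreal (E l z) \<partial>lborel)
        \<le> ennreal 4 * Y + ennreal (4 * Z + 1) * (\<Sum>l\<in>A. ennreal (K * exp (- \<alpha> / 8 * C0)) * J l)"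
      by (intro add_left_mono mult_left_mono sum_mono E_int) auto
    also have "(\<Sum>l\<in>A. ennreal (K * exp (- \<alpha> / 8 * C0)) * J l) = ennreal (K * exp (- \<alpha> / 8 * C0)) * X"
      by (simp only: X_def sum_distrib_left)
    also have "ennreal (4 * Z + 1) * (ennreal (K * exp (- \<alpha> / 8 * C0)) * X) = ennreal ((4 * Z + 1) * (K * exp (- \<alpha> / 8 * C0))) * X"
      unfolding mult.assoc[symmetric] using Z(1) K(1) by (subst ennreal_mult[symmetric]) (auto simp: mult.assoc)
    also have "ennreal 4 * Y + ennreal ((4 * Z + 1) * (K * exp (- \<alpha> / 8 * C0))) * X \<le> ennreal 4 * Y + ennreal (1 / 2) * X"
    proof (intro add_left_mono mult_right_mono ennreal_leI)
      show "(4 * Z + 1) * (K * exp (- \<alpha> / 8 * C0)) \<le> 1 / 2"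
        using small unfolding D_def mult.assoc .
    qed simp
    finally have XY: "X \<le> ennreal 4 * Y + ennreal (1 / 2) * X" .
    \<comment> \<open>Finiteness is essential here: it permits subtracting X / 2 from both sides of
      \<open>XY\<close>.\<close>
    have "X < \<infinity>" unfolding X_def using Jfin A by (simp add: ennreal_sum_less_top)
    then obtain x where x: "X = ennreal x" "x \<ge> 0" by (cases X) auto
    have "X \<le> 8 * Y"
    proof (cases Y)
      case (real y)
      then have y: "Y = ennreal y" "0 \<le> y" by auto
      have a: "ennreal (4 * y) = ennreal 4 * ennreal y" by (rule ennreal_mult) (use y in auto)
      have b: "ennreal (1 / 2 * x) = ennreal (1 / 2) * ennreal x" by (rule ennreal_mult) (use x in auto)
      have c: "ennreal (4 * y + 1 / 2 * x) = ennreal (4 * y) + ennreal (1 / 2 * x)"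
        by (rule ennreal_plus) (use x y in auto)
      have "ennreal x \<le> ennreal (4 * y + 1 / 2 * x)" unfolding c a b using XY by (simp only: x(1) y(1))
      then have "x \<le> 4 * y + 1 / 2 * x"
        by (subst (asm) ennreal_le_iff) (use x(2) y(2) in auto)
      then have "ennreal x \<le> ennreal (8 * y)" by (intro ennreal_leI) simp
      also have "ennreal (8 * y) = ennreal 8 * ennreal y" using y(2) by (intro ennreal_mult) auto
      finally show ?thesis unfolding x(1) y(1) by simp
    next
      case top
      then show ?thesis by (simp add: ennreal_mult_top)
    qed
    then show "(\<Sum>l\<in>A. \<integral>\<^sup>+u. ennreal (wmod (\<lambda>u. \<Sum>i<m l. c l i * u ^ i) u powr s) \<partial>lborel)
       \<le> 8 * (\<integral>\<^sup>+z. ennreal (cmod (\<Sum>l\<in>A. e l z) powr s) \<partial>lborel)"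
      unfolding X_def Y_def J_def Q_def \<eta>_def .
  qed
qed

end

subsection \<open>Linear functionals with a common kernel\<close>

text \<open>Induction on I by restricting L to the kernel of one functional; a vector on which that
  functional does not vanish determines its coefficient. Applied with moments as the functionals, it
  expands the annihilating functional over the points of the divisor.\<close>

lemma functional_combination:
  fixes L :: "(complex \<Rightarrow> complex) \<Rightarrow> complex" and \<Phi> :: "'i \<Rightarrow> (complex \<Rightarrow> complex) \<Rightarrow> complex"
  assumes "finite I"
    and "\<And>f g. f \<in> V \<Longrightarrow> g \<in> V \<Longrightarrow> (\<lambda>z. f z + g z) \<in> V" "\<And>c f. f \<in> V \<Longrightarrow> (\<lambda>z. c * f z) \<in> V"
    and "\<And>f g. f \<in> V \<Longrightarrow> g \<in> V \<Longrightarrow> L (\<lambda>z. f z + g z) = L f + L g" "\<And>c f. f \<in> V \<Longrightarrow> L (\<lambda>z. c * f z) = c * L f"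
    and "\<And>i f g. f \<in> V \<Longrightarrow> g \<in> V \<Longrightarrow> \<Phi> i (\<lambda>z. f z + g z) = \<Phi> i f + \<Phi> i g"
    and "\<And>i c f. f \<in> V \<Longrightarrow> \<Phi> i (\<lambda>z. c * f z) = c * \<Phi> i f"
    and "\<And>f. f \<in> V \<Longrightarrow> (\<And>i. i \<in> I \<Longrightarrow> \<Phi> i f = 0) \<Longrightarrow> L f = 0"
  shows "\<exists>c. \<forall>f\<in>V. L f = (\<Sum>i\<in>I. c i * \<Phi> i f)"
  using assms
proof (induction I arbitrary: V rule: finite_induct)
  case empty
  then show ?case by simp
next
  case (insert a I)
  define V' where "V' = {f \<in> V. \<Phi> a f = 0}"
  have "\<exists>c. \<forall>f\<in>V'. L f = (\<Sum>i\<in>I. c i * \<Phi> i f)"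
  proof (rule insert.IH)
    show "\<And>f. f \<in> V' \<Longrightarrow> (\<And>i. i \<in> I \<Longrightarrow> \<Phi> i f = 0) \<Longrightarrow> L f = 0"
      using insert.prems(7) by (auto simp: V'_def)
  qed (use insert.prems in \<open>auto simp: V'_def\<close>)
  then obtain c where c: "\<And>f. f \<in> V' \<Longrightarrow> L f = (\<Sum>i\<in>I. c i * \<Phi> i f)" by blast
  show ?case
  proof (cases "\<exists>v\<in>V. \<Phi> a v \<noteq> 0")
    case False
    then have "L f = (\<Sum>i\<in>insert a I. c i * \<Phi> i f)" if "f \<in> V" for f
      using c[of f] that insert.hyps by (auto simp: V'_def)
    then show ?thesis by blast
  next
    case True
    then obtain v where v: "v \<in> V" "\<Phi> a v \<noteq> 0" by blast
    define d where "d = (L v - (\<Sum>i\<in>I. c i * \<Phi> i v)) / \<Phi> a v"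
    have "L f = (\<Sum>i\<in>insert a I. (c(a := d)) i * \<Phi> i f)" if f: "f \<in> V" for f
    proof -
      define t where "t = - (\<Phi> a f / \<Phi> a v)"
      have tv: "(\<lambda>z. t * v z) \<in> V" using insert.prems(2) v by blast
      have fv: "(\<lambda>z. f z + t * v z) \<in> V" using insert.prems(1)[OF f tv] .
      have \<Phi>: "\<Phi> i (\<lambda>z. f z + t * v z) = \<Phi> i f + t * \<Phi> i v" for i
        using insert.prems(5)[OF f tv] insert.prems(6)[OF v(1)] by simp
      have "\<Phi> a (\<lambda>z. f z + t * v z) = 0" unfolding \<Phi> using v by (simp add: t_def)
      then have "(\<lambda>z. f z + t * v z) \<in> V'" using fv by (simp add: V'_def)
      from c[OF this] have "L f + t * L v = (\<Sum>i\<in>I. c i * (\<Phi> i f + t * \<Phi> i v))"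
        unfolding insert.prems(3)[OF f tv] insert.prems(4)[OF v(1)] \<Phi> .
      also have "\<dots> = (\<Sum>i\<in>I. c i * \<Phi> i f) + t * (\<Sum>i\<in>I. c i * \<Phi> i v)"
        by (simp add: sum.distrib sum_distrib_left algebra_simps)
      finally have "L f = (\<Sum>i\<in>I. c i * \<Phi> i f) - t * (L v - (\<Sum>i\<in>I. c i * \<Phi> i v))"
        by (simp add: algebra_simps)
      also have "- t * (L v - (\<Sum>i\<in>I. c i * \<Phi> i v)) = d * \<Phi> a f"
        using v by (simp add: t_def d_def)
      then have "(\<Sum>i\<in>I. c i * \<Phi> i f) - t * (L v - (\<Sum>i\<in>I. c i * \<Phi> i v)) = d * \<Phi> a f + (\<Sum>i\<in>I. c i * \<Phi> i f)"
        by simp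
      also have "(\<Sum>i\<in>I. c i * \<Phi> i f) = (\<Sum>i\<in>I. (c(a := d)) i * \<Phi> i f)"
        using insert.hyps by (intro sum.cong) auto
      finally show ?thesis using insert.hyps by simp
    qed
    then show ?thesis by blast
  qed
qed

subsection \<open>Hermite interpolation by polynomials\<close>

text \<open>Newton's scheme: at the new point the order of contact is raised one step at a time by a
  multiple of (z - a)^k times a polynomial that vanishes to full order at all earlier
  points.\<close>

lemma hermite_interpolation:
  assumes "finite A" "\<And>l. l \<in> A \<Longrightarrow> F l holomorphic_on UNIV"
  shows "\<exists>P. \<forall>l\<in>A. vanish l (m l) (\<lambda>z. poly P z - F l z)"
  using assms
proof (induction A rule: finite_induct)
  case empty
  then show ?case by simp
next
  case (insert a A)
  then obtain P0 where P0: "\<And>l. l \<in> A \<Longrightarrow> vanish l (m l) (\<lambda>z. poly P0 z - F l z)" by blast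
  define pr where "pr = (\<Prod>l\<in>A. [:- l, 1:] ^ m l)"
  have pra: "poly pr a \<noteq> 0" using insert.hyps by (auto simp: pr_def poly_prod)
  have prv: "vanish l (m l) (poly (R * pr))" if "l \<in> A" for l R
  proof -
    have "poly (R * pr) z = (z - l) ^ m l * poly (R * (\<Prod>l\<in>A - {l}. [:- l, 1:] ^ m l)) z" for z
      using that insert.hyps(1) by (simp add: pr_def prod.remove[of A l])
    then show ?thesis unfolding vanish_def
      by (intro exI[of _ "poly (R * (\<Prod>l\<in>A - {l}. [:- l, 1:] ^ m l))"]) (auto intro!: holomorphic_intros)
  qed
  have "\<exists>P. (\<forall>l\<in>A. vanish l (m l) (\<lambda>z. poly P z - F l z)) \<and> vanish a k (\<lambda>z. poly P z - F a z)" for k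
  proof (induction k)
    case 0
    have "(\<lambda>z. poly P0 z - F a z) holomorphic_on UNIV"
      using insert.prems by (intro holomorphic_intros) auto
    then show ?case using P0 vanish_0 by blast
  next
    case (Suc k)
    then obtain P where P: "\<And>l. l \<in> A \<Longrightarrow> vanish l (m l) (\<lambda>z. poly P z - F l z)"
      "vanish a k (\<lambda>z. poly P z - F a z)" by blast
    obtain h where h: "h holomorphic_on UNIV" "\<And>z. poly P z - F a z = (z - a) ^ k * h z"
      using P(2) unfolding vanish_def by auto
    define c where "c = - h a / poly pr a"
    define R where "R = P + [:c:] * [:- a, 1:] ^ k * pr"
    have "vanish l (m l) (\<lambda>z. poly R z - F l z)" if "l \<in> A" for l
    proof -
      have "(\<lambda>z. poly R z - F l z) = (\<lambda>z. (poly P z - F l z) + poly ([:c:] * [:- a, 1:] ^ k * pr) z)"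
        by (simp add: R_def fun_eq_iff)
      then show ?thesis using vanish_add[OF P(1)[OF that] prv[OF that]] by metis
    qed
    moreover have "vanish a (Suc k) (\<lambda>z. poly R z - F a z)"
    proof (rule vanish_Suc)
      show "(\<lambda>z. h z + c * poly pr z) holomorphic_on UNIV" using h by (intro holomorphic_intros)
      show "poly R z - F a z = (z - a) ^ k * (h z + c * poly pr z)" for z
      proof -
        have "poly R z - F a z = (poly P z - F a z) + c * (z - a) ^ k * poly pr z"
          by (simp add: R_def)
        then show ?thesis unfolding h(2) by (simp add: distrib_left)
      qed
      show "h a + c * poly pr a = 0" using pra by (simp add: c_def)
    qed
    ultimately show ?case by blast
  qed
  from this[of "m a"] show ?case by blast
qed

context fock
begin

lemma poly_FS: "poly P \<in> FS"
proof -
  have "poly P = (\<lambda>z. \<Sum>i<Suc (degree P). coeff P i * z ^ i)"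
    by (simp add: poly_altdef fun_eq_iff lessThan_Suc_atMost)
  then have "integrable lborel (\<lambda>z. wmod (poly P) z powr p)"
    using poly_integrable[where q=p and m="Suc (degree P)" and c="coeff P"] p2 by simp
  then show ?thesis by (simp add: FS_iff) (intro holomorphic_intros)
qed

lemma power_FS: "(\<lambda>z. z ^ j) \<in> FS"
proof -
  have "poly (monom 1 j) = (\<lambda>z::complex. z ^ j)" by (rule ext) (simp add: poly_monom)
  then show ?thesis using poly_FS[of "monom 1 j"] by (simp only:)
qed

subsection \<open>The extremal problem and its dual function\<close>

text \<open>The small coefficient sits on the exponent s, where the term will be absorbed; c is
  chosen so that c^s / s = \<delta>.\<close>

lemma young_eps:
  assumes d: "\<delta> > 0"
  obtains K where "K \<ge> 0" "\<And>a b. a \<ge> 0 \<Longrightarrow> b \<ge> 0 \<Longrightarrow> a * b \<le> K * a powr p + \<delta> * b powr s"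
proof
  define c where "c = (s * \<delta>) powr (1 / s)"
  have c: "c > 0" "c powr s = s * \<delta>" using d s_facts by (auto simp: c_def powr_powr)
  show "1 / (c powr p * p) \<ge> 0" using p2 by simp
  fix a b :: real assume ab: "a \<ge> 0" "b \<ge> 0"
  have "(a / c) * (c * b) \<le> (a / c) powr p / p + (c * b) powr s / s"
    by (rule Youngs_inequality) (use ab c p2 s_facts in auto)
  also have "(a / c) powr p / p = 1 / (c powr p * p) * a powr p" using ab c by (simp add: powr_divide)
  also have "(c * b) powr s / s = \<delta> * b powr s" using ab c s_facts by (simp add: powr_mult)
  finally show "a * b \<le> 1 / (c powr p * p) * a powr p + \<delta> * b powr s" using c by simp
qed

text \<open>The gradient of the p-th power of the norm, with the weight included: up to the factor
  p, the real part of \<open>pairing g f\<close> is the derivative of \<open>mass\<close> at f in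
  the direction g.\<close>

definition dual :: "(complex \<Rightarrow> complex) \<Rightarrow> complex \<Rightarrow> complex" where
  "dual f w = cnj (f w) * of_real (cmod (f w) powr (p - 2) * exp (- (p * \<alpha> / 2) * (cmod w)\<^sup>2))"

definition pairing :: "(complex \<Rightarrow> complex) \<Rightarrow> (complex \<Rightarrow> complex) \<Rightarrow> complex" where
  "pairing g f = (LINT w|lborel. g w * dual f w)"

lemma wmod_powr: "wmod f w powr q = cmod (f w) powr q * exp (- (q * \<alpha> / 2) * (cmod w)\<^sup>2)"
  by (simp add: wmod_def powr_mult exp_powr_real mult_ac)

lemma norm_dual: "cmod (g w * dual f w) = wmod g w * wmod f w powr (p - 1)"
proof (cases "f w = 0")
  case True
  then show ?thesis using p2 by (simp add: dual_def wmod_def)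
next
  case False
  then have "cmod (f w) * cmod (f w) powr (p - 2) = cmod (f w) powr (p - 1)"
    using powr_add[of "cmod (f w)" 1 "p - 2"] by simp
  moreover have "exp (- \<alpha> * (cmod w)\<^sup>2 / 2) * exp (- ((p - 1) * \<alpha> / 2) * (cmod w)\<^sup>2) = exp (- (p * \<alpha> / 2) * (cmod w)\<^sup>2)"
    unfolding exp_add[symmetric] by (rule arg_cong[of _ _ exp]) (simp add: field_simps)
  ultimately show ?thesis
    unfolding wmod_powr[of f w "p - 1"] by (simp add: dual_def norm_mult wmod_def mult_ac)
qed

lemma self_dual: "f w * dual f w = of_real (wmod f w powr p)"
proof (cases "f w = 0")
  case False
  then have "(cmod (f w))\<^sup>2 * cmod (f w) powr (p - 2) = cmod (f w) powr p"
    using powr_add[of "cmod (f w)" 2 "p - 2"] by (simp add: powr_numeral)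
  moreover have "f w * cnj (f w) = of_real ((cmod (f w))\<^sup>2)" by (rule complex_norm_square[symmetric])
  ultimately show ?thesis
    unfolding wmod_powr dual_def by (simp only: mult.assoc[symmetric] of_real_mult[symmetric])
qed (use p2 in \<open>simp add: dual_def wmod_def\<close>)

lemma dual_measurable [measurable]: "f \<in> borel_measurable borel \<Longrightarrow> dual f \<in> borel_measurable borel"
proof -
  assume [measurable]: "f \<in> borel_measurable borel"
  have [measurable]: "(\<lambda>z::complex. exp (- (p * \<alpha> / 2) * (cmod z)\<^sup>2)) \<in> borel_measurable borel"
    by (intro borel_measurable_continuous_onI continuous_intros)
  show ?thesis unfolding dual_def[abs_def] by measurable
qed

lemma pairing_bound:
  assumes a: "a \<ge> 0" and b: "b \<ge> 0"
  shows "a * b powr (p - 1) \<le> a powr p + b powr p"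
proof -
  have "a * b powr (p - 1) \<le> a powr p / p + (b powr (p - 1)) powr s / s"
    by (rule Youngs_inequality) (use a b p2 s_facts in auto)
  also have "(b powr (p - 1)) powr s = b powr p" by (simp add: powr_powr s_facts)
  also have "a powr p / p + b powr p / s \<le> a powr p / 1 + b powr p / 1"
    using p2 s_facts by (intro add_mono divide_left_mono) auto
  finally show ?thesis by simp
qed

lemma pairing_integrable:
  assumes f: "f \<in> FS" and g: "g \<in> FS"
  shows "integrable lborel (\<lambda>w. g w * dual f w)" "integrable lborel (\<lambda>w. wmod g w * wmod f w powr (p - 1))"
proof -
  have [measurable]: "f \<in> borel_measurable borel" "g \<in> borel_measurable borel"
    using f g by (auto intro: entire_measurable FS_entire)
  have i: "integrable lborel (\<lambda>w. wmod g w powr p + wmod f w powr p)"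
    using f g by (auto intro: FS_integrable)
  have "AE w in lborel. norm (g w * dual f w) \<le> norm (wmod g w powr p + wmod f w powr p)"
    by (rule AE_I2) (use pairing_bound in \<open>simp add: norm_dual\<close>)
  then show "integrable lborel (\<lambda>w. g w * dual f w)"
    by (intro Bochner_Integration.integrable_bound[OF i]) measurable
  then have "integrable lborel (\<lambda>w. cmod (g w * dual f w))" by (rule integrable_norm)
  then show "integrable lborel (\<lambda>w. wmod g w * wmod f w powr (p - 1))" unfolding norm_dual .
qed

lemma pairing_self: "pairing f f = of_real (mass f)"
  unfolding pairing_def self_dual mass_def by (rule integral_complex_of_real)

lemma pairing_add: "f \<in> FS \<Longrightarrow> g \<in> FS \<Longrightarrow> h \<in> FS \<Longrightarrow> pairing (\<lambda>z. g z + h z) f = pairing g f + pairing h f"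
  unfolding pairing_def distrib_right by (intro Bochner_Integration.integral_add pairing_integrable)

lemma pairing_cmult: "pairing (\<lambda>z. c * g z) f = c * pairing g f"
  unfolding pairing_def mult.assoc by (rule integral_mult_right_zero)

text \<open>The graph of |a|^p lies above its real tangent plane at c: the tangent inequality for
  the moduli combined with Re (cnj c * a) \<le> |c| |a|.\<close>

lemma convexity_pointwise:
  fixes a c :: complex
  shows "cmod c powr p + p * (cmod c powr (p - 2) * Re (cnj c * (a - c))) \<le> cmod a powr p"
proof (cases "c = 0")
  case False
  then have c: "cmod c > 0" by simp
  have "cmod c powr p + p * cmod c powr (p - 1) * (cmod a - cmod c) \<le> cmod a powr p"
    by (rule powr_tangent) (use c p2 in auto)
  moreover have "Re (cnj c * (a - c)) \<le> cmod c * (cmod a - cmod c)"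
  proof -
    have "cnj c * (a - c) = cnj c * a - of_real ((cmod c)\<^sup>2)"
      unfolding complex_norm_square by (simp add: algebra_simps)
    then have "Re (cnj c * (a - c)) = Re (cnj c * a) - (cmod c)\<^sup>2" by simp
    moreover have "Re (cnj c * a) \<le> cmod c * cmod a"
      using complex_Re_le_cmod[of "cnj c * a"] by (simp add: norm_mult)
    ultimately show ?thesis by (simp add: power2_eq_square algebra_simps)
  qed
  then have "p * (cmod c powr (p - 2) * Re (cnj c * (a - c))) \<le> p * (cmod c powr (p - 2) * (cmod c * (cmod a - cmod c)))"
    using p2 by (intro mult_left_mono) auto
  moreover have "cmod c powr (p - 2) * cmod c = cmod c powr (p - 1)"
    using powr_add[of "cmod c" "p - 2" 1] c by simp
  then have "p * (cmod c powr (p - 2) * (cmod c * (cmod a - cmod c))) = p * cmod c powr (p - 1) * (cmod a - cmod c)"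
    by (simp add: mult.assoc[symmetric])
  ultimately show ?thesis by linarith
qed (use p2 in simp)

text \<open>Convexity replaces differentiation under the integral. Minimality gives a sign for the
  pairing at each perturbed function; the limit along rays in all complex directions leaves no value
  but zero.\<close>

lemma extremal_orthogonal:
  assumes f: "f \<in> FS" and g: "g \<in> FS" and min: "\<And>t. mass f \<le> mass (\<lambda>z. f z + t * g z)"
  shows "pairing g f = 0"
proof -
  have [measurable]: "f \<in> borel_measurable borel" "g \<in> borel_measurable borel"
    using f g by (auto intro: entire_measurable FS_entire)
  have ft: "(\<lambda>z. f z + t * g z) \<in> FS" for t by (intro FS_add FS_cmult f g)
  \<comment> \<open>The tangent plane is taken at the perturbed function and evaluated at f; the
    tangent plane at f would only bound the perturbed mass from below, which minimality does
    already.\<close>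
  have pos: "0 \<le> Re (t * pairing g (\<lambda>z. f z + t * g z))" for t
  proof -
    define h where "h = (\<lambda>z. f z + t * g z)"
    have hF: "h \<in> FS" using ft by (simp add: h_def)
    have pw: "wmod h w powr p - p * Re (t * (g w * dual h w)) \<le> wmod f w powr p" for w
    proof -
      define E where "E = exp (- (p * \<alpha> / 2) * (cmod w)\<^sup>2)"
      define q where "q = cmod (h w) powr (p - 2)"
      define X where "X = cnj (h w) * (t * g w)"
      have a: "t * (g w * dual h w) = X * of_real (q * E)"
        by (simp add: dual_def E_def X_def q_def mult_ac)
      have b: "cnj (h w) * (f w - h w) = - X" by (simp add: h_def X_def)
      have "(cmod (h w) powr p + p * (q * Re (cnj (h w) * (f w - h w)))) * E \<le> cmod (f w) powr p * E"
        unfolding q_def by (intro mult_right_mono convexity_pointwise) (simp add: E_def)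
      then have "cmod (h w) powr p * E - p * (Re X * (q * E)) \<le> cmod (f w) powr p * E"
        unfolding b uminus_complex.sel by (simp add: algebra_simps)
      moreover have "Re (X * of_real (q * E)) = Re X * (q * E)" by simp
      ultimately show ?thesis unfolding wmod_powr E_def[symmetric] a by simp
    qed
    have i: "integrable lborel (\<lambda>w. Re (t * (g w * dual h w)))"
      by (intro integrable_Re integrable_mult_right pairing_integrable hF g)
    have "(LINT w|lborel. wmod h w powr p - p * Re (t * (g w * dual h w))) \<le> (LINT w|lborel. wmod f w powr p)"
      by (intro integral_mono Bochner_Integration.integrable_diff integrable_mult_right i FS_integrable f hF pw)
    then have "mass h - p * (LINT w|lborel. Re (t * (g w * dual h w))) \<le> mass f"
      unfolding mass_def using i FS_integrable[OF hF] by simp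
    moreover have "(LINT w|lborel. Re (t * (g w * dual h w))) = Re (t * pairing g h)"
      unfolding pairing_def
      by (subst integral_Re) (intro integrable_mult_right pairing_integrable hF g, simp only: integral_mult_right_zero)
    ultimately have "mass h - p * Re (t * pairing g h) \<le> mass f" by simp
    with min[of t] have "0 \<le> p * Re (t * pairing g h)" unfolding h_def by linarith
    then show ?thesis using p2 unfolding h_def by (simp add: zero_le_mult_iff)
  qed
  have lim: "0 \<le> Re (\<tau> * pairing g f)" for \<tau>
  proof -
    define h where "h n z = f z + (\<tau> / of_nat (Suc n)) * g z" for n z
    have hF: "h n \<in> FS" for n unfolding h_def using ft .
    have hm[measurable]: "h n \<in> borel_measurable borel" for n unfolding h_def by measurable
    have re: "Re (of_real r * x) = r * Re x" for r x by simp
    have hpos: "0 \<le> Re (\<tau> * pairing g (h n))" for n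
    proof -
      have "0 \<le> Re (\<tau> / of_nat (Suc n) * pairing g (h n))"
        using pos[of "\<tau> / of_nat (Suc n)"] unfolding h_def .
      also have "\<tau> / of_nat (Suc n) * pairing g (h n) = of_real (1 / real (Suc n)) * (\<tau> * pairing g (h n))"
        by (simp add: field_simps)
      finally have "0 \<le> 1 / real (Suc n) * Re (\<tau> * pairing g (h n))" by (simp only: re)
      then show ?thesis by (simp add: zero_le_mult_iff zero_le_divide_iff)
    qed
    have "(\<lambda>n. pairing g (h n)) \<longlonglongrightarrow> pairing g f"
      unfolding pairing_def
    proof (rule integral_dominated_convergence[where w="\<lambda>w. wmod g w powr p + 2 powr p * (wmod f w powr p + (cmod \<tau> * wmod g w) powr p)"])
      have "(\<lambda>n. h n w) \<longlonglongrightarrow> f w" for w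
      proof -
        have "(\<lambda>n. \<tau> / of_nat (Suc n)) \<longlonglongrightarrow> 0"
          using tendsto_mult[OF tendsto_const[of \<tau>] LIMSEQ_inverse_real_of_nat[THEN tendsto_of_real[where 'a=complex]]]
          by (simp add: divide_inverse)
        then have "(\<lambda>n. f w + (\<tau> / of_nat (Suc n)) * g w) \<longlonglongrightarrow> f w + 0 * g w" by (intro tendsto_intros)
        then show ?thesis by (simp add: h_def)
      qed
      then have "(\<lambda>n. dual (h n) w) \<longlonglongrightarrow> dual f w" for w
        unfolding dual_def using p2 by (intro tendsto_intros tendsto_powr2) auto
      then show "AE w in lborel. (\<lambda>n. g w * dual (h n) w) \<longlonglongrightarrow> g w * dual f w"
        by (intro AE_I2 tendsto_intros)
      show "AE w in lborel. norm (g w * dual (h n) w) \<le> wmod g w powr p + 2 powr p * (wmod f w powr p + (cmod \<tau> * wmod g w) powr p)" for n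
      proof (rule AE_I2)
        fix w
        have "wmod (h n) w \<le> wmod f w + wmod (\<lambda>z. (\<tau> / of_nat (Suc n)) * g z) w"
          unfolding h_def by (rule wmod_add_le)
        also have "wmod (\<lambda>z. (\<tau> / of_nat (Suc n)) * g z) w = cmod \<tau> / real (Suc n) * wmod g w"
          unfolding wmod_cmult norm_divide norm_of_nat ..
        also have "\<dots> \<le> cmod \<tau> / 1 * wmod g w"
          by (intro mult_right_mono divide_left_mono) auto
        finally have "wmod (h n) w powr p \<le> (wmod f w + cmod \<tau> * wmod g w) powr p"
          using p2 by (intro powr_mono2) auto
        also have "\<dots> \<le> 2 powr p * (wmod f w powr p + (cmod \<tau> * wmod g w) powr p)"
          using p2 by (intro powr_add_le) auto
        finally show "norm (g w * dual (h n) w) \<le> wmod g w powr p + 2 powr p * (wmod f w powr p + (cmod \<tau> * wmod g w) powr p)"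
          using pairing_bound[of "wmod g w" "wmod (h n) w"] by (simp add: norm_dual)
      qed
      show "integrable lborel (\<lambda>w. wmod g w powr p + 2 powr p * (wmod f w powr p + (cmod \<tau> * wmod g w) powr p))"
        using f g by (auto simp: powr_mult FS_integrable)
    qed measurable
    then have "(\<lambda>n. Re (\<tau> * pairing g (h n))) \<longlonglongrightarrow> Re (\<tau> * pairing g f)" by (intro tendsto_intros)
    then show ?thesis by (rule LIMSEQ_le_const) (use hpos in blast)
  qed
  have "pairing g f * cnj (pairing g f) = of_real ((cmod (pairing g f))\<^sup>2)" by (rule complex_norm_square[symmetric])
  then have "Re (- cnj (pairing g f) * pairing g f) = - (cmod (pairing g f))\<^sup>2" by (simp add: mult.commute)
  \<comment> \<open>In this direction the nonnegative quantity is minus the squared modulus of the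
    pairing.\<close>
  with lim[of "- cnj (pairing g f)"] have "(cmod (pairing g f))\<^sup>2 \<le> 0" by linarith
  then show ?thesis by simp
qed


section \<open>Pairing the dual function with coherent states\<close>

lemma wmod_coherent: "wmod (coherent z) w = exp (- (\<alpha> / 2) * (cmod (w - z))\<^sup>2)"
  unfolding coherent_def wmod_shift by (simp add: wmod_def)

text \<open>Young's convolution inequality for a Gaussian kernel, through the power mean and Fubini.
  The exponents match because the s-th power of |f|^(p-1) is |f|^p, so the dual norm is bounded by
  the mass of f.\<close>

lemma convolution_bound:
  assumes f: "f \<in> FS"
  defines "\<Gamma> \<equiv> (LINT w|lborel. exp (- (\<alpha> / 2) * (cmod (w::complex))\<^sup>2))"
  shows "(\<integral>\<^sup>+z. ennreal ((LINT w|lborel. wmod (coherent z) w * wmod f w powr (p - 1)) powr s) \<partial>lborel)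
    \<le> ennreal (\<Gamma> powr s * mass f)"
proof -
  have [measurable]: "f \<in> borel_measurable borel" using f by (auto intro: entire_measurable FS_entire)
  have ig: "integrable lborel (\<lambda>w::complex. exp (- (\<alpha> / 2) * (cmod w)\<^sup>2))" using integrable_gauss[of "\<alpha> / 2"] \<alpha>0 by simp
  have ig': "integrable lborel (wmod (coherent z))" and Lg: "(LINT w|lborel. wmod (coherent z) w) = \<Gamma>" for z
    using integrable_translate_iff[of "\<lambda>w. exp (- (\<alpha> / 2) * (cmod w)\<^sup>2)" "- z"] ig
      integral_translate[of "\<lambda>w. exp (- (\<alpha> / 2) * (cmod w)\<^sup>2)" "- z"]
    unfolding wmod_coherent[abs_def] \<Gamma>_def by (simp_all add: add.commute)
  have G0: "\<Gamma> \<ge> 0" unfolding \<Gamma>_def by simp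
  have [measurable]: "coherent z \<in> borel_measurable borel" for z
    using coherent(1) by (intro entire_measurable FS_entire)
  have ii: "integrable lborel (\<lambda>w. wmod (coherent z) w * wmod f w powr p)" for z
  proof (rule Bochner_Integration.integrable_bound[OF FS_integrable[OF f]])
    have "wmod (coherent z) w * wmod f w powr p \<le> 1 * wmod f w powr p" for w
      by (intro mult_right_mono coherent(3)) auto
    then show "AE w in lborel. norm (wmod (coherent z) w * wmod f w powr p) \<le> norm (wmod f w powr p)"
      by (intro AE_I2) (simp add: abs_mult)
  qed measurable
  have pw: "(LINT w|lborel. wmod (coherent z) w * wmod f w powr (p - 1)) powr s
      \<le> \<Gamma> powr (s - 1) * (LINT w|lborel. wmod (coherent z) w * wmod f w powr p)" for z
  proof -
    have e: "(wmod f w powr (p - 1)) powr s = wmod f w powr p" for w by (simp add: powr_powr s_facts)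
    have "(LINT w|lborel. wmod (coherent z) w * wmod f w powr (p - 1)) powr s
      \<le> (LINT w|lborel. wmod (coherent z) w) powr (s - 1) * (LINT w|lborel. wmod (coherent z) w * (wmod f w powr (p - 1)) powr s)"
      by (rule power_mean) (use s_facts ig' ii pairing_integrable(2)[OF f coherent(1)] in \<open>auto simp: e\<close>)
    then show ?thesis unfolding e Lg .
  qed
  define h where "h z w = ennreal (exp (- (\<alpha> / 2) * (cmod (w - z))\<^sup>2)) * ennreal (wmod f w powr p)" for z w
  have mh[measurable]: "case_prod h \<in> borel_measurable (lborel \<Otimes>\<^sub>M lborel)"
    unfolding h_def by (simp add: split_beta')
  have "(\<integral>\<^sup>+z. ennreal ((LINT w|lborel. wmod (coherent z) w * wmod f w powr (p - 1)) powr s) \<partial>lborel)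
    \<le> (\<integral>\<^sup>+z. ennreal (\<Gamma> powr (s - 1)) * (\<integral>\<^sup>+w. h z w \<partial>lborel) \<partial>lborel)"
  proof (intro nn_integral_mono)
    fix z
    have "ennreal (\<Gamma> powr (s - 1) * (LINT w|lborel. wmod (coherent z) w * wmod f w powr p))
        = ennreal (\<Gamma> powr (s - 1)) * ennreal (LINT w|lborel. wmod (coherent z) w * wmod f w powr p)"
      by (rule ennreal_mult) auto
    also have "ennreal (LINT w|lborel. wmod (coherent z) w * wmod f w powr p)
        = (\<integral>\<^sup>+w. ennreal (wmod (coherent z) w * wmod f w powr p) \<partial>lborel)"
      by (rule nn_integral_eq_integral[OF ii, symmetric]) auto
    also have "\<dots> = (\<integral>\<^sup>+w. h z w \<partial>lborel)"
      by (intro nn_integral_cong) (simp add: h_def wmod_coherent ennreal_mult)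
    finally show "ennreal ((LINT w|lborel. wmod (coherent z) w * wmod f w powr (p - 1)) powr s)
        \<le> ennreal (\<Gamma> powr (s - 1)) * (\<integral>\<^sup>+w. h z w \<partial>lborel)"
      using ennreal_leI[OF pw[of z]] by simp
  qed
  also have "\<dots> = ennreal (\<Gamma> powr (s - 1)) * (\<integral>\<^sup>+z. \<integral>\<^sup>+w. h z w \<partial>lborel \<partial>lborel)"
    by (rule nn_integral_cmult) measurable
  also have "(\<integral>\<^sup>+z. \<integral>\<^sup>+w. h z w \<partial>lborel \<partial>lborel) = (\<integral>\<^sup>+w. \<integral>\<^sup>+z. h z w \<partial>lborel \<partial>lborel)"
    by (rule lborel_pair.Fubini'[symmetric]) measurable
  also have "\<dots> = (\<integral>\<^sup>+w. ennreal \<Gamma> * ennreal (wmod f w powr p) \<partial>lborel)"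
  proof (intro nn_integral_cong)
    fix w
    have "(\<integral>\<^sup>+z. h z w \<partial>lborel) = (\<integral>\<^sup>+z. ennreal (exp (- (\<alpha> / 2) * (cmod (w - z))\<^sup>2)) \<partial>lborel) * ennreal (wmod f w powr p)"
      unfolding h_def by (rule nn_integral_multc) measurable
    also have "(\<integral>\<^sup>+z. ennreal (exp (- (\<alpha> / 2) * (cmod (w - z))\<^sup>2)) \<partial>lborel)
        = (\<integral>\<^sup>+z. ennreal (wmod (coherent w) z) \<partial>lborel)"
      by (intro nn_integral_cong) (simp add: wmod_coherent norm_minus_commute)
    also have "\<dots> = ennreal \<Gamma>" using nn_integral_eq_integral[OF ig'[of w]] Lg by simp
    finally show "(\<integral>\<^sup>+z. h z w \<partial>lborel) = ennreal \<Gamma> * ennreal (wmod f w powr p)" .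
  qed
  also have "\<dots> = ennreal \<Gamma> * (\<integral>\<^sup>+w. ennreal (wmod f w powr p) \<partial>lborel)"
    by (rule nn_integral_cmult) measurable
  also have "(\<integral>\<^sup>+w. ennreal (wmod f w powr p) \<partial>lborel) = ennreal (mass f)"
    unfolding mass_def by (rule nn_integral_eq_integral[OF FS_integrable[OF f]]) auto
  also have "ennreal (\<Gamma> powr (s - 1)) * (ennreal \<Gamma> * ennreal (mass f)) = ennreal (\<Gamma> powr (s - 1) * (\<Gamma> * mass f))"
    using G0 by (simp add: ennreal_mult)
  also have "\<Gamma> powr (s - 1) * (\<Gamma> * mass f) = \<Gamma> powr s * mass f"
  proof (cases "\<Gamma> = 0")
    case False
    then have "\<Gamma> powr (s - 1) * \<Gamma> = \<Gamma> powr s" using powr_add[of \<Gamma> "s - 1" 1] G0 by simp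
    then show ?thesis by (simp add: mult.assoc[symmetric])
  qed (use s_facts in simp)
  finally show ?thesis .
qed

subsection \<open>The reproducing property\<close>

text \<open>This is the zeroth moment at v of z^j, rewritten by the substitution y = v + u; the
  constant factor N cancels at the end.\<close>

lemma reproducing:
  "(LINT y|lborel. y ^ j * exp (of_real \<alpha> * v * cnj y) * of_real (exp (- \<alpha> * (cmod y)\<^sup>2))) = of_real (gmoment 0) * v ^ j"
proof -
  have F: "(\<lambda>z. z ^ j) \<in> FS" by (rule power_FS)
  define N where "N = complex_of_real (exp (- \<alpha> * (cmod v)\<^sup>2 / 2))"
  have e0: "- \<alpha> * (cmod v)\<^sup>2 / 2 = - (\<alpha> * (cmod v)\<^sup>2 / 2)" by simp
  have N: "N \<noteq> 0" "N = exp (- of_real (\<alpha> * (cmod v)\<^sup>2 / 2))"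
    by (simp add: N_def) (simp only: N_def e0 exp_of_real[symmetric] of_real_minus)
  obtain g where g: "g holomorphic_on UNIV" "\<And>u. shift v (\<lambda>z. z ^ j) u = shift v (\<lambda>z. z ^ j) 0 + (u - 0) * g u"
    using entire_factor[OF shift_entire[OF FS_entire[OF F]], where l=0] by blast
  have "moment v 0 (\<lambda>z. z ^ j) = shift v (\<lambda>z. z ^ j) 0 * of_real (gmoment 0)"
  proof (rule moment_taylor[OF F g(1), where l=v and m=1 and c="\<lambda>_. shift v (\<lambda>z. z ^ j) 0" and j=0])
    show "shift v (\<lambda>z. z ^ j) u = (\<Sum>i<1. shift v (\<lambda>z. z ^ j) 0 * u ^ i) + u ^ 1 * g u" for u using g(2)[of u] by simp
  qed simp
  also have "shift v (\<lambda>z. z ^ j) 0 = v ^ j * N" by (simp add: shift_def N(2))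
  finally have m: "moment v 0 (\<lambda>z. z ^ j) = v ^ j * N * of_real (gmoment 0)" .
  define h where "h y = N * (y ^ j * exp (of_real \<alpha> * v * cnj y) * of_real (exp (- \<alpha> * (cmod y)\<^sup>2)))" for y
  have hm: "h \<in> borel_measurable borel" unfolding h_def by (intro borel_measurable_continuous_onI continuous_intros)
  have hs: "h (v + u) = shift v (\<lambda>z. z ^ j) u * cnj u ^ 0 * of_real (exp (- \<alpha> * (cmod u)\<^sup>2))" for u
  proof -
    have sq: "complex_of_real ((cmod x)\<^sup>2) = x * cnj x" for x by (rule complex_norm_square)
    have E: "- of_real (\<alpha> * (cmod v)\<^sup>2 / 2) + of_real \<alpha> * v * cnj (v + u) + of_real (- \<alpha> * (cmod (v + u))\<^sup>2)
        = - of_real \<alpha> * cnj v * u - of_real (\<alpha> * (cmod v)\<^sup>2 / 2) + of_real (- \<alpha> * (cmod u)\<^sup>2)"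
      unfolding of_real_mult of_real_divide of_real_minus sq by (simp add: algebra_simps)
    have "h (v + u) = (v + u) ^ j * (exp (- of_real (\<alpha> * (cmod v)\<^sup>2 / 2)) * exp (of_real \<alpha> * v * cnj (v + u)) * exp (of_real (- \<alpha> * (cmod (v + u))\<^sup>2)))"
      unfolding h_def N(2) exp_of_real by (simp only: mult_ac)
    also have "\<dots> = (v + u) ^ j * (exp (- of_real \<alpha> * cnj v * u - of_real (\<alpha> * (cmod v)\<^sup>2 / 2)) * exp (of_real (- \<alpha> * (cmod u)\<^sup>2)))"
      unfolding exp_add[symmetric] E ..
    finally show ?thesis unfolding shift_def exp_of_real by (simp only: power_0 mult_1_right mult.assoc)
  qed
  have "(LINT u|lborel. h (v + u)) = (LINT u|lborel. h u)" by (rule integral_translate[OF hm])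
  moreover have "(LINT u|lborel. h (v + u)) = v ^ j * N * of_real (gmoment 0)"
    unfolding hs using m unfolding moment_def .
  moreover have "(LINT u|lborel. h u) = N * (LINT y|lborel. y ^ j * exp (of_real \<alpha> * v * cnj y) * of_real (exp (- \<alpha> * (cmod y)\<^sup>2)))"
    unfolding h_def by (rule integral_mult_right_zero)
  ultimately have "N * (LINT y|lborel. y ^ j * exp (of_real \<alpha> * v * cnj y) * of_real (exp (- \<alpha> * (cmod y)\<^sup>2)))
      = v ^ j * N * of_real (gmoment 0)" by (simp only:)
  also have "\<dots> = N * (of_real (gmoment 0) * v ^ j)" by (simp only: mult_ac)
  finally show ?thesis by (rule iffD1[OF mult_left_cancel[OF N(1)]])
qed

text \<open>The factor \<open>k\<close> only matters through its modulus.\<close>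

lemma moment_coherent:
  obtains k where "\<And>l j z. moment l j (coherent z) = of_real (gmoment 0) * cnj (z - l) ^ j * k l z"
    "\<And>l z. cmod (k l z) = exp (- \<alpha> * (cmod (z - l))\<^sup>2 / 2)" "\<And>l. k l \<in> borel_measurable borel"
proof -
  define k where "k l z = exp (of_real \<alpha> * cnj z * l - of_real (\<alpha> * (cmod z)\<^sup>2 / 2) - of_real (\<alpha> * (cmod l)\<^sup>2 / 2))" for l z :: complex
  \<comment> \<open>Translating a coherent state gives a multiple of an exponential, so its moments
    are conjugates of the reproducing integrals.\<close>
  have sh: "shift l (coherent z) u = k l z * exp (of_real \<alpha> * cnj (z - l) * u)" for l z u
  proof -
    have "of_real \<alpha> * cnj z * (l + u) - of_real (\<alpha> * (cmod z)\<^sup>2 / 2) + (- of_real \<alpha> * cnj l * u - of_real (\<alpha> * (cmod l)\<^sup>2 / 2))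
      = (of_real \<alpha> * cnj z * l - of_real (\<alpha> * (cmod z)\<^sup>2 / 2) - of_real (\<alpha> * (cmod l)\<^sup>2 / 2)) + of_real \<alpha> * cnj (z - l) * u"
      by (simp add: algebra_simps)
    note E = this
    have "coherent z (l + u) = exp (of_real \<alpha> * cnj z * (l + u) - of_real (\<alpha> * (cmod z)\<^sup>2 / 2))"
      by (simp add: coherent_def shift_def)
    then have "shift l (coherent z) u = exp (of_real \<alpha> * cnj z * (l + u) - of_real (\<alpha> * (cmod z)\<^sup>2 / 2))
        * exp (- of_real \<alpha> * cnj l * u - of_real (\<alpha> * (cmod l)\<^sup>2 / 2))"
      by (simp only: shift_def)
    then show ?thesis unfolding k_def exp_add[symmetric] E .
  qed
  have m: "moment l j (coherent z) = of_real (gmoment 0) * cnj (z - l) ^ j * k l z" for l j z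
  proof -
    define v where "v = z - l"
    have "cnj (LINT u|lborel. u ^ j * exp (of_real \<alpha> * v * cnj u) * of_real (exp (- \<alpha> * (cmod u)\<^sup>2)))
        = (LINT u|lborel. cnj (u ^ j * exp (of_real \<alpha> * v * cnj u) * of_real (exp (- \<alpha> * (cmod u)\<^sup>2))))"
      by (rule Bochner_Integration.integral_cnj[symmetric])
    also have "(\<lambda>u. cnj (u ^ j * exp (of_real \<alpha> * v * cnj u) * of_real (exp (- \<alpha> * (cmod u)\<^sup>2))))
        = (\<lambda>u. exp (of_real \<alpha> * cnj v * u) * cnj u ^ j * of_real (exp (- \<alpha> * (cmod u)\<^sup>2)))"
      by (simp add: exp_cnj mult_ac)
    finally have c: "(LINT u|lborel. exp (of_real \<alpha> * cnj v * u) * cnj u ^ j * of_real (exp (- \<alpha> * (cmod u)\<^sup>2))) = of_real (gmoment 0) * cnj v ^ j"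
      unfolding reproducing by simp
    have "moment l j (coherent z) = (LINT u|lborel. k l z * (exp (of_real \<alpha> * cnj v * u) * cnj u ^ j * of_real (exp (- \<alpha> * (cmod u)\<^sup>2))))"
      unfolding moment_def sh v_def by (simp add: mult.assoc)
    also have "\<dots> = k l z * (of_real (gmoment 0) * cnj v ^ j)"
      unfolding integral_mult_right_zero c ..
    finally show ?thesis by (simp add: v_def)
  qed
  have n: "cmod (k l z) = exp (- \<alpha> * (cmod (z - l))\<^sup>2 / 2)" for l z
  proof -
    define R where "R = Re (cnj z * l)"
    have "(cmod (z - l))\<^sup>2 = (cmod z)\<^sup>2 + (cmod l)\<^sup>2 - 2 * R"
      unfolding cmod_power2 R_def by (simp add: power2_eq_square algebra_simps)
    then have "- \<alpha> * (cmod (z - l))\<^sup>2 / 2 = - \<alpha> * ((cmod z)\<^sup>2 + (cmod l)\<^sup>2 - 2 * R) / 2" by (simp only:)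
    then have "\<alpha> * R - \<alpha> * (cmod z)\<^sup>2 / 2 - \<alpha> * (cmod l)\<^sup>2 / 2 = - \<alpha> * (cmod (z - l))\<^sup>2 / 2"
      by (simp add: field_simps)
    moreover have "Re (of_real \<alpha> * cnj z * l - of_real (\<alpha> * (cmod z)\<^sup>2 / 2) - of_real (\<alpha> * (cmod l)\<^sup>2 / 2))
        = \<alpha> * R - \<alpha> * (cmod z)\<^sup>2 / 2 - \<alpha> * (cmod l)\<^sup>2 / 2"
    proof -
      have "Re (of_real \<alpha> * cnj z * l) = \<alpha> * R" unfolding R_def by (simp add: algebra_simps)
      then show ?thesis unfolding minus_complex.sel Re_complex_of_real by simp
    qed
    ultimately show ?thesis unfolding k_def norm_exp_eq_Re by (simp only:)
  qed
  have "k l \<in> borel_measurable borel" for l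
    unfolding k_def by (intro borel_measurable_continuous_onI continuous_intros) auto
  then show ?thesis using that m n by blast
qed

subsection \<open>Sufficiency for finite divisors\<close>

text \<open>Hermite polynomials show that competitors exist, and normal families extract a minimiser
  from a minimising sequence.\<close>

lemma minimal_interpolant:
  assumes A: "finite A" and F: "\<And>l. l \<in> A \<Longrightarrow> F l \<in> FS"
  obtains f where "f \<in> FS" "\<And>l. l \<in> A \<Longrightarrow> vanish l (m l) (\<lambda>z. f z - F l z)"
    "\<And>g. \<lbrakk>g \<in> FS; \<And>l. l \<in> A \<Longrightarrow> vanish l (m l) (\<lambda>z. g z - F l z)\<rbrakk> \<Longrightarrow> mass f \<le> mass g"
proof -
  define S where "S = {g \<in> FS. \<forall>l\<in>A. vanish l (m l) (\<lambda>z. g z - F l z)}"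
  have "\<exists>P. \<forall>l\<in>A. vanish l (m l) (\<lambda>z. poly P z - F l z)"
    by (rule hermite_interpolation[OF A]) (use F FS_entire in auto)
  then have Sne: "S \<noteq> {}" using poly_FS by (auto simp: S_def)
  define B where "B = Inf (mass ` S)"
  have bdd: "bdd_below (mass ` S)" by (intro bdd_belowI[of _ 0]) auto
  have "\<exists>g\<in>S. mass g \<le> B + 1 / real (Suc n)" for n
  proof -
    have "B < B + 1 / real (Suc n)" by simp
    then have "\<exists>x\<in>mass ` S. x < B + 1 / real (Suc n)"
      using cInf_lessD[of "mass ` S" "B + 1 / real (Suc n)"] Sne unfolding B_def by auto
    then show ?thesis by (auto intro: less_imp_le)
  qed
  then obtain f where f: "\<And>n. f n \<in> S" "\<And>n. mass (f n) \<le> B + 1 / real (Suc n)" by metis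
  have lim: "(\<lambda>n. B + 1 / real (Suc n)) \<longlonglongrightarrow> B"
    using tendsto_add[OF tendsto_const[of B] LIMSEQ_inverse_real_of_nat] by (simp add: inverse_eq_divide)
  have fF: "f n \<in> FS" for n using f(1) by (simp add: S_def)
  obtain g r where g: "strict_mono (r :: nat \<Rightarrow> nat)" "g \<in> FS" "mass g \<le> B"
    "\<And>l m h. h holomorphic_on UNIV \<Longrightarrow> (\<forall>\<^sub>F n in sequentially. vanish l m (\<lambda>z. f (r n) z - h z)) \<Longrightarrow>
       vanish l m (\<lambda>z. g z - h z)"
    by (rule compactness[OF fF f(2) lim]) blast
  show ?thesis
  proof (rule that[OF g(2)])
    fix l assume "l \<in> A"
    then show "vanish l (m l) (\<lambda>z. g z - F l z)"
      using f(1) F FS_entire by (intro g(4) always_eventually) (auto simp: S_def)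
  next
    fix h assume "h \<in> FS" "\<And>l. l \<in> A \<Longrightarrow> vanish l (m l) (\<lambda>z. h z - F l z)"
    then have "mass h \<in> mass ` S" by (auto simp: S_def)
    then have "B \<le> mass h" unfolding B_def by (rule cInf_lower[OF _ bdd])
    then show "mass g \<le> mass h" using g(3) by linarith
  qed
qed

text \<open>The constants are fixed before the divisor: neither the number of points nor the
  multiplicities enter them. This uniformity is what the passage to countable divisors
  requires.\<close>

lemma finite_interpolation:
  obtains C0 M where "C0 \<ge> 1" "M \<ge> 0"
    "\<And>A m F. \<lbrakk>finite A; \<And>l. l \<in> A \<Longrightarrow> m l \<ge> 1; disjoint_family_on (\<lambda>l. ball l (sqrt (real (m l) / \<alpha>) + C0)) A;
       \<And>l. l \<in> A \<Longrightarrow> F l \<in> FS\<rbrakk>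
     \<Longrightarrow> \<exists>f\<in>FS. (\<forall>l\<in>A. vanish l (m l) (\<lambda>z. f z - F l z)) \<and> mass f \<le> M * (\<Sum>l\<in>A. mass (F l))"
proof -
  obtain C0 where C0: "C0 \<ge> 1"
    "\<And>A m c e. \<lbrakk>finite A; \<And>l. l \<in> A \<Longrightarrow> m l \<ge> 1; disjoint_family_on (\<lambda>l. ball l (sqrt (real (m l) / \<alpha>) + C0)) A;
       \<And>l. l \<in> A \<Longrightarrow> e l \<in> borel_measurable borel;
       \<And>l z. l \<in> A \<Longrightarrow> cmod (e l z) = wmod (\<lambda>u. \<Sum>i<m l. c l i * u ^ i) (z - l)\<rbrakk>
     \<Longrightarrow> (\<Sum>l\<in>A. \<integral>\<^sup>+u. ennreal (wmod (\<lambda>u. \<Sum>i<m l. c l i * u ^ i) u powr s) \<partial>lborel)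
       \<le> 8 * (\<integral>\<^sup>+z. ennreal (cmod (\<Sum>l\<in>A. e l z) powr s) \<partial>lborel)"
  proof (rule separated_pieces, goal_cases)
    case (1 C)
    show ?case by (rule 1(1)[OF 1(2) 1(3)])
  qed
  obtain k where k: "\<And>l j z. moment l j (coherent z) = of_real (gmoment 0) * cnj (z - l) ^ j * k l z"
    "\<And>l z. cmod (k l z) = exp (- \<alpha> * (cmod (z - l))\<^sup>2 / 2)" "\<And>l. k l \<in> borel_measurable borel"
  proof (rule moment_coherent, goal_cases)
    case (1 k)
    show ?case by (rule 1(1)[OF 1(2) 1(3) 1(4)])
  qed
  define \<Gamma> where "\<Gamma> = (LINT w|lborel. exp (- (\<alpha> / 2) * (cmod (w::complex))\<^sup>2))"
  define \<kappa> where "\<kappa> = gmoment 0"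
  have \<kappa>: "\<kappa> > 0" unfolding \<kappa>_def by (rule gmoment_pos)
  define D where "D = (\<Gamma> / \<kappa>) powr s"
  have D: "D \<ge> 0" by (simp add: D_def)
  have G0: "\<Gamma> \<ge> 0" unfolding \<Gamma>_def by simp
  \<comment> \<open>Makes 8 D \<delta> at most one half, so that the dual terms can be absorbed into
    the mass of f; the summand 1 covers D = 0.\<close>
  define \<delta> where "\<delta> = 1 / (16 * D + 1)"
  have \<delta>: "\<delta> > 0" "\<delta> * (8 * D) \<le> 1 / 2" using D by (auto simp: \<delta>_def field_simps)
  obtain K where K: "K \<ge> 0" "\<And>a b. a \<ge> 0 \<Longrightarrow> b \<ge> 0 \<Longrightarrow> a * b \<le> K * a powr p + \<delta> * b powr s"
    by (rule young_eps[OF \<delta>(1)]) blast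
  show ?thesis
  proof (rule that[OF C0(1), of "2 * K"])
    show "2 * K \<ge> 0" using K by simp
    fix A :: "complex set" and m :: "complex \<Rightarrow> nat" and F :: "complex \<Rightarrow> complex \<Rightarrow> complex"
    assume A: "finite A" and m: "\<And>l. l \<in> A \<Longrightarrow> m l \<ge> 1"
      and dis: "disjoint_family_on (\<lambda>l. ball l (sqrt (real (m l) / \<alpha>) + C0)) A"
      and F: "\<And>l. l \<in> A \<Longrightarrow> F l \<in> FS"
    obtain f where f: "f \<in> FS" "\<And>l. l \<in> A \<Longrightarrow> vanish l (m l) (\<lambda>z. f z - F l z)"
      and fmin: "\<And>g. \<lbrakk>g \<in> FS; \<And>l. l \<in> A \<Longrightarrow> vanish l (m l) (\<lambda>z. g z - F l z)\<rbrakk> \<Longrightarrow> mass f \<le> mass g"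
      by (rule minimal_interpolant[OF A F, where m=m]) blast+
    have orth: "pairing g f = 0" if g: "g \<in> FS" "\<And>l. l \<in> A \<Longrightarrow> vanish l (m l) g" for g
    proof (rule extremal_orthogonal[OF f(1) g(1)])
      fix t
      show "mass f \<le> mass (\<lambda>z. f z + t * g z)"
      proof (rule fmin)
        show "(\<lambda>z. f z + t * g z) \<in> FS" by (intro FS_add FS_cmult f g)
        fix l assume l: "l \<in> A"
        have "vanish l (m l) (\<lambda>z. (f z - F l z) + t * g z)"
          by (rule vanish_add[OF f(2)[OF l] vanish_cmult[OF g(2)[OF l]]])
        then show "vanish l (m l) (\<lambda>z. f z + t * g z - F l z)" by (simp add: algebra_simps)
      qed
    qed
    \<comment> \<open>By orthogonality the functional vanishes on the common kernel of the moments
      up to the multiplicities, hence it is a combination of them.\<close>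
    have "\<exists>c. \<forall>g\<in>FS. pairing g f = (\<Sum>i\<in>Sigma A (\<lambda>l. {..<m l}). c i * (\<lambda>(l, j). moment l j) i g)"
    proof (rule functional_combination)
      show "pairing g f = 0" if g: "g \<in> FS" and "\<And>i. i \<in> Sigma A (\<lambda>l. {..<m l}) \<Longrightarrow> (\<lambda>(l, j). moment l j) i g = 0" for g
      proof (rule orth[OF g])
        fix l assume "l \<in> A"
        then show "vanish l (m l) g" unfolding vanish_iff_moments[OF g] using that(2) by auto
      qed
    qed (use A f(1) in \<open>auto intro: FS_add FS_cmult pairing_add pairing_cmult moment_add moment_cmult\<close>)
    then obtain c where "\<And>g. g \<in> FS \<Longrightarrow> pairing g f = (\<Sum>i\<in>Sigma A (\<lambda>l. {..<m l}). c i * (\<lambda>(l, j). moment l j) i g)"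
      by blast
    then have c: "pairing g f = (\<Sum>l\<in>A. \<Sum>j<m l. c (l, j) * moment l j g)" if "g \<in> FS" for g
      using that A by (simp add: sum.Sigma split_beta')
    \<comment> \<open>The coefficients are conjugated so that the piece of l acts on g by
      integrating \<open>shift l g\<close> against cnj (q l) with the Gaussian weight.\<close>
    define q where "q l u = (\<Sum>j<m l. cnj (c (l, j)) * u ^ j)" for l u
    have qm[measurable]: "q l \<in> borel_measurable borel" for l unfolding q_def by measurable
    define J where "J l = (LINT u|lborel. wmod (q l) u powr s)" for l
    have qi: "integrable lborel (\<lambda>u. wmod (q l) u powr s)" for l
      unfolding q_def by (rule poly_integrable) (use s_facts in auto)
    have Jnn: "(\<integral>\<^sup>+u. ennreal (wmod (q l) u powr s) \<partial>lborel) = ennreal (J l)" for l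
      unfolding J_def by (rule nn_integral_eq_integral[OF qi]) auto
    \<comment> \<open>The piece of l evaluated on the coherent state at z, divided by \<kappa>; its
      modulus is \<open>wmod (q l) (z - l)\<close>, as \<open>separated_pieces\<close>
      demands.\<close>
    define e where "e l z = cnj (q l (z - l)) * k l z" for l z
    have "(\<Sum>l\<in>A. \<integral>\<^sup>+u. ennreal (wmod (q l) u powr s) \<partial>lborel)
       \<le> 8 * (\<integral>\<^sup>+z. ennreal (cmod (\<Sum>l\<in>A. e l z) powr s) \<partial>lborel)"
      unfolding q_def
    proof (rule C0(2)[OF A m dis])
      show "e l \<in> borel_measurable borel" if "l \<in> A" for l
        using k(3)[of l] unfolding e_def by measurable
      show "cmod (e l z) = wmod (\<lambda>u. \<Sum>i<m l. cnj (c (l, i)) * u ^ i) (z - l)" if "l \<in> A" for l z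
      proof -
        have "cmod (e l z) = cmod (q l (z - l)) * cmod (k l z)" by (simp add: e_def norm_mult)
        then show ?thesis unfolding k(2) wmod_def q_def .
      qed
    qed
    also have "8 * (\<integral>\<^sup>+z. ennreal (cmod (\<Sum>l\<in>A. e l z) powr s) \<partial>lborel) \<le> 8 * ennreal (D * mass f)"
    proof (rule mult_left_mono)
      have en: "cmod (\<Sum>l\<in>A. e l z) \<le> 1 / \<kappa> * (LINT w|lborel. wmod (coherent z) w * wmod f w powr (p - 1))" for z
      proof -
        have "pairing (coherent z) f = (\<Sum>l\<in>A. \<Sum>j<m l. c (l, j) * moment l j (coherent z))"
          by (rule c[OF coherent(1)])
        also have "\<dots> = (\<Sum>l\<in>A. of_real \<kappa> * e l z)"
        proof (intro sum.cong refl)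
          fix l
          have "(\<Sum>j<m l. c (l, j) * moment l j (coherent z)) = (\<Sum>j<m l. of_real \<kappa> * (c (l, j) * cnj (z - l) ^ j * k l z))"
            by (simp add: k(1) \<kappa>_def mult_ac)
          also have "\<dots> = of_real \<kappa> * e l z"
            by (simp add: e_def q_def sum_distrib_left sum_distrib_right mult.assoc)
          finally show "(\<Sum>j<m l. c (l, j) * moment l j (coherent z)) = of_real \<kappa> * e l z" .
        qed
        finally have "pairing (coherent z) f = of_real \<kappa> * (\<Sum>l\<in>A. e l z)" by (simp add: sum_distrib_left)
        then have "\<kappa> * cmod (\<Sum>l\<in>A. e l z) = cmod (pairing (coherent z) f)" using \<kappa> by (simp add: norm_mult)
        also have "\<dots> \<le> (LINT w|lborel. cmod (coherent z w * dual f w))"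
          unfolding pairing_def by (rule integral_norm_bound)
        finally show ?thesis using \<kappa> unfolding norm_dual by (simp add: field_simps)
      qed
      have "(\<integral>\<^sup>+z. ennreal (cmod (\<Sum>l\<in>A. e l z) powr s) \<partial>lborel)
        \<le> (\<integral>\<^sup>+z. ennreal ((1 / \<kappa>) powr s * (LINT w|lborel. wmod (coherent z) w * wmod f w powr (p - 1)) powr s) \<partial>lborel)"
      proof (intro nn_integral_mono ennreal_leI)
        fix z
        have "cmod (\<Sum>l\<in>A. e l z) powr s \<le> (1 / \<kappa> * (LINT w|lborel. wmod (coherent z) w * wmod f w powr (p - 1))) powr s"
          using s_facts by (intro powr_mono2 en) auto
        also have "\<dots> = (1 / \<kappa>) powr s * (LINT w|lborel. wmod (coherent z) w * wmod f w powr (p - 1)) powr s"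
          using \<kappa> by (intro powr_mult)
        finally show "cmod (\<Sum>l\<in>A. e l z) powr s \<le> (1 / \<kappa>) powr s * (LINT w|lborel. wmod (coherent z) w * wmod f w powr (p - 1)) powr s" .
      qed
      also have "\<dots> = ennreal ((1 / \<kappa>) powr s) * (\<integral>\<^sup>+z. ennreal ((LINT w|lborel. wmod (coherent z) w * wmod f w powr (p - 1)) powr s) \<partial>lborel)"
      proof -
        have [measurable]: "f \<in> borel_measurable borel" using f(1) by (auto intro: entire_measurable FS_entire)
        have [measurable]: "(\<lambda>z. LINT w|lborel. wmod (coherent z) w * wmod f w powr (p - 1)) \<in> borel_measurable borel"
          unfolding wmod_coherent by measurable
        show ?thesis by (simp add: ennreal_mult nn_integral_cmult)
      qed
      also have "\<dots> \<le> ennreal ((1 / \<kappa>) powr s) * ennreal (\<Gamma> powr s * mass f)"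
        unfolding \<Gamma>_def by (intro mult_left_mono convolution_bound f) auto
      also have "\<dots> = ennreal (D * mass f)"
        using \<kappa> G0 by (simp add: D_def powr_divide ennreal_mult[symmetric])
      finally show "(\<integral>\<^sup>+z. ennreal (cmod (\<Sum>l\<in>A. e l z) powr s) \<partial>lborel) \<le> ennreal (D * mass f)" .
    qed simp
    also have "8 * ennreal (D * mass f) = ennreal (8 * (D * mass f))"
      using D by (simp add: ennreal_mult)
    finally have "ennreal (\<Sum>l\<in>A. J l) \<le> ennreal (8 * (D * mass f))"
      unfolding Jnn by (subst (asm) sum_ennreal) (simp_all add: J_def)
    then have sumJ: "(\<Sum>l\<in>A. J l) \<le> 8 * (D * mass f)"
      by (subst (asm) ennreal_le_iff) (use D in auto)
    \<comment> \<open>Only moments below the multiplicity occur, and there f and the datum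
      \<open>F l\<close> agree; f may therefore be replaced by the datum before Young's
      inequality.\<close>
    have piece: "cmod (\<Sum>j<m l. c (l, j) * moment l j f) \<le> K * mass (F l) + \<delta> * J l" if l: "l \<in> A" for l
    proof -
      have mom: "moment l j f = moment l j (F l)" if "j < m l" for j
      proof -
        have "moment l j (\<lambda>z. f z - F l z) = 0"
          using f(2)[OF l] that unfolding vanish_iff_moments[OF FS_diff(1)[OF f(1) F[OF l]]] by blast
        then show ?thesis using moment_diff[OF f(1) F[OF l]] by simp
      qed
      have "(\<Sum>j<m l. c (l, j) * moment l j f) = (\<Sum>j<m l. c (l, j) * moment l j (F l))"
        using mom by (intro sum.cong) auto
      also have "\<dots> = (LINT u|lborel. (\<Sum>j<m l. c (l, j) * (shift l (F l) u * cnj u ^ j * of_real (exp (- \<alpha> * (cmod u)\<^sup>2)))))"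
        unfolding moment_def
        by (subst Bochner_Integration.integral_sum) (intro integrable_mult_right FS_moment F l, simp only: integral_mult_right_zero)
      also have "(\<lambda>u. (\<Sum>j<m l. c (l, j) * (shift l (F l) u * cnj u ^ j * of_real (exp (- \<alpha> * (cmod u)\<^sup>2)))))
          = (\<lambda>u. shift l (F l) u * cnj (q l u) * of_real (exp (- \<alpha> * (cmod u)\<^sup>2)))"
        by (simp add: q_def sum_distrib_left sum_distrib_right mult_ac fun_eq_iff)
      finally have "cmod (\<Sum>j<m l. c (l, j) * moment l j f)
          \<le> (LINT u|lborel. cmod (shift l (F l) u * cnj (q l u) * of_real (exp (- \<alpha> * (cmod u)\<^sup>2))))"
        by (simp only: integral_norm_bound)
      also have "(\<lambda>u. cmod (shift l (F l) u * cnj (q l u) * of_real (exp (- \<alpha> * (cmod u)\<^sup>2)))) = (\<lambda>u. wmod (shift l (F l)) u * wmod (q l) u)"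
      proof
        fix u :: complex
        have "exp (- \<alpha> * (cmod u)\<^sup>2) = exp (- \<alpha> * (cmod u)\<^sup>2 / 2) * exp (- \<alpha> * (cmod u)\<^sup>2 / 2)"
          unfolding exp_add[symmetric] by simp
        then show "cmod (shift l (F l) u * cnj (q l u) * of_real (exp (- \<alpha> * (cmod u)\<^sup>2))) = wmod (shift l (F l)) u * wmod (q l) u"
          by (simp add: norm_mult wmod_def mult_ac)
      qed
      also have "(LINT u|lborel. wmod (shift l (F l)) u * wmod (q l) u) \<le> (LINT u|lborel. K * wmod (shift l (F l)) u powr p + \<delta> * wmod (q l) u powr s)"
      proof -
        have i: "integrable lborel (\<lambda>u. K * wmod (shift l (F l)) u powr p + \<delta> * wmod (q l) u powr s)"
          by (intro Bochner_Integration.integrable_add integrable_mult_right FS_integrable shift_FS F l qi)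
        have [measurable]: "shift l (F l) \<in> borel_measurable borel"
          using shift_FS(1)[OF F[OF l]] by (auto intro: entire_measurable FS_entire)
        have i2: "integrable lborel (\<lambda>u. wmod (shift l (F l)) u * wmod (q l) u)"
        proof (rule Bochner_Integration.integrable_bound[OF i])
          show "AE u in lborel. norm (wmod (shift l (F l)) u * wmod (q l) u) \<le> norm (K * wmod (shift l (F l)) u powr p + \<delta> * wmod (q l) u powr s)"
          proof (rule AE_I2)
            fix u
            have "wmod (shift l (F l)) u * wmod (q l) u \<le> K * wmod (shift l (F l)) u powr p + \<delta> * wmod (q l) u powr s"
              by (rule K(2)) auto
            then show "norm (wmod (shift l (F l)) u * wmod (q l) u) \<le> norm (K * wmod (shift l (F l)) u powr p + \<delta> * wmod (q l) u powr s)"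
              by (simp add: abs_mult)
          qed
        qed measurable
        show ?thesis by (intro integral_mono i i2 K(2)) auto
      qed
      also have "\<dots> = K * mass (shift l (F l)) + \<delta> * J l"
        using qi FS_integrable[OF shift_FS(1)[OF F[OF l]]] by (simp add: mass_def J_def)
      finally show ?thesis using shift_FS(2)[OF F[OF l]] by simp
    qed
    have "mass f = cmod (pairing f f)" unfolding pairing_self by simp
    also have "\<dots> = cmod (\<Sum>l\<in>A. \<Sum>j<m l. c (l, j) * moment l j f)" using c[OF f(1)] by simp
    also have "\<dots> \<le> (\<Sum>l\<in>A. K * mass (F l) + \<delta> * J l)"
      by (rule order_trans[OF norm_sum sum_mono[OF piece]])
    also have "\<dots> = K * (\<Sum>l\<in>A. mass (F l)) + \<delta> * (\<Sum>l\<in>A. J l)"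
      by (simp add: sum.distrib sum_distrib_left)
    also have "\<delta> * (\<Sum>l\<in>A. J l) \<le> \<delta> * (8 * (D * mass f))"
      using \<delta>(1) sumJ by (intro mult_left_mono) auto
    also have "\<delta> * (8 * (D * mass f)) = (\<delta> * (8 * D)) * mass f" by simp
    also have "\<dots> \<le> 1 / 2 * mass f" by (intro mult_right_mono \<delta>) simp
    finally have "mass f \<le> 2 * K * (\<Sum>l\<in>A. mass (F l))" by simp
    then show "\<exists>f\<in>FS. (\<forall>l\<in>A. vanish l (m l) (\<lambda>z. f z - F l z)) \<and> mass f \<le> 2 * K * (\<Sum>l\<in>A. mass (F l))"
      using f by blast
  qed
qed

end

lemma powr_le_zeroD: "x = 0" if "x powr q \<le> (0::real)"
  using that powr_ge_zero[of x q] by (simp add: order_antisym_conv)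

context fock
begin

subsection \<open>Quotient norms\<close>

lemma quotient_bdd: "bdd_below ((\<lambda>g. fock_norm p \<alpha> (\<lambda>z. F z - g z)) ` vanishing_space p \<alpha> m l)"
  by (intro bdd_belowI[of _ 0]) auto

lemma vanishing_space_nonempty: "vanishing_space p \<alpha> m l \<noteq> {}"
proof -
  have "(\<lambda>z. 0) \<in> vanishing_space p \<alpha> m l" by (simp add: vanishing_space_iff vanish_zero)
  then show ?thesis by blast
qed

lemma quotient_nonneg: "0 \<le> quotient_norm p \<alpha> m l F"
  unfolding quotient_norm_def by (rule cINF_greatest[OF vanishing_space_nonempty]) simp

lemma quotient_le_mass:
  assumes F: "F \<in> FS" and G: "G \<in> FS" and v: "vanish l (m l) (\<lambda>z. G z - F z)"
  shows "quotient_norm p \<alpha> m l F powr p \<le> mass G"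
proof -
  have "vanish l (m l) (\<lambda>z. F z - G z)" using vanish_cmult[OF v, of "-1"] by simp
  then have g: "(\<lambda>z. F z - G z) \<in> vanishing_space p \<alpha> m l"
    using F G by (simp add: vanishing_space_iff FS_diff)
  have "quotient_norm p \<alpha> m l F \<le> fock_norm p \<alpha> (\<lambda>z. F z - (F z - G z))"
    unfolding quotient_norm_def by (rule cINF_lower[OF quotient_bdd g])
  then have "quotient_norm p \<alpha> m l F \<le> fock_norm p \<alpha> G" by simp
  then have "quotient_norm p \<alpha> m l F powr p \<le> fock_norm p \<alpha> G powr p"
    using p2 quotient_nonneg by (intro powr_mono2) auto
  then show ?thesis unfolding fock_norm_powr .
qed

lemma quotient_approx:
  assumes F: "F \<in> FS" and e: "quotient_norm p \<alpha> m l F < e"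
  obtains G where "G \<in> FS" "vanish l (m l) (\<lambda>z. G z - F z)" "mass G \<le> e powr p"
proof -
  have "\<exists>g\<in>vanishing_space p \<alpha> m l. fock_norm p \<alpha> (\<lambda>z. F z - g z) < e"
    using e unfolding quotient_norm_def by (subst (asm) cINF_less_iff[OF vanishing_space_nonempty quotient_bdd])
  then obtain g where g: "g \<in> FS" "vanish l (m l) g" "fock_norm p \<alpha> (\<lambda>z. F z - g z) < e"
    by (auto simp: vanishing_space_iff)
  show ?thesis
  proof (rule that)
    show "(\<lambda>z. F z - g z) \<in> FS" by (rule FS_diff[OF F g(1)])
    show "vanish l (m l) (\<lambda>z. F z - g z - F z)" using vanish_cmult[OF g(2), of "-1"] by simp
    have "fock_norm p \<alpha> (\<lambda>z. F z - g z) powr p \<le> e powr p" using g(3) p2 by (intro powr_mono2) auto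
    then show "mass (\<lambda>z. F z - g z) \<le> e powr p" unfolding fock_norm_powr .
  qed
qed

text \<open>The vanishing space is closed because moments are continuous. This covers the case in
  which no representative of proportional norm can be picked by slack.\<close>

lemma quotient_zero:
  assumes F: "F \<in> FS" and z: "quotient_norm p \<alpha> m l F = 0"
  shows "vanish l (m l) F"
  unfolding vanish_iff_moments[OF F]
proof (intro allI impI)
  fix j assume j: "j < m l"
  obtain C where C: "C \<ge> 0" "\<And>f l. f \<in> FS \<Longrightarrow> cmod (moment l j f) powr p \<le> C * mass f"
    using FS_moment(2)[of j] by blast
  have "cmod (moment l j F) powr p \<le> 0"
  proof (rule field_le_epsilon)
    fix e :: real assume e: "e > 0"
    define d where "d = (e / (C + 1)) powr (1 / p)"
    have d: "d > 0" "d powr p = e / (C + 1)" using e C(1) p2 by (auto simp: d_def powr_powr)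
    obtain G where G: "G \<in> FS" "vanish l (m l) (\<lambda>z. G z - F z)" "mass G \<le> d powr p"
      by (rule quotient_approx[OF F, of m l d]) (use z d in auto)
    have "moment l j (\<lambda>z. G z - F z) = 0"
      using G(2) j unfolding vanish_iff_moments[OF FS_diff(1)[OF G(1) F]] by blast
    then have "moment l j F = moment l j G" using moment_diff[OF G(1) F] by simp
    then have "cmod (moment l j F) powr p \<le> C * mass G" using C(2)[OF G(1)] by simp
    also have "\<dots> \<le> (C + 1) * (d powr p)" using C(1) G(3) by (intro mult_mono) auto
    also have "\<dots> = e" unfolding d(2) using C(1) by simp
    finally show "cmod (moment l j F) powr p \<le> 0 + e" by simp
  qed
  then show "moment l j F = 0" using powr_le_zeroD by fastforce
qed

text \<open>A positive quotient norm leaves room for a representative of at most twice that norm; if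
  it is zero, the zero function represents the class.\<close>

lemma quotient_representative:
  assumes F: "F \<in> FS"
  shows "\<exists>G\<in>FS. vanish l (m l) (\<lambda>z. G z - F z) \<and> mass G \<le> 2 powr p * quotient_norm p \<alpha> m l F powr p"
proof (cases "quotient_norm p \<alpha> m l F = 0")
  case True
  have "vanish l (m l) (\<lambda>z. 0 - F z)" using vanish_cmult[OF quotient_zero[OF F True], of "-1"] by simp
  then show ?thesis using True by (intro bexI[of _ "\<lambda>z. 0"]) auto
next
  case False
  then have q: "quotient_norm p \<alpha> m l F > 0" using quotient_nonneg[of m l F] by linarith
  obtain G where "G \<in> FS" "vanish l (m l) (\<lambda>z. G z - F z)" "mass G \<le> (2 * quotient_norm p \<alpha> m l F) powr p"
    by (rule quotient_approx[OF F, of m l "2 * quotient_norm p \<alpha> m l F"]) (use q in auto)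
  then show ?thesis using q by (intro bexI[of _ G]) (auto simp: powr_mult)
qed

lemma interpolates_iff:
  "interpolates p \<alpha> \<Lambda> m F f \<longleftrightarrow> f \<in> FS \<and> (\<forall>l\<in>\<Lambda>. (\<lambda>z. f z - F l z) \<in> FS \<and> vanish l (m l) (\<lambda>z. f z - F l z))"
  by (simp add: interpolates_def vanishing_space_iff)

lemma interpolatesI:
  assumes "f \<in> FS" "\<And>l. l \<in> \<Lambda> \<Longrightarrow> F l \<in> FS" "\<And>l. l \<in> \<Lambda> \<Longrightarrow> vanish l (m l) (\<lambda>z. f z - F l z)"
  shows "interpolates p \<alpha> \<Lambda> m F f"
  using assms by (auto simp: interpolates_iff intro: FS_diff)

lemma vanish_trans:
  assumes "vanish l m (\<lambda>z. f z - g z)" "vanish l m (\<lambda>z. g z - h z)"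
  shows "vanish l m (\<lambda>z. f z - h z)"
  using vanish_add[OF assms] by simp

subsection \<open>From finite to countable divisors\<close>

lemma compact_interpolation:
  assumes c: "countable \<Lambda>" and F: "\<And>l. l \<in> \<Lambda> \<Longrightarrow> F l \<in> FS"
    and fin: "\<And>A. finite A \<Longrightarrow> A \<subseteq> \<Lambda> \<Longrightarrow> \<exists>f\<in>FS. (\<forall>l\<in>A. vanish l (m l) (\<lambda>z. f z - F l z)) \<and> mass f \<le> B"
  shows "\<exists>f\<in>FS. (\<forall>l\<in>\<Lambda>. vanish l (m l) (\<lambda>z. f z - F l z)) \<and> mass f \<le> B"
proof -
  \<comment> \<open>An exhaustion by finite sets. Along any subsequence each point eventually
    belongs to the sets, so its condition survives in the limit.\<close>
  define A where "A n = {l \<in> \<Lambda>. to_nat_on \<Lambda> l \<le> n}" for n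
  have "finite (A n)" for n
  proof (rule finite_imageD)
    show "finite (to_nat_on \<Lambda> ` A n)" by (rule finite_subset[of _ "{..n}"]) (auto simp: A_def)
    show "inj_on (to_nat_on \<Lambda>) (A n)" by (rule inj_on_subset[OF inj_on_to_nat_on[OF c]]) (auto simp: A_def)
  qed
  then have "\<exists>f\<in>FS. (\<forall>l\<in>A n. vanish l (m l) (\<lambda>z. f z - F l z)) \<and> mass f \<le> B" for n
    by (intro fin) (auto simp: A_def)
  then obtain f where f: "\<And>n. f n \<in> FS" "\<And>n l. l \<in> A n \<Longrightarrow> vanish l (m l) (\<lambda>z. f n z - F l z)" "\<And>n. mass (f n) \<le> B"
    by metis
  obtain g r where g: "strict_mono (r :: nat \<Rightarrow> nat)" "g \<in> FS" "mass g \<le> B"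
    "\<And>l m h. h holomorphic_on UNIV \<Longrightarrow> (\<forall>\<^sub>F n in sequentially. vanish l m (\<lambda>z. f (r n) z - h z)) \<Longrightarrow>
       vanish l m (\<lambda>z. g z - h z)"
    by (rule compactness[where f=f and b="\<lambda>_. B" and B=B, OF f(1) f(3) tendsto_const]) blast
  have "vanish l (m l) (\<lambda>z. g z - F l z)" if l: "l \<in> \<Lambda>" for l
  proof (rule g(4)[OF FS_entire[OF F[OF l]]])
    show "\<forall>\<^sub>F n in sequentially. vanish l (m l) (\<lambda>z. f (r n) z - F l z)"
    proof (rule eventually_sequentiallyI[of "to_nat_on \<Lambda> l"])
      fix n assume "to_nat_on \<Lambda> l \<le> n"
      also have "n \<le> r n" by (rule seq_suble[OF g(1)])
      finally show "vanish l (m l) (\<lambda>z. f (r n) z - F l z)" using l by (intro f(2)) (simp add: A_def)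
    qed
  qed
  then show ?thesis using g by blast
qed

lemma admissible_representatives:
  assumes "admissible_data p \<alpha> \<Lambda> m F"
  obtains G where "\<And>l. l \<in> \<Lambda> \<Longrightarrow> G l \<in> FS" "\<And>l. l \<in> \<Lambda> \<Longrightarrow> vanish l (m l) (\<lambda>z. G l z - F l z)"
    "(\<lambda>l. mass (G l)) summable_on \<Lambda>"
    "(\<Sum>\<^sub>\<infinity>l\<in>\<Lambda>. mass (G l)) \<le> 2 powr p * (\<Sum>\<^sub>\<infinity>l\<in>\<Lambda>. quotient_norm p \<alpha> m l (F l) powr p)"
proof -
  have F: "\<And>l. l \<in> \<Lambda> \<Longrightarrow> F l \<in> FS" and sm: "(\<lambda>l. quotient_norm p \<alpha> m l (F l) powr p) summable_on \<Lambda>"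
    using assms by (auto simp: admissible_data_def)
  have "\<forall>l\<in>\<Lambda>. \<exists>G. G \<in> FS \<and> vanish l (m l) (\<lambda>z. G z - F l z) \<and> mass G \<le> 2 powr p * quotient_norm p \<alpha> m l (F l) powr p"
    using quotient_representative[OF F] by blast
  then obtain G where G: "\<And>l. l \<in> \<Lambda> \<Longrightarrow> G l \<in> FS" "\<And>l. l \<in> \<Lambda> \<Longrightarrow> vanish l (m l) (\<lambda>z. G l z - F l z)"
    "\<And>l. l \<in> \<Lambda> \<Longrightarrow> mass (G l) \<le> 2 powr p * quotient_norm p \<alpha> m l (F l) powr p"
    by metis
  have sm2: "(\<lambda>l. 2 powr p * quotient_norm p \<alpha> m l (F l) powr p) summable_on \<Lambda>"
    by (rule summable_on_cmult_right[OF sm])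
  have sm3: "(\<lambda>l. mass (G l)) summable_on \<Lambda>"
    by (rule summable_on_comparison_test[OF sm2]) (use G in auto)
  show ?thesis
  proof (rule that[OF G(1,2) sm3])
    have "(\<Sum>\<^sub>\<infinity>l\<in>\<Lambda>. mass (G l)) \<le> (\<Sum>\<^sub>\<infinity>l\<in>\<Lambda>. 2 powr p * quotient_norm p \<alpha> m l (F l) powr p)"
      by (rule infsum_mono[OF sm3 sm2]) (rule G(3))
    also have "\<dots> = 2 powr p * (\<Sum>\<^sub>\<infinity>l\<in>\<Lambda>. quotient_norm p \<alpha> m l (F l) powr p)"
      by (rule infsum_cmult_right') 
    finally show "(\<Sum>\<^sub>\<infinity>l\<in>\<Lambda>. mass (G l)) \<le> 2 powr p * (\<Sum>\<^sub>\<infinity>l\<in>\<Lambda>. quotient_norm p \<alpha> m l (F l) powr p)" .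
  qed
qed

lemma sufficiency:
  "\<exists>C0>0. \<forall>\<Lambda> m. divisor \<Lambda> m \<and> disjoint_family_on (\<lambda>l. ball l (sqrt (real (m l) / \<alpha>) + C0)) \<Lambda> \<longrightarrow> interpolating p \<alpha> \<Lambda> m"
proof -
  obtain C0 M where C: "C0 \<ge> 1" "M \<ge> 0"
    "\<And>A m F. \<lbrakk>finite A; \<And>l. l \<in> A \<Longrightarrow> m l \<ge> 1; disjoint_family_on (\<lambda>l. ball l (sqrt (real (m l) / \<alpha>) + C0)) A;
       \<And>l. l \<in> A \<Longrightarrow> F l \<in> FS\<rbrakk>
     \<Longrightarrow> \<exists>f\<in>FS. (\<forall>l\<in>A. vanish l (m l) (\<lambda>z. f z - F l z)) \<and> mass f \<le> M * (\<Sum>l\<in>A. mass (F l))"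
  proof (rule finite_interpolation, goal_cases)
    case (1 C M)
    show ?case by (rule 1(1)[OF 1(2) 1(3) 1(4)])
  qed
  show ?thesis
  proof (intro exI[of _ C0] conjI allI impI)
    show "C0 > 0" using C(1) by simp
    fix \<Lambda> m assume "divisor \<Lambda> m \<and> disjoint_family_on (\<lambda>l. ball l (sqrt (real (m l) / \<alpha>) + C0)) \<Lambda>"
    then have \<Lambda>: "countable \<Lambda>" "\<And>l. l \<in> \<Lambda> \<Longrightarrow> m l \<ge> 1" "disjoint_family_on (\<lambda>l. ball l (sqrt (real (m l) / \<alpha>) + C0)) \<Lambda>"
      by (auto simp: divisor_def)
    show "interpolating p \<alpha> \<Lambda> m" unfolding interpolating_def
    proof (intro allI impI)
      fix F assume adm: "admissible_data p \<alpha> \<Lambda> m F"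
      then have F: "\<And>l. l \<in> \<Lambda> \<Longrightarrow> F l \<in> FS" by (auto simp: admissible_data_def)
      obtain G where G: "\<And>l. l \<in> \<Lambda> \<Longrightarrow> G l \<in> FS" "\<And>l. l \<in> \<Lambda> \<Longrightarrow> vanish l (m l) (\<lambda>z. G l z - F l z)"
        "(\<lambda>l. mass (G l)) summable_on \<Lambda>"
        by (rule admissible_representatives[OF adm]) blast
      have "\<exists>f\<in>FS. (\<forall>l\<in>\<Lambda>. vanish l (m l) (\<lambda>z. f z - G l z)) \<and> mass f \<le> M * (\<Sum>\<^sub>\<infinity>l\<in>\<Lambda>. mass (G l))"
      proof (rule compact_interpolation[OF \<Lambda>(1) G(1)])
        fix A assume A: "finite A" "A \<subseteq> \<Lambda>"
        have "\<exists>f\<in>FS. (\<forall>l\<in>A. vanish l (m l) (\<lambda>z. f z - G l z)) \<and> mass f \<le> M * (\<Sum>l\<in>A. mass (G l))"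
          using A \<Lambda>(2) G(1) disjoint_family_on_mono[OF A(2) \<Lambda>(3)] by (intro C(3)) auto
        moreover have "M * (\<Sum>l\<in>A. mass (G l)) \<le> M * (\<Sum>\<^sub>\<infinity>l\<in>\<Lambda>. mass (G l))"
          using finite_sum_le_infsum[OF G(3) A] C(2) by (intro mult_left_mono) auto
        ultimately show "\<exists>f\<in>FS. (\<forall>l\<in>A. vanish l (m l) (\<lambda>z. f z - G l z)) \<and> mass f \<le> M * (\<Sum>\<^sub>\<infinity>l\<in>\<Lambda>. mass (G l))"
          by (meson order_trans)
      qed
      then obtain f where f: "f \<in> FS" "\<And>l. l \<in> \<Lambda> \<Longrightarrow> vanish l (m l) (\<lambda>z. f z - G l z)" by blast
      have "interpolates p \<alpha> \<Lambda> m F f"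
        by (rule interpolatesI[OF f(1) F]) (use vanish_trans[OF f(2) G(2)] in auto)
      then show "\<exists>f. interpolates p \<alpha> \<Lambda> m F f" by (rule exI[of _ f])
    qed
  qed
qed


subsection \<open>Boundedness of the interpolation operator\<close>

lemma moment_sum: "(\<And>i. i \<in> I \<Longrightarrow> f i \<in> FS) \<Longrightarrow> moment l j (\<lambda>z. \<Sum>i\<in>I. f i z) = (\<Sum>i\<in>I. moment l j (f i))"
proof (induction I rule: infinite_finite_induct)
  case (insert a I)
  then show ?case by (simp add: moment_add FS_sum)
qed (simp_all add: moment_def shift_def)

text \<open>Data concentrated at a single point. They produce the basis functions of
  \<open>finite_part_bounded\<close> and the test problem of the necessity argument.\<close>

lemma point_data_admissible:
  assumes l: "l \<in> \<Lambda>" and e: "e \<in> FS"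
  defines "F \<equiv> (\<lambda>k. if k = l then e else (\<lambda>z. 0))"
  shows "admissible_data p \<alpha> \<Lambda> m F"
    and "(\<Sum>\<^sub>\<infinity>k\<in>\<Lambda>. quotient_norm p \<alpha> m k (F k) powr p) \<le> mass e"
proof -
  have z: "quotient_norm p \<alpha> m k (F k) powr p = 0" if "k \<in> \<Lambda> - {l}" for k
  proof -
    have "quotient_norm p \<alpha> m k (F k) powr p \<le> mass (\<lambda>z. 0)"
      by (rule quotient_le_mass) (use that vanish_zero in \<open>auto simp: F_def\<close>)
    then show ?thesis using powr_le_zeroD[of "quotient_norm p \<alpha> m k (F k)" p] by simp
  qed
  have "(\<lambda>k. quotient_norm p \<alpha> m k (F k) powr p) summable_on {l}" by simp
  also have "?this \<longleftrightarrow> (\<lambda>k. quotient_norm p \<alpha> m k (F k) powr p) summable_on \<Lambda>"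
    by (rule summable_on_cong_neutral) (use z l in auto)
  finally show "admissible_data p \<alpha> \<Lambda> m F" using e by (auto simp: admissible_data_def F_def)
  have "(\<Sum>\<^sub>\<infinity>k\<in>\<Lambda>. quotient_norm p \<alpha> m k (F k) powr p) = (\<Sum>\<^sub>\<infinity>k\<in>{l}. quotient_norm p \<alpha> m k (F k) powr p)"
    by (rule infsum_cong_neutral) (use z l in auto)
  also have "\<dots> = quotient_norm p \<alpha> m l e powr p" by (simp add: F_def)
  also have "\<dots> \<le> mass e" by (rule quotient_le_mass[OF e e]) (simp add: vanish_zero)
  finally show "(\<Sum>\<^sub>\<infinity>k\<in>\<Lambda>. quotient_norm p \<alpha> m k (F k) powr p) \<le> mass e" .
qed

text \<open>Solving the problem for each single moment at a point of B gives functions whose moments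
  on B are Kronecker deltas and which vanish as required off B. Their linear combinations solve
  every problem on B; K may depend on B and on the multiplicities.\<close>

lemma finite_part_bounded:
  assumes int: "interpolating p \<alpha> \<Lambda> m" and B: "finite B" "B \<subseteq> \<Lambda>"
  obtains K where "K \<ge> 0"
    "\<And>F. (\<And>l. l \<in> B \<Longrightarrow> F l \<in> FS) \<Longrightarrow> \<exists>f\<in>FS. (\<forall>l\<in>B. vanish l (m l) (\<lambda>z. f z - F l z))
       \<and> (\<forall>l\<in>\<Lambda> - B. vanish l (m l) f) \<and> mass f \<le> K * (\<Sum>l\<in>B. mass (F l))"
proof -
  \<comment> \<open>Monomials centred at l: by orthogonality exactly one moment at l is
    nonzero.\<close>
  define e where "e l j = shift (- l) (\<lambda>u. u ^ j)" for l j
  have eF: "e l j \<in> FS" for l j unfolding e_def by (rule shift_FS(1)[OF power_FS])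
  have me: "moment l i (e l j) = (if j = i then of_real (gmoment i) else 0)" for l i j
  proof -
    have "shift l (e l j) = (\<lambda>u. u ^ j)" unfolding e_def using shift_inverse[of "- l"] by simp
    then show ?thesis unfolding moment_def using integral_monomials(2)[of j i] by simp
  qed
  have "\<exists>\<phi>. interpolates p \<alpha> \<Lambda> m (\<lambda>k. if k = l then e l j else (\<lambda>z. 0)) \<phi>" if "l \<in> B" for l j
    using int point_data_admissible(1)[OF subsetD[OF B(2) that] eF] unfolding interpolating_def by blast
  then obtain \<phi> where \<phi>: "\<And>l j. l \<in> B \<Longrightarrow> interpolates p \<alpha> \<Lambda> m (\<lambda>k. if k = l then e l j else (\<lambda>z. 0)) (\<phi> l j)"
    by metis
  have \<phi>F: "\<phi> l j \<in> FS" if "l \<in> B" for l j using \<phi>[OF that] by (simp add: interpolates_iff)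
  have \<phi>v: "vanish k (m k) (\<phi> l j)" if "l \<in> B" "k \<in> \<Lambda>" "k \<noteq> l" for k l j
    using \<phi>[OF that(1), of j] that by (auto simp: interpolates_iff)
  have \<phi>e: "vanish l (m l) (\<lambda>z. \<phi> l j z - e l j z)" if "l \<in> B" for l j
  proof -
    have "vanish l (m l) (\<lambda>z. \<phi> l j z - (if l = l then e l j else (\<lambda>z. 0)) z)"
      using \<phi>[OF that, of j] subsetD[OF B(2) that] unfolding interpolates_iff by blast
    then show ?thesis by simp
  qed
  have m\<phi>: "moment k i (\<phi> l j) = (if l = k \<and> j = i then of_real (gmoment i) else 0)"
    if "l \<in> B" "k \<in> B" "i < m k" for k l i j
  proof (cases "l = k")
    case True
    have "moment k i (\<lambda>z. \<phi> l j z - e l j z) = 0"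
      using \<phi>e[OF that(1), of j] that(3) True unfolding vanish_iff_moments[OF FS_diff(1)[OF \<phi>F[OF that(1)] eF]] by blast
    then show ?thesis using moment_diff[OF \<phi>F[OF that(1)] eF, of k i j l j] me[of l i j] True by simp
  next
    case False
    then show ?thesis using \<phi>v[OF that(1), of k j] that B unfolding vanish_iff_moments[OF \<phi>F[OF that(1)]] by auto
  qed
  define I where "I = Sigma B (\<lambda>l. {..<m l})"
  have fI: "finite I" using B by (simp add: I_def)
  obtain K1 where K1: "K1 \<ge> 0" "\<And>f. \<forall>i\<in>I. f i \<in> FS \<Longrightarrow> mass (\<lambda>z. \<Sum>i\<in>I. f i z) \<le> K1 * (\<Sum>i\<in>I. mass (f i))"
    using mass_sum_le[OF fI] by blast
  have "\<forall>j. \<exists>C\<ge>0. \<forall>f\<in>FS. \<forall>l. cmod (moment l j f) powr p \<le> C * mass f" using FS_moment(2) by blast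
  then obtain C where C: "\<And>j. C j \<ge> 0" "\<And>j f l. f \<in> FS \<Longrightarrow> cmod (moment l j f) powr p \<le> C j * mass f" by metis
  define d where "d i = C (snd i) / gmoment (snd i) powr p * mass (\<phi> (fst i) (snd i))" for i
  have d0: "d i \<ge> 0" for i unfolding d_def using C(1) by simp
  show ?thesis
  proof (rule that)
    show "K1 * (\<Sum>i\<in>I. d i) \<ge> 0" using K1(1) d0 by (simp add: sum_nonneg)
    fix F assume F: "\<And>l. l \<in> B \<Longrightarrow> F l \<in> FS"
    \<comment> \<open>The moment of the datum divided by the moment of the matching basis
      function.\<close>
    define a where "a i = moment (fst i) (snd i) (F (fst i)) / of_real (gmoment (snd i))" for i
    define t where "t i z = a i * \<phi> (fst i) (snd i) z" for i z
    have tF: "t i \<in> FS" if "i \<in> I" for i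
      unfolding t_def using that by (intro FS_cmult \<phi>F) (auto simp: I_def)
    define f where "f z = (\<Sum>i\<in>I. t i z)" for z
    have fF: "f \<in> FS" unfolding f_def by (rule FS_sum[OF tF])
    have vB: "vanish k (m k) (\<lambda>z. f z - F k z)" if k: "k \<in> B" for k
      unfolding vanish_iff_moments[OF FS_diff(1)[OF fF F[OF k]]]
    proof (intro allI impI)
      fix i assume i: "i < m k"
      have "moment k i f = (\<Sum>x\<in>I. moment k i (t x))" unfolding f_def by (rule moment_sum[OF tF])
      also have "\<dots> = (\<Sum>x\<in>I. if x = (k, i) then moment k i (F k) else 0)"
      proof (intro sum.cong refl)
        fix x assume x: "x \<in> I"
        have "moment k i (t x) = a x * moment k i (\<phi> (fst x) (snd x))" unfolding t_def by (rule moment_cmult)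
        also have "moment k i (\<phi> (fst x) (snd x)) = (if fst x = k \<and> snd x = i then of_real (gmoment i) else 0)"
          by (rule m\<phi>) (use x k i in \<open>auto simp: I_def\<close>)
        finally show "moment k i (t x) = (if x = (k, i) then moment k i (F k) else 0)"
          using gmoment_pos[of i] by (auto simp: a_def prod_eq_iff)
      qed
      also have "\<dots> = moment k i (F k)" using fI k i by (simp add: I_def)
      finally show "moment k i (\<lambda>z. f z - F k z) = 0" using moment_diff[OF fF F[OF k]] by simp
    qed
    have vO: "vanish k (m k) f" if k: "k \<in> \<Lambda> - B" for k
      unfolding f_def t_def by (intro vanish_sum vanish_cmult \<phi>v) (use k in \<open>auto simp: I_def\<close>)
    have "mass f \<le> K1 * (\<Sum>i\<in>I. mass (t i))" unfolding f_def using K1(2)[of t] tF by blast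
    also have "\<dots> \<le> K1 * (\<Sum>i\<in>I. d i * (\<Sum>l\<in>B. mass (F l)))"
    proof (intro mult_left_mono sum_mono K1(1))
      fix i assume i: "i \<in> I"
      then have iB: "fst i \<in> B" by (auto simp: I_def)
      have "mass (t i) = cmod (a i) powr p * mass (\<phi> (fst i) (snd i))" unfolding t_def by (rule mass_cmult)
      also have "cmod (a i) powr p = cmod (moment (fst i) (snd i) (F (fst i))) powr p / gmoment (snd i) powr p"
        using gmoment_pos[of "snd i"] by (simp add: a_def norm_divide powr_divide)
      also have "\<dots> \<le> C (snd i) * mass (F (fst i)) / gmoment (snd i) powr p"
        by (intro divide_right_mono C(2) F iB) simp
      also have "\<dots> \<le> C (snd i) * (\<Sum>l\<in>B. mass (F l)) / gmoment (snd i) powr p"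
        using member_le_sum[of "fst i" B "\<lambda>l. mass (F l)"] iB B C(1)
        by (intro divide_right_mono mult_left_mono) auto
      finally show "mass (t i) \<le> d i * (\<Sum>l\<in>B. mass (F l))"
        by (simp add: d_def mult_right_mono mult_ac)
    qed
    also have "\<dots> = K1 * (\<Sum>i\<in>I. d i) * (\<Sum>l\<in>B. mass (F l))" by (simp add: sum_distrib_right mult.assoc)
    finally show "\<exists>f\<in>FS. (\<forall>l\<in>B. vanish l (m l) (\<lambda>z. f z - F l z))
       \<and> (\<forall>l\<in>\<Lambda> - B. vanish l (m l) f) \<and> mass f \<le> K1 * (\<Sum>i\<in>I. d i) * (\<Sum>l\<in>B. mass (F l))"
      using fF vB vO by blast
  qed
qed

lemma mass_eq_0:
  assumes "f \<in> FS" "mass f = 0" shows "f = (\<lambda>z. 0)"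
proof
  fix z
  obtain A where A: "A > 0" "\<And>f z. f \<in> FS \<Longrightarrow> wmod f z powr p \<le> A * mass f"
    using pointwise_bound by blast
  have "wmod f z powr p \<le> 0" using A(2)[OF assms(1), of z] assms(2) by simp
  then have "wmod f z = 0" by (rule powr_le_zeroD)
  then show "f z = 0" by (simp add: wmod_def)
qed

text \<open>A gliding hump: otherwise disjoint finite blocks whose data have summable norms
  but require ever larger interpolants could be assembled into one unsolvable problem.\<close>

lemma tail_bounded:
  assumes int: "interpolating p \<alpha> \<Lambda> m"
  obtains B K where "finite B" "B \<subseteq> \<Lambda>" "K \<ge> 0"
    "\<And>A F. \<lbrakk>finite A; A \<subseteq> \<Lambda> - B; \<And>l. l \<in> A \<Longrightarrow> F l \<in> FS\<rbrakk>
      \<Longrightarrow> \<exists>f\<in>FS. (\<forall>l\<in>A. vanish l (m l) (\<lambda>z. f z - F l z)) \<and> mass f \<le> K * (\<Sum>l\<in>A. mass (F l))"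
proof (rule ccontr)
  assume neg: "\<not> thesis"
  note goal = that
  define solvable where "solvable A F K \<longleftrightarrow>
    (\<exists>f\<in>FS. (\<forall>l\<in>A. vanish l (m l) (\<lambda>z. f z - F l z)) \<and> mass f \<le> K * (\<Sum>l\<in>A. mass (F l)))" for A F K
  define bad where "bad B K A F \<longleftrightarrow> finite A \<and> A \<subseteq> \<Lambda> - B \<and> (\<forall>l\<in>A. F l \<in> FS) \<and> \<not> solvable A F K" for B K A F
  have "\<exists>A F. bad B K A F" if BK: "finite B" "B \<subseteq> \<Lambda>" "K \<ge> 0" for B K
  proof (rule ccontr)
    assume no: "\<not> (\<exists>A F. bad B K A F)"
    have thesis
    proof (rule goal[OF BK])
      fix A F assume "finite A" "A \<subseteq> \<Lambda> - B" "\<And>l. l \<in> A \<Longrightarrow> F l \<in> FS"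
      then have "solvable A F K" using no unfolding bad_def by blast
      then show "\<exists>f\<in>FS. (\<forall>l\<in>A. vanish l (m l) (\<lambda>z. f z - F l z)) \<and> mass f \<le> K * (\<Sum>l\<in>A. mass (F l))"
        unfolding solvable_def .
    qed
    with neg show False by contradiction
  qed
  then obtain \<A> \<F> where bad: "\<And>B K. finite B \<Longrightarrow> B \<subseteq> \<Lambda> \<Longrightarrow> K \<ge> 0 \<Longrightarrow> bad B K (\<A> B K) (\<F> B K)"
    by metis
  \<comment> \<open>Block n will be scaled to carry data of mass 2^-n, so failure with this constant
    forces every solution to have mass above n + 1.\<close>
  define k where "k n = (real n + 1) * 2 ^ n" for n :: nat
  have k0: "k n \<ge> 0" for n by (simp add: k_def)
  define Bs :: "nat \<Rightarrow> complex set" where "Bs = rec_nat {} (\<lambda>n B. B \<union> \<A> B (k n))"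
  have Bs_0: "Bs 0 = {}" and Bs_Suc: "Bs (Suc n) = Bs n \<union> \<A> (Bs n) (k n)" for n by (simp_all add: Bs_def)
  have Bs: "finite (Bs n) \<and> Bs n \<subseteq> \<Lambda>" for n
  proof (induction n)
    case (Suc n)
    then have "bad (Bs n) (k n) (\<A> (Bs n) (k n)) (\<F> (Bs n) (k n))" using bad k0 by blast
    then show ?case using Suc unfolding Bs_Suc bad_def by blast
  qed (simp add: Bs_0)
  define A where "A n = \<A> (Bs n) (k n)" for n
  define F where "F n = \<F> (Bs n) (k n)" for n
  have A: "finite (A n)" "A n \<subseteq> \<Lambda> - Bs n" "\<And>l. l \<in> A n \<Longrightarrow> F n l \<in> FS"
    "\<And>f. f \<in> FS \<Longrightarrow> (\<forall>l\<in>A n. vanish l (m l) (\<lambda>z. f z - F n l z)) \<Longrightarrow> k n * (\<Sum>l\<in>A n. mass (F n l)) < mass f" for n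
  proof -
    have "bad (Bs n) (k n) (A n) (F n)" unfolding A_def F_def using bad Bs k0 by blast
    then have *: "finite (A n)" "A n \<subseteq> \<Lambda> - Bs n" "\<forall>l\<in>A n. F n l \<in> FS" "\<not> solvable (A n) (F n) (k n)"
      unfolding bad_def by blast+
    show "finite (A n)" "A n \<subseteq> \<Lambda> - Bs n" by (fact *(1), fact *(2))
    show "F n l \<in> FS" if "l \<in> A n" for l using *(3) that by blast
    show "k n * (\<Sum>l\<in>A n. mass (F n l)) < mass f"
      if "f \<in> FS" "\<forall>l\<in>A n. vanish l (m l) (\<lambda>z. f z - F n l z)" for f
    proof (rule ccontr)
      assume "\<not> ?thesis"
      then have "mass f \<le> k n * (\<Sum>l\<in>A n. mass (F n l))" by simp
      with that have "solvable (A n) (F n) (k n)" unfolding solvable_def by blast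
      with *(4) show False by contradiction
    qed
  qed
  have mono: "Bs i \<subseteq> Bs j" if "i \<le> j" for i j
    using that by (induction rule: dec_induct) (auto simp: Bs_Suc)
  have AB: "A i \<subseteq> Bs j" if "i < j" for i j
    using mono[of "Suc i" j] that by (auto simp: Bs_Suc A_def)
  have disj: "i = j" if "l \<in> A i" "l \<in> A j" for l i j
    using AB[of i j] AB[of j i] A(2)[of i] A(2)[of j] that by (metis DiffD2 linorder_neqE_nat subsetD)
  define \<sigma> where "\<sigma> n = (\<Sum>l\<in>A n. mass (F n l))" for n
  \<comment> \<open>Needed for the scaling; zero data could not be bad, as the zero function would
    solve them.\<close>
  have \<sigma>: "\<sigma> n > 0" for n
  proof (rule ccontr)
    assume "\<not> \<sigma> n > 0"
    moreover have "\<sigma> n \<ge> 0" unfolding \<sigma>_def by (simp add: sum_nonneg)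
    ultimately have s0: "\<sigma> n = 0" by simp
    then have "mass (F n l) = 0" if "l \<in> A n" for l
      using sum_nonneg_eq_0_iff[OF A(1), of n "\<lambda>l. mass (F n l)"] that by (simp add: \<sigma>_def)
    then have "F n l = (\<lambda>z. 0)" if "l \<in> A n" for l using mass_eq_0[OF A(3)[OF that]] that by blast
    then have "\<forall>l\<in>A n. vanish l (m l) (\<lambda>z. 0 - F n l z)" by (simp add: vanish_zero)
    from A(4)[OF FS_zero this] s0 show False by (simp add: \<sigma>_def)
  qed
  \<comment> \<open>The scaling that brings block n to total mass 2^-n.\<close>
  define t where "t n = (1 / (2 ^ n * \<sigma> n)) powr (1 / p)" for n
  have t: "t n > 0" "t n powr p = 1 / (2 ^ n * \<sigma> n)" for n
    using \<sigma>[of n] p2 by (auto simp: t_def powr_powr)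
  define x where "x l = (if \<exists>n. l \<in> A n then (\<lambda>z. of_real (t (THE n. l \<in> A n)) * F (THE n. l \<in> A n) l z) else (\<lambda>z. 0))" for l
  have xA: "x l = (\<lambda>z. of_real (t n) * F n l z)" if "l \<in> A n" for l n
  proof -
    have "(THE n. l \<in> A n) = n" by (rule the_equality) (use that disj in auto)
    then show ?thesis using that by (auto simp: x_def)
  qed
  have xF: "x l \<in> FS" for l
  proof (cases "\<exists>n. l \<in> A n")
    case True
    then obtain n where n: "l \<in> A n" ..
    show ?thesis unfolding xA[OF n] by (rule FS_cmult[OF A(3)[OF n]])
  qed (simp add: x_def)
  have mx: "mass (x l) = t n powr p * mass (F n l)" if "l \<in> A n" for l n
    unfolding xA[OF that] mass_cmult using t(1)[of n] by simp
  have block: "(\<Sum>l\<in>A n. mass (x l)) = (1 / 2) ^ n" for n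
  proof -
    have "(\<Sum>l\<in>A n. mass (x l)) = t n powr p * \<sigma> n" unfolding \<sigma>_def sum_distrib_left by (intro sum.cong mx) auto
    then show ?thesis using t(2)[of n] \<sigma>[of n] by (simp add: power_divide)
  qed
  have sumBs: "(\<Sum>l\<in>Bs n. mass (x l)) \<le> 2 - 2 * (1 / 2) ^ n" for n
  proof (induction n)
    case (Suc n)
    have "(\<Sum>l\<in>Bs (Suc n). mass (x l)) = (\<Sum>l\<in>Bs n. mass (x l)) + (\<Sum>l\<in>A n. mass (x l))"
      unfolding Bs_Suc A_def[symmetric] using A(1,2)[of n] Bs[of n] by (intro sum.union_disjoint) auto
    then show ?case using Suc.IH block[of n] by simp
  qed (simp add: Bs_0)
  have bound: "(\<Sum>l\<in>S. mass (x l)) \<le> 2" if S: "finite S" for S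
  proof -
    \<comment> \<open>S is finite, so every block that it meets has been collected before stage N;
      points outside all blocks carry the zero datum.\<close>
    define N where "N = Suc (Max (insert 0 ((\<lambda>l. LEAST n. l \<in> A n) ` S)))"
    have "mass (x l) = 0" if "l \<in> S - Bs N" for l
    proof -
      have "\<not> (\<exists>n. l \<in> A n)"
      proof
        assume "\<exists>n. l \<in> A n"
        then have "l \<in> A (LEAST n. l \<in> A n)" by (rule LeastI_ex)
        moreover have "(LEAST n. l \<in> A n) < N" unfolding N_def less_Suc_eq_le using S that by (intro Max_ge) auto
        ultimately show False using AB that by blast
      qed
      then show ?thesis by (simp add: x_def)
    qed
    then have "(\<Sum>l\<in>S. mass (x l)) = (\<Sum>l\<in>S \<inter> Bs N. mass (x l))"
      using S by (intro sum.mono_neutral_right) auto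
    also have "\<dots> \<le> (\<Sum>l\<in>Bs N. mass (x l))" using Bs[of N] by (intro sum_mono2) auto
    also have "\<dots> \<le> 2"
    proof -
      have "(0::real) \<le> (1 / 2) ^ N" by simp
      with sumBs[of N] show ?thesis by linarith
    qed
    finally show ?thesis .
  qed
  have q: "quotient_norm p \<alpha> m l (x l) powr p \<le> mass (x l)" for l
    by (rule quotient_le_mass[OF xF xF]) (simp add: vanish_zero)
  have "(\<lambda>l. quotient_norm p \<alpha> m l (x l) powr p) summable_on \<Lambda>"
  proof (rule nonneg_bdd_above_summable_on)
    show "bdd_above (sum (\<lambda>l. quotient_norm p \<alpha> m l (x l) powr p) ` {F. F \<subseteq> \<Lambda> \<and> finite F})"
    proof (rule bdd_aboveI2)
      fix S assume "S \<in> {F. F \<subseteq> \<Lambda> \<and> finite F}"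
      then show "(\<Sum>l\<in>S. quotient_norm p \<alpha> m l (x l) powr p) \<le> 2"
        using order_trans[OF sum_mono[OF q] bound[of S]] by simp
    qed
  qed simp
  then have "admissible_data p \<alpha> \<Lambda> m x" using xF by (simp add: admissible_data_def)
  then obtain f where "interpolates p \<alpha> \<Lambda> m x f" using int unfolding interpolating_def by blast
  then have f: "f \<in> FS" "\<And>l. l \<in> \<Lambda> \<Longrightarrow> vanish l (m l) (\<lambda>z. f z - x l z)" by (auto simp: interpolates_iff)
  have big: "real n + 1 < mass f" for n
  proof -
    define g where "g z = of_real (1 / t n) * f z" for z
    have gF: "g \<in> FS" unfolding g_def by (rule FS_cmult[OF f(1)])
    have "vanish l (m l) (\<lambda>z. g z - F n l z)" if l: "l \<in> A n" for l
    proof -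
      have "vanish l (m l) (\<lambda>z. of_real (1 / t n) * (f z - x l z))"
        using l A(2)[of n] by (intro vanish_cmult f(2)) auto
      also have "(\<lambda>z. of_real (1 / t n) * (f z - x l z)) = (\<lambda>z. g z - F n l z)"
        unfolding xA[OF l] g_def using t(1)[of n] by (simp add: fun_eq_iff field_simps)
      finally show ?thesis .
    qed
    then have "k n * \<sigma> n < mass g" unfolding \<sigma>_def using A(4)[OF gF] by blast
    also have "mass g = (1 / t n) powr p * mass f" unfolding g_def mass_cmult using t(1)[of n] by (simp add: norm_divide)
    also have "(1 / t n) powr p = 2 ^ n * \<sigma> n" using t[of n] by (simp add: powr_divide)
    finally have "(real n + 1) * (2 ^ n * \<sigma> n) < mass f * (2 ^ n * \<sigma> n)" by (simp add: k_def mult_ac)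
    then show ?thesis using \<sigma>[of n] by (simp add: mult_less_cancel_right)
  qed
  obtain n where "mass f < real n" using reals_Archimedean2 by blast
  with big[of n] show False by simp
qed


text \<open>Boundedness on the tail and on the finite exceptional part are combined: first solve off
  B, then correct on B by a function that vanishes on the rest of the divisor.\<close>

lemma interpolation_bounded:
  assumes div: "divisor \<Lambda> m" and int: "interpolating p \<alpha> \<Lambda> m"
  obtains K where "K \<ge> 0"
    "\<And>F. admissible_data p \<alpha> \<Lambda> m F \<Longrightarrow> \<exists>f. interpolates p \<alpha> \<Lambda> m F f \<and>
       mass f \<le> K * (\<Sum>\<^sub>\<infinity>l\<in>\<Lambda>. quotient_norm p \<alpha> m l (F l) powr p)"
proof -
  obtain B K where B: "finite B" "B \<subseteq> \<Lambda>" "K \<ge> 0"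
    "\<And>A F. \<lbrakk>finite A; A \<subseteq> \<Lambda> - B; \<And>l. l \<in> A \<Longrightarrow> F l \<in> FS\<rbrakk>
      \<Longrightarrow> \<exists>f\<in>FS. (\<forall>l\<in>A. vanish l (m l) (\<lambda>z. f z - F l z)) \<and> mass f \<le> K * (\<Sum>l\<in>A. mass (F l))"
  proof (rule tail_bounded[OF int], goal_cases)
    case (1 B K)
    show ?case by (rule 1(1)[OF 1(2) 1(3) 1(4) 1(5)])
  qed
  obtain K' where K': "K' \<ge> 0"
    "\<And>F. (\<And>l. l \<in> B \<Longrightarrow> F l \<in> FS) \<Longrightarrow> \<exists>f\<in>FS. (\<forall>l\<in>B. vanish l (m l) (\<lambda>z. f z - F l z))
       \<and> (\<forall>l\<in>\<Lambda> - B. vanish l (m l) f) \<and> mass f \<le> K' * (\<Sum>l\<in>B. mass (F l))"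
  proof (rule finite_part_bounded[OF int B(1,2)], goal_cases)
    case (1 K)
    show ?case by (rule 1(1)[OF 1(2) 1(3)])
  qed
  define D where "D = 2 powr p * (K + K' * (2 powr p * (1 + real (card B) * K)))"
  have D0: "D \<ge> 0" unfolding D_def using B(3) K'(1) by simp
  show ?thesis
  proof (rule that)
    show "D * 2 powr p \<ge> 0" using D0 by simp
    fix F assume adm: "admissible_data p \<alpha> \<Lambda> m F"
    then have F: "\<And>l. l \<in> \<Lambda> \<Longrightarrow> F l \<in> FS" by (auto simp: admissible_data_def)
    obtain G where G: "\<And>l. l \<in> \<Lambda> \<Longrightarrow> G l \<in> FS" "\<And>l. l \<in> \<Lambda> \<Longrightarrow> vanish l (m l) (\<lambda>z. G l z - F l z)"
      "(\<lambda>l. mass (G l)) summable_on \<Lambda>"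
      "(\<Sum>\<^sub>\<infinity>l\<in>\<Lambda>. mass (G l)) \<le> 2 powr p * (\<Sum>\<^sub>\<infinity>l\<in>\<Lambda>. quotient_norm p \<alpha> m l (F l) powr p)"
      by (rule admissible_representatives[OF adm]) blast
    define T where "T = (\<Sum>\<^sub>\<infinity>l\<in>\<Lambda>. mass (G l))"
    have T: "(\<Sum>l\<in>A. mass (G l)) \<le> T" if "finite A" "A \<subseteq> \<Lambda>" for A
      unfolding T_def using finite_sum_le_infsum[OF G(3) that] by simp
    have T0: "T \<ge> 0" using T[of "{}"] by simp
    have "\<exists>f\<in>FS. (\<forall>l\<in>\<Lambda> - B. vanish l (m l) (\<lambda>z. f z - G l z)) \<and> mass f \<le> K * T"
    proof (rule compact_interpolation)
      show "countable (\<Lambda> - B)" using div by (auto simp: divisor_def)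
      fix A assume A: "finite A" "A \<subseteq> \<Lambda> - B"
      have "\<exists>f\<in>FS. (\<forall>l\<in>A. vanish l (m l) (\<lambda>z. f z - G l z)) \<and> mass f \<le> K * (\<Sum>l\<in>A. mass (G l))"
        using A G(1) by (intro B(4)) auto
      moreover have "K * (\<Sum>l\<in>A. mass (G l)) \<le> K * T" using T[of A] A B(3) by (intro mult_left_mono) auto
      ultimately show "\<exists>f\<in>FS. (\<forall>l\<in>A. vanish l (m l) (\<lambda>z. f z - G l z)) \<and> mass f \<le> K * T"
        by (meson order_trans)
    qed (use G in auto)
    then obtain f1 where f1: "f1 \<in> FS" "\<And>l. l \<in> \<Lambda> - B \<Longrightarrow> vanish l (m l) (\<lambda>z. f1 z - G l z)" "mass f1 \<le> K * T"
      by blast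
    have GB: "G l \<in> FS" if "l \<in> B" for l using G(1) B(2) that by blast
    have dF: "(\<lambda>z. G l z - f1 z) \<in> FS" if "l \<in> B" for l by (rule FS_diff(1)[OF GB[OF that] f1(1)])
    \<comment> \<open>The correction interpolates the error of f1 on B and leaves the conditions off
      B intact.\<close>
    obtain f2 where f2: "f2 \<in> FS" "\<And>l. l \<in> B \<Longrightarrow> vanish l (m l) (\<lambda>z. f2 z - (G l z - f1 z))"
      "\<And>l. l \<in> \<Lambda> - B \<Longrightarrow> vanish l (m l) f2" "mass f2 \<le> K' * (\<Sum>l\<in>B. mass (\<lambda>z. G l z - f1 z))"
      using K'(2)[of "\<lambda>l z. G l z - f1 z", OF dF] by blast
    define f where "f z = f1 z + f2 z" for z
    have fF: "f \<in> FS" unfolding f_def by (rule FS_add(1)[OF f1(1) f2(1)])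
    have fv: "vanish l (m l) (\<lambda>z. f z - G l z)" if "l \<in> \<Lambda>" for l
    proof (cases "l \<in> B")
      case True
      then show ?thesis using f2(2)[OF True] by (simp add: f_def algebra_simps)
    next
      case False
      then show ?thesis using vanish_add[OF f1(2) f2(3), of l] that by (simp add: f_def algebra_simps)
    qed
    have mf2: "mass f2 \<le> K' * (2 powr p * (1 + real (card B) * K) * T)"
    proof (rule order_trans[OF f2(4)], intro mult_left_mono K'(1))
      have "(\<Sum>l\<in>B. mass (\<lambda>z. G l z - f1 z)) \<le> (\<Sum>l\<in>B. 2 powr p * (mass (G l) + K * T))"
      proof (intro sum_mono)
        fix l assume l: "l \<in> B"
        have "mass (\<lambda>z. G l z - f1 z) \<le> 2 powr p * (mass (G l) + mass f1)" by (rule FS_diff(2)[OF GB[OF l] f1(1)])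
        also have "\<dots> \<le> 2 powr p * (mass (G l) + K * T)" using f1(3) by (intro mult_left_mono add_left_mono) auto
        finally show "mass (\<lambda>z. G l z - f1 z) \<le> 2 powr p * (mass (G l) + K * T)" .
      qed
      also have "\<dots> = 2 powr p * ((\<Sum>l\<in>B. mass (G l)) + real (card B) * (K * T))"
        by (simp add: sum_distrib_left[symmetric] sum.distrib)
      also have "\<dots> \<le> 2 powr p * (T + real (card B) * (K * T))"
        using T[OF B(1,2)] by (intro mult_left_mono add_right_mono) auto
      also have "\<dots> = 2 powr p * (1 + real (card B) * K) * T" by (simp add: algebra_simps)
      finally show "(\<Sum>l\<in>B. mass (\<lambda>z. G l z - f1 z)) \<le> 2 powr p * (1 + real (card B) * K) * T" .
    qed
    have "mass f \<le> 2 powr p * (mass f1 + mass f2)" unfolding f_def by (rule FS_add(2)[OF f1(1) f2(1)])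
    also have "\<dots> \<le> 2 powr p * (K * T + K' * (2 powr p * (1 + real (card B) * K) * T))"
      by (intro mult_left_mono add_mono f1(3) mf2) auto
    also have "\<dots> = D * T" by (simp add: D_def algebra_simps)
    also have "\<dots> \<le> D * (2 powr p * (\<Sum>\<^sub>\<infinity>l\<in>\<Lambda>. quotient_norm p \<alpha> m l (F l) powr p))"
      using G(4) D0 unfolding T_def by (intro mult_left_mono) auto
    finally have mf: "mass f \<le> D * 2 powr p * (\<Sum>\<^sub>\<infinity>l\<in>\<Lambda>. quotient_norm p \<alpha> m l (F l) powr p)"
      by (simp add: mult.assoc)
    have "interpolates p \<alpha> \<Lambda> m F f"
      by (rule interpolatesI[OF fF F]) (use vanish_trans[OF fv G(2)] in auto)
    with mf show "\<exists>f. interpolates p \<alpha> \<Lambda> m F f \<and>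
       mass f \<le> D * 2 powr p * (\<Sum>\<^sub>\<infinity>l\<in>\<Lambda>. quotient_norm p \<alpha> m l (F l) powr p)" by blast
  qed
qed

text \<open>Boundedness makes the set under the infimum nonempty, so the infimum is approached by
  admissible constants. A slack of 1 is enough for the separation argument, which only needs a bound
  determined by the interpolation constant.\<close>

lemma interpolation_constant_attained:
  assumes div: "divisor \<Lambda> m" and int: "interpolating p \<alpha> \<Lambda> m"
  shows "\<exists>C. 0 \<le> C \<and> C < interpolation_constant p \<alpha> \<Lambda> m + 1 \<and>
    (\<forall>F. admissible_data p \<alpha> \<Lambda> m F \<longrightarrow> (\<exists>f. interpolates p \<alpha> \<Lambda> m F f \<and>
      fock_norm p \<alpha> f \<le> C * (\<Sum>\<^sub>\<infinity>l\<in>\<Lambda>. quotient_norm p \<alpha> m l (F l) powr p) powr (1 / p)))"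
proof -
  define S where "S = {C. 0 \<le> C \<and>
     (\<forall>F. admissible_data p \<alpha> \<Lambda> m F \<longrightarrow>
       (\<exists>f. interpolates p \<alpha> \<Lambda> m F f \<and>
         fock_norm p \<alpha> f \<le> C * (\<Sum>\<^sub>\<infinity>l\<in>\<Lambda>. quotient_norm p \<alpha> m l (F l) powr p) powr (1 / p)))}"
  obtain K where K: "K \<ge> 0"
    "\<And>F. admissible_data p \<alpha> \<Lambda> m F \<Longrightarrow> \<exists>f. interpolates p \<alpha> \<Lambda> m F f \<and>
       mass f \<le> K * (\<Sum>\<^sub>\<infinity>l\<in>\<Lambda>. quotient_norm p \<alpha> m l (F l) powr p)"
  proof (rule interpolation_bounded[OF div int], goal_cases)
    case (1 K)
    show ?case by (rule 1(1)[OF 1(2) 1(3)])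
  qed
  have "K powr (1 / p) \<in> S" unfolding S_def
  proof (intro CollectI conjI allI impI)
    fix F assume adm: "admissible_data p \<alpha> \<Lambda> m F"
    define q where "q = (\<Sum>\<^sub>\<infinity>l\<in>\<Lambda>. quotient_norm p \<alpha> m l (F l) powr p)"
    have q0: "q \<ge> 0" unfolding q_def by (rule infsum_nonneg) simp
    obtain f where f: "interpolates p \<alpha> \<Lambda> m F f" "mass f \<le> K * q" using K(2)[OF adm] unfolding q_def by blast
    have "mass f powr (1 / p) \<le> (K * q) powr (1 / p)" using f(2) p2 by (intro powr_mono2) auto
    then have "fock_norm p \<alpha> f \<le> K powr (1 / p) * q powr (1 / p)"
      unfolding fock_norm_eq using K(1) q0 by (simp add: powr_mult)
    then show "\<exists>f. interpolates p \<alpha> \<Lambda> m F f \<and>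
      fock_norm p \<alpha> f \<le> K powr (1 / p) * (\<Sum>\<^sub>\<infinity>l\<in>\<Lambda>. quotient_norm p \<alpha> m l (F l) powr p) powr (1 / p)"
      using f(1) unfolding q_def by blast
  qed simp
  then have "Inf S < Inf S + 1" "S \<noteq> {}" by auto
  from cInf_lessD[OF this(2) this(1)] obtain C where "C \<in> S" "C < Inf S + 1" by blast
  then show ?thesis unfolding interpolation_constant_def S_def by blast
qed

lemma necessity_constant:
  "\<exists>c>0. \<forall>\<Lambda> m. divisor \<Lambda> m \<and> interpolating p \<alpha> \<Lambda> m \<and> interpolation_constant p \<alpha> \<Lambda> m = M \<longrightarrow>
     disjoint_family_on (\<lambda>l. ball l (sqrt (real (m l) / \<alpha>) - c)) \<Lambda>"
proof -
  \<comment> \<open>Bounds the p-th power of the norm of an interpolant for coherent data; the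
    absolute value makes the bound meaningful for every real M, since the final constant is a
    function on all reals.\<close>
  define B where "B = (\<bar>M\<bar> + 1) powr p * mass (\<lambda>_. 1)"
  have "B \<ge> 0" by (simp add: B_def)
  then obtain c where c: "c > 0"
    "\<And>l m l' m' w f. \<lbrakk>f \<in> FS; mass f \<le> B; vanish l m (\<lambda>z. f z - coherent w z); vanish l' m' f;
      cmod (w - l) \<le> sqrt (real m / \<alpha>) - c; cmod (w - l') \<le> sqrt (real m' / \<alpha>) - c\<rbrakk> \<Longrightarrow> False"
    by (rule separation_constant) blast
  have "disjoint_family_on (\<lambda>l. ball l (sqrt (real (m l) / \<alpha>) - c)) \<Lambda>"
    if div: "divisor \<Lambda> m" and int: "interpolating p \<alpha> \<Lambda> m" and M: "interpolation_constant p \<alpha> \<Lambda> m = M" for \<Lambda> m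
    unfolding disjoint_family_on_def
  proof (intro ballI impI)
    fix l l' assume l: "l \<in> \<Lambda>" "l' \<in> \<Lambda>" "l \<noteq> l'"
    show "ball l (sqrt (real (m l) / \<alpha>) - c) \<inter> ball l' (sqrt (real (m l') / \<alpha>) - c) = {}"
    proof (rule ccontr)
      assume "ball l (sqrt (real (m l) / \<alpha>) - c) \<inter> ball l' (sqrt (real (m l') / \<alpha>) - c) \<noteq> {}"
      then obtain w where "w \<in> ball l (sqrt (real (m l) / \<alpha>) - c)" "w \<in> ball l' (sqrt (real (m l') / \<alpha>) - c)" by blast
      then have w: "cmod (w - l) \<le> sqrt (real (m l) / \<alpha>) - c" "cmod (w - l') \<le> sqrt (real (m l') / \<alpha>) - c"
        by (simp_all add: dist_norm norm_minus_commute)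
      \<comment> \<open>The kernel at w is prescribed at l and zero at all other points, in
        particular at l'. Both discs contain w at depth c, so an interpolant of controlled norm
        contradicts the choice of c.\<close>
      define F where "F = (\<lambda>k. if k = l then coherent w else (\<lambda>z. 0))"
      obtain C where C: "0 \<le> C" "C < M + 1"
        "\<And>F. admissible_data p \<alpha> \<Lambda> m F \<Longrightarrow> (\<exists>f. interpolates p \<alpha> \<Lambda> m F f \<and>
          fock_norm p \<alpha> f \<le> C * (\<Sum>\<^sub>\<infinity>l\<in>\<Lambda>. quotient_norm p \<alpha> m l (F l) powr p) powr (1 / p))"
        using interpolation_constant_attained[OF div int] unfolding M by blast
      note adm = point_data_admissible[OF l(1) coherent(1)[of w], where m=m, folded F_def]
      define q where "q = (\<Sum>\<^sub>\<infinity>k\<in>\<Lambda>. quotient_norm p \<alpha> m k (F k) powr p)"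
      have q: "0 \<le> q" "q \<le> mass (\<lambda>_. 1)"
        using adm(2) coherent(2)[of w] unfolding q_def F_def by (auto intro!: infsum_nonneg)
      obtain f where f: "interpolates p \<alpha> \<Lambda> m F f" "fock_norm p \<alpha> f \<le> C * q powr (1 / p)"
        using C(3)[OF adm(1)] unfolding q_def by blast
      have "fock_norm p \<alpha> f powr p \<le> (C * q powr (1 / p)) powr p" using f(2) p2 by (intro powr_mono2) auto
      also have "\<dots> = C powr p * q" using C(1) q(1) p2 by (simp add: powr_mult powr_powr)
      also have "\<dots> \<le> (\<bar>M\<bar> + 1) powr p * mass (\<lambda>_. 1)"
        using C q p2 by (intro mult_mono powr_mono2) auto
      finally have mf: "mass f \<le> B" unfolding fock_norm_powr B_def .
      have fF: "f \<in> FS" and v: "vanish l (m l) (\<lambda>z. f z - F l z)" "vanish l' (m l') (\<lambda>z. f z - F l' z)"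
        using f(1) l by (auto simp: interpolates_iff)
      have v1: "vanish l (m l) (\<lambda>z. f z - coherent w z)" and v2: "vanish l' (m l') f"
        using v l(3) by (simp_all add: F_def)
      show False by (rule c(2)[OF fF mf v1 v2 w])
    qed
  qed
  then show ?thesis using c(1) by blast
qed

end

theorem theorem8p2:
  fixes p \<alpha> :: real
  assumes "2 < p" and "0 < \<alpha>"
  shows "(\<exists>C :: real \<Rightarrow> real. (\<forall>M. C M > 0) \<and>
           (\<forall>(\<Lambda> :: complex set) (m :: complex \<Rightarrow> nat).
              divisor \<Lambda> m \<and> interpolating p \<alpha> \<Lambda> m \<longrightarrow>
              (let c = C (interpolation_constant p \<alpha> \<Lambda> m) in
               disjoint_family_on (\<lambda>l. ball l (sqrt (real (m l) / \<alpha>) - c))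
                 {l \<in> \<Lambda>. real (m l) > \<alpha> * c\<^sup>2})))
       \<and> (\<exists>C0 :: real. C0 > 0 \<and>
           (\<forall>(\<Lambda> :: complex set) (m :: complex \<Rightarrow> nat).
              divisor \<Lambda> m \<and>
              disjoint_family_on (\<lambda>l. ball l (sqrt (real (m l) / \<alpha>) + C0)) \<Lambda> \<longrightarrow>
              interpolating p \<alpha> \<Lambda> m))"
proof -
  interpret fock p \<alpha> by unfold_locales (use assms in auto)
  obtain C :: "real \<Rightarrow> real" where C: "\<And>M. C M > 0"
    "\<And>M \<Lambda> m. divisor \<Lambda> m \<Longrightarrow> interpolating p \<alpha> \<Lambda> m \<Longrightarrow> interpolation_constant p \<alpha> \<Lambda> m = M \<Longrightarrow>
       disjoint_family_on (\<lambda>l. ball l (sqrt (real (m l) / \<alpha>) - C M)) \<Lambda>"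
    using necessity_constant by metis
  show ?thesis
  proof (rule conjI[OF _ sufficiency])
    show "\<exists>C :: real \<Rightarrow> real. (\<forall>M. C M > 0) \<and>
           (\<forall>(\<Lambda> :: complex set) (m :: complex \<Rightarrow> nat).
              divisor \<Lambda> m \<and> interpolating p \<alpha> \<Lambda> m \<longrightarrow>
              (let c = C (interpolation_constant p \<alpha> \<Lambda> m) in
               disjoint_family_on (\<lambda>l. ball l (sqrt (real (m l) / \<alpha>) - c))
                 {l \<in> \<Lambda>. real (m l) > \<alpha> * c\<^sup>2}))"
      unfolding Let_def
    proof (intro exI[of _ C] conjI allI impI C(1))
      fix \<Lambda> m assume "divisor \<Lambda> m \<and> interpolating p \<alpha> \<Lambda> m"
      then have "disjoint_family_on (\<lambda>l. ball l (sqrt (real (m l) / \<alpha>) - C (interpolation_constant p \<alpha> \<Lambda> m))) \<Lambda>"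
        using C(2) by blast
      then show "disjoint_family_on (\<lambda>l. ball l (sqrt (real (m l) / \<alpha>) - C (interpolation_constant p \<alpha> \<Lambda> m)))
          {l \<in> \<Lambda>. real (m l) > \<alpha> * (C (interpolation_constant p \<alpha> \<Lambda> m))\<^sup>2}"
        by (rule disjoint_family_on_mono[rotated]) auto
    qed
  qed
qed

end
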